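(* Let $m_1,m_2\in\mathbb Z_{\ge 0}$, let $\lambda=(m_1+m_2)\epsilon_1+m_2\epsilon_2$, also regarded as the partition $(m_1+m_2,m_2)$, and let $L(\lambda)$ be the finite dimensional irreducible representation of $\mathfrak{spo}(4|1)$ over $\mathbb C$ with highest weight $\lambda$ and nonzero highest weight vector $v_\lambda$. Let $$H=\left\{ f_1^{b_4} f_2^{b_3} f_1^{b_2} f_2^{b_1} v_\lambda \;\middle|\; \begin{aligned} & b_1,b_2,b_3,b_4\in\mathbb Z_{\ge 0},\quad 0\le b_1\le 2m_2,\quad 0\le b_2\le m_1+b_1,\\ & 0\le b_3\le \min\{b_2+m_1,\,2b_2\},\quad 0\le b_4\le \min\{m_1,\tfrac12 b_3\}\end{aligned}\right\}\subset L(\lambda)$$ be the system of Verma vectors of $L(\lambda)$. Then: (i) there exists a weight-preserving one-to-one correspondence between $H$ and the set $\mathrm{KN}_\lambda(4|1)$ of Kashiwara-Nakashima tableaux of $\mathfrak{spo}(4|1)$ of shape $\lambda$; (ii) $H$ is a basis of $L(\lambda)$.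
   Context: The Lie superalgebra $\mathfrak{spo}(4|1)$ is the set of complex $5\times5$ matrices of the form $$\begin{pmatrix} a_{11}&a_{12}&b_{11}&b_{12}&p_1\\ a_{21}&a_{22}&b_{12}&b_{22}&p_2\\ c_{11}&c_{12}&-a_{11}&-a_{21}&q_1\\ c_{12}&c_{22}&-a_{12}&-a_{22}&q_2\\ -q_1&-q_2&p_1&p_2&0\end{pmatrix},$$ with the supercommutator as bracket; the even part ($\cong\mathfrak{sp}_4$) is given by $p_1=p_2=q_1=q_2=0$, the odd part by the vanishing of all $a_{ij},b_{ij},c_{ij}$. Let $E_{ij}$ be the matrix units. The Cartan subalgebra $\mathfrak h$ is spanned by $H_1=E_{11}-E_{33}$, $H_2=E_{22}-E_{44}$, and $\epsilon_1,\epsilon_2\in\mathfrak h^*$ is the dual basis, $\epsilon_i(H_j)=\delta_{ij}$. The simple roots are $\alpha_1=\epsilon_1-\epsilon_2$ (even) and $\alpha_2=\epsilon_2$ (odd); the positive even roots are $\epsilon_1\pm\epsilon_2,2\epsilon_1,2\epsilon_2$ and the positive odd roots are $\epsilon_1,\epsilon_2$. The negative simple root vectors are $f_1=E_{21}-E_{34}$ (root $\epsilon_2-\epsilon_1$) and $f_2=E_{52}-E_{45}$ (root $-\epsilon_2$). With fundamental weights $\omega_1=\epsilon_1$, $\omega_2=\frac12(\epsilon_1+\epsilon_2)$ one has $\lambda=m_1\omega_1+2m_2\omega_2$; these are exactly the highest weights of the finite dimensional irreducible modules. Kashiwara-Nakashima (KN) tableaux. Let $\mathcal N=\{1,2,0,\overline2,\overline1\}$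 with the order $1<2<0<\overline2<\overline1$. For a partition $\lambda=(\lambda_1,\lambda_2)$ with at most two parts, a KN tableau $T$ of $\mathfrak{spo}(4|1)$ of shape $\lambda$ is a filling of the Young diagram of shape $\lambda$ (left-justified rows, $\lambda_i$ boxes in row $i$) with entries in $\mathcal N$ such that: (1) entries are weakly increasing from left to right along each row, with $0$ not allowed to repeat in a row; entries are strictly increasing down each column, except that $0$ may repeat in a column; (2) $1$ and $\overline1$ do not appear in the same column; (3) there are no two adjacent columns such that the left column has entry $2$ in the first row and the right column has entry $\overline2$ in the second row, and no two adjacent columns such that the left column has entry $0$ in the first row and the right column has entry $\overline2$ in the second row. The set of these tableaux is $\mathrm{KN}_\lambda(4|1)$. The weight of $T$ is $\mathrm{wt}(T)=\sum_{i=1}^2(k_i-k_{\overline i})\epsilon_i$, where $k_i$ (resp. $k_{\overline i}$) is the number of entries of $T$ equal to $i$ (resp. $\overline i$). "Weight-preserving" means that the $\mathfrak h$-weight of a vector in $H$ equals the weight of the corresponding tableau. *)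

theory Defs
  imports "HOL-Analysis.Analysis" "HOL-Library.FuncSet"
begin

section \<open>The Lie superalgebra spo(4|1)\<close>

text \<open>
  The index type \<^typ>\<open>5\<close> has the elements 1, 2, 3, 4 and 5 = 0; the last one is the odd basis
  vector of the natural module. Parities are truth values: \<^term>\<open>False\<close> is even and
  \<^term>\<open>True\<close> is odd, so that the sum of two parities is \<open>\<noteq>\<close>.
\<close>

type_synonym mat5 = "complex^5^5"

definition mat_scale :: "complex \<Rightarrow> mat5 \<Rightarrow> mat5" where
  "mat_scale c X = map_matrix ((*) c) X"

definition mat_unit :: "5 \<Rightarrow> 5 \<Rightarrow> mat5" where
  "mat_unit i j = (\<chi> k l. if k = i \<and> l = j then 1 else 0)"

definition spo_matrix ::
  "complex \<Rightarrow> complex \<Rightarrow> complex \<Rightarrow> complex \<Rightarrow> complex \<Rightarrow> complex \<Rightarrow> complex \<Rightarrow>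
   complex \<Rightarrow> complex \<Rightarrow> complex \<Rightarrow> complex \<Rightarrow> complex \<Rightarrow> complex \<Rightarrow> complex \<Rightarrow> mat5" where
  "spo_matrix a11 a12 a21 a22 b11 b12 b22 c11 c12 c22 p1 p2 q1 q2 = vector
    [vector [a11, a12, b11, b12, p1],
     vector [a21, a22, b12, b22, p2],
     vector [c11, c12, - a11, - a21, q1],
     vector [c12, c22, - a12, - a22, q2],
     vector [- q1, - q2, p1, p2, 0]]"

definition spo :: "mat5 set" where
  "spo = {spo_matrix a11 a12 a21 a22 b11 b12 b22 c11 c12 c22 p1 p2 q1 q2
    | a11 a12 a21 a22 b11 b12 b22 c11 c12 c22 p1 p2 q1 q2. True}"

definition spo_part :: "bool \<Rightarrow> mat5 set" where
  "spo_part p =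
    (if p then {spo_matrix 0 0 0 0 0 0 0 0 0 0 p1 p2 q1 q2 | p1 p2 q1 q2. True}
     else {spo_matrix a11 a12 a21 a22 b11 b12 b22 c11 c12 c22 0 0 0 0
       | a11 a12 a21 a22 b11 b12 b22 c11 c12 c22. True})"

definition even_part :: "mat5 \<Rightarrow> mat5" where
  "even_part X = (\<chi> i j. if (i = 5) = (j = 5) then X $ i $ j else 0)"

definition odd_part :: "mat5 \<Rightarrow> mat5" where
  "odd_part X = (\<chi> i j. if (i = 5) = (j = 5) then 0 else X $ i $ j)"

text \<open>
  The bilinear extension of \<open>[X, Y] = XY - (-1)\<^bsup>|X||Y|\<^esup> YX\<close> from homogeneous to
  arbitrary matrices.
\<close>

definition supercommutator :: "mat5 \<Rightarrow> mat5 \<Rightarrow> mat5" where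
  "supercommutator X Y = X ** Y -
    (even_part Y ** even_part X + even_part Y ** odd_part X
     + odd_part Y ** even_part X - odd_part Y ** odd_part X)"

definition H1 :: mat5 where "H1 = mat_unit 1 1 - mat_unit 3 3"
definition H2 :: mat5 where "H2 = mat_unit 2 2 - mat_unit 4 4"

definition cartan :: "mat5 set" where
  "cartan = {mat_scale a H1 + mat_scale b H2 | a b. True}"

definition f1 :: mat5 where "f1 = mat_unit 2 1 - mat_unit 3 4"
definition f2 :: mat5 where "f2 = mat_unit 5 2 - mat_unit 4 5"


section \<open>Weights and roots\<close>

text \<open>
  Weights are functionals on the Cartan subalgebra. They are represented by functions on all
  matrices, of which only the restriction to \<open>cartan\<close> is ever used.
\<close>

type_synonym weight = "mat5 \<Rightarrow> complex"

definition eps1 :: weight where "eps1 h = h $ 1 $ 1"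
definition eps2 :: weight where "eps2 h = h $ 2 $ 2"

definition weight_of :: "complex \<Rightarrow> complex \<Rightarrow> weight" where
  "weight_of x y = (\<lambda>h. x * eps1 h + y * eps2 h)"

lemma eps_dual_basis:
  "eps1 H1 = 1" "eps1 H2 = 0" "eps2 H1 = 0" "eps2 H2 = 1"
  by (simp_all add: eps1_def eps2_def H1_def H2_def mat_unit_def)

definition positive_roots :: "weight set" where
  "positive_roots =
    {weight_of 1 (-1), weight_of 1 1, weight_of 2 0, weight_of 0 2,
     weight_of 1 0, weight_of 0 1}"

definition root_space :: "weight \<Rightarrow> mat5 set" where
  "root_space \<alpha> = {X \<in> spo. \<forall>h\<in>cartan. supercommutator h X = mat_scale (\<alpha> h) X}"


section \<open>Representations\<close>

locale spo_representation = vector_space cscale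
  for cscale :: "complex \<Rightarrow> 'v::ab_group_add \<Rightarrow> 'v" +
  fixes V :: "bool \<Rightarrow> 'v set"
    and \<rho> :: "mat5 \<Rightarrow> 'v \<Rightarrow> 'v"
  assumes subspace_V: "subspace (V p)"
    and V_disjoint: "V False \<inter> V True = {0}"
    and V_sum: "\<exists>x\<in>V False. \<exists>y\<in>V True. u = x + y"
    and rho_linear: "X \<in> spo \<Longrightarrow> Vector_Spaces.linear cscale cscale (\<rho> X)"
    and rho_add: "X \<in> spo \<Longrightarrow> Y \<in> spo \<Longrightarrow> \<rho> (X + Y) u = \<rho> X u + \<rho> Y u"
    and rho_scale: "X \<in> spo \<Longrightarrow> \<rho> (mat_scale c X) u = cscale c (\<rho> X u)"
    and rho_parity: "X \<in> spo_part p \<Longrightarrow> u \<in> V q \<Longrightarrow> \<rho> X u \<in> V (p \<noteq> q)"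
    and rho_bracket: "X \<in> spo_part p \<Longrightarrow> Y \<in> spo_part q \<Longrightarrow>
      \<rho> (supercommutator X Y) u =
        (if p \<and> q then \<rho> X (\<rho> Y u) + \<rho> Y (\<rho> X u) else \<rho> X (\<rho> Y u) - \<rho> Y (\<rho> X u))"
begin

definition graded_submodule :: "'v set \<Rightarrow> bool" where
  "graded_submodule W \<longleftrightarrow>
    subspace W \<and>
    (\<forall>u\<in>W. \<exists>x \<in> W \<inter> V False. \<exists>y \<in> W \<inter> V True. u = x + y) \<and>
    (\<forall>X\<in>spo. \<forall>u\<in>W. \<rho> X u \<in> W)"

definition irreducible_rep :: bool where
  "irreducible_rep \<longleftrightarrow>
    (UNIV :: 'v set) \<noteq> {0} \<and> (\<forall>W. graded_submodule W \<longrightarrow> W = {0} \<or> W = UNIV)"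

definition finite_dim_rep :: bool where
  "finite_dim_rep \<longleftrightarrow> (\<exists>B. finite B \<and> span B = UNIV)"

end

definition weight_vector ::
  "(complex \<Rightarrow> 'v::ab_group_add \<Rightarrow> 'v) \<Rightarrow> (mat5 \<Rightarrow> 'v \<Rightarrow> 'v) \<Rightarrow> weight \<Rightarrow> 'v \<Rightarrow> bool" where
  "weight_vector cscale \<rho> \<mu> u \<longleftrightarrow> u \<noteq> 0 \<and> (\<forall>h\<in>cartan. \<rho> h u = cscale (\<mu> h) u)"

definition highest_weight_vector ::
  "(complex \<Rightarrow> 'v::ab_group_add \<Rightarrow> 'v) \<Rightarrow> (mat5 \<Rightarrow> 'v \<Rightarrow> 'v) \<Rightarrow> weight \<Rightarrow> 'v \<Rightarrow> bool" where
  "highest_weight_vector cscale \<rho> \<mu> u \<longleftrightarrow>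
    weight_vector cscale \<rho> \<mu> u \<and> (\<forall>\<alpha>\<in>positive_roots. \<forall>X\<in>root_space \<alpha>. \<rho> X u = 0)"

text \<open>
  \<open>highest_weight_irrep cscale V \<rho> \<mu> v\<close>: the module is a model of \<open>L(\<mu>)\<close>, and \<open>v\<close> is a
  highest weight vector of it.
\<close>

locale highest_weight_irrep = spo_representation cscale V \<rho>
  for cscale :: "complex \<Rightarrow> 'v::ab_group_add \<Rightarrow> 'v" and V \<rho> +
  fixes \<mu> :: weight and v :: 'v
  assumes finite_dim: "finite_dim_rep"
    and irreducible: "irreducible_rep"
    and highest_weight: "highest_weight_vector cscale \<rho> \<mu> v"

definition verma_vectors :: "(mat5 \<Rightarrow> 'v \<Rightarrow> 'v) \<Rightarrow> 'v \<Rightarrow> nat \<Rightarrow> nat \<Rightarrow> 'v set" where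
  "verma_vectors \<rho> v m1 m2 =
    {(\<rho> f1 ^^ b4) ((\<rho> f2 ^^ b3) ((\<rho> f1 ^^ b2) ((\<rho> f2 ^^ b1) v))) | b1 b2 b3 b4 :: nat.
      b1 \<le> 2 * m2 \<and> b2 \<le> m1 + b1 \<and> b3 \<le> min (b2 + m1) (2 * b2) \<and>
      real b4 \<le> min (real m1) (real b3 / 2)}"


section \<open>Kashiwara-Nakashima tableaux\<close>

datatype letter = One | Two | Zero | TwoBar | OneBar

primrec letter_rank :: "letter \<Rightarrow> nat" where
  "letter_rank One = 0"
| "letter_rank Two = 1"
| "letter_rank Zero = 2"
| "letter_rank TwoBar = 3"
| "letter_rank OneBar = 4"

instantiation letter :: linorder
begin

definition less_eq_letter :: "letter \<Rightarrow> letter \<Rightarrow> bool" where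
  "x \<le> y \<longleftrightarrow> letter_rank x \<le> letter_rank y"

definition less_letter :: "letter \<Rightarrow> letter \<Rightarrow> bool" where
  "x < y \<longleftrightarrow> letter_rank x < letter_rank y"

instance
proof
  fix x y :: letter
  show "x \<le> y \<Longrightarrow> y \<le> x \<Longrightarrow> x = y"
    by (cases x; cases y) (simp_all add: less_eq_letter_def)
qed (auto simp: less_eq_letter_def less_letter_def)

end

text \<open>
  A box is a pair (row, column), both counted from 1. A filling of a diagram is a function on its
  boxes, extended by \<^term>\<open>undefined\<close> to all other pairs.
\<close>

definition young_diagram :: "nat \<Rightarrow> nat \<Rightarrow> (nat \<times> nat) set" where
  "young_diagram l1 l2 = {(i, j). (i = 1 \<and> 1 \<le> j \<and> j \<le> l1) \<or> (i = 2 \<and> 1 \<le> j \<and> j \<le> l2)}"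

definition KN_tableaux :: "nat \<Rightarrow> nat \<Rightarrow> (nat \<times> nat \<Rightarrow> letter) set" where
  "KN_tableaux l1 l2 = {T \<in> young_diagram l1 l2 \<rightarrow>\<^sub>E UNIV.
    (\<forall>i j j'. (i, j) \<in> young_diagram l1 l2 \<longrightarrow> (i, j') \<in> young_diagram l1 l2 \<longrightarrow> j < j' \<longrightarrow>
      T (i, j) \<le> T (i, j') \<and> \<not> (T (i, j) = Zero \<and> T (i, j') = Zero)) \<and>
    (\<forall>i i' j. (i, j) \<in> young_diagram l1 l2 \<longrightarrow> (i', j) \<in> young_diagram l1 l2 \<longrightarrow> i < i' \<longrightarrow>
      T (i, j) < T (i', j) \<or> (T (i, j) = Zero \<and> T (i', j) = Zero)) \<and>
    (\<forall>i i' j. (i, j) \<in> young_diagram l1 l2 \<longrightarrow> (i', j) \<in> young_diagram l1 l2 \<longrightarrow>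
      \<not> (T (i, j) = One \<and> T (i', j) = OneBar)) \<and>
    (\<forall>j. (1, j) \<in> young_diagram l1 l2 \<longrightarrow> (2, j + 1) \<in> young_diagram l1 l2 \<longrightarrow>
      \<not> (T (1, j) = Two \<and> T (2, j + 1) = TwoBar) \<and>
      \<not> (T (1, j) = Zero \<and> T (2, j + 1) = TwoBar))}"

definition letter_count :: "nat \<Rightarrow> nat \<Rightarrow> (nat \<times> nat \<Rightarrow> letter) \<Rightarrow> letter \<Rightarrow> nat" where
  "letter_count l1 l2 T x = card {b \<in> young_diagram l1 l2. T b = x}"

definition tableau_weight :: "nat \<Rightarrow> nat \<Rightarrow> (nat \<times> nat \<Rightarrow> letter) \<Rightarrow> weight" where
  "tableau_weight l1 l2 T = weight_of
    (of_nat (letter_count l1 l2 T One) - of_nat (letter_count l1 l2 T OneBar))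
    (of_nat (letter_count l1 l2 T Two) - of_nat (letter_count l1 l2 T TwoBar))"

end

theory Submission
  imports Defs "HOL-Library.Function_Algebras"
begin

text \<open>
  In any module generated by a highest weight vector of weight \<open>\<lambda>\<close> on which \<open>f\<^sub>1\<close> and \<open>f\<^sub>2\<close> act
  locally nilpotently, the Verma vectors span: applying the strings in the order of the word
  \<open>f\<^sub>1 f\<^sub>2 f\<^sub>1 f\<^sub>2\<close>, representation theory of \<open>sl\<^sub>2\<close> shortens every string, the weights being confined
  to an octagon. Independence is checked in a tensor power of the natural module, where the Verma
  vectors of an explicit highest weight vector have triangular coordinates. The Casimir element
  forces every nonzero submodule of a highest weight module to contain the generator, so the
  submodule generated in the direct sum of this model and \<open>L(\<lambda>)\<close> is the graph of an isomorphism.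
  The tableaux are matched with the exponents by an explicit piecewise linear bijection.
\<close>


section \<open>Root vectors and their brackets\<close>

text \<open>\<open>f1 f2 f1 f2\<close> follows a reduced word of the longest Weyl group element, so
  the full strings lead from the highest weight to the lowest. Spanning rests on this. The span of
  the Verma vectors is visibly stable under \<open>e1\<close>, \<open>e2\<close> and
  \<open>f1\<close> but not under \<open>f2\<close>, so it is not seen directly to be a submodule.
  Instead it is shown to contain a lowest weight vector, from which \<open>e1\<close> and
  \<open>e2\<close> reach everything. The bounds on the first three strings are exits from the
  octagon; the bound on the fourth holds only modulo vectors with a shorter third string, which is
  why the filtration \<open>lower\<close> appears. Independence is not visible inside the abstract
  module, whose dimension is unknown at that stage. In the tensor model a Verma vector is found by a
  pivot word, a coordinate that vanishes on all Verma vectors not dominated by it. To bring a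
  relation from the irreducible module to the model, the Casimir element takes the place of complete
  reducibility: its eigenvalue at \<lambda> differs from that at every other dominant weight below
  \<lambda>.\<close>

lemma exhaust_5:
  fixes x :: 5
  shows "x = 1 \<or> x = 2 \<or> x = 3 \<or> x = 4 \<or> x = 5"
proof (induct x)
  case (of_int z)
  then have "z = 0 \<or> z = 1 \<or> z = 2 \<or> z = 3 \<or> z = 4" by fastforce
  then show ?case by auto
qed

lemma forall_5: "(\<forall>i::5. P i) \<longleftrightarrow> P 1 \<and> P 2 \<and> P 3 \<and> P 4 \<and> P 5"
  by (metis exhaust_5)

lemma UNIV_5: "UNIV = {1, 2, 3, 4, 5::5}"
  using exhaust_5 by auto

lemma sum_5: "sum f (UNIV::5 set) = f 1 + f 2 + f 3 + f 4 + f 5"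
  unfolding UNIV_5 by (simp add: ac_simps)

lemma vector_5:
  "(vector [a, b, c, d, e] :: 'a::zero ^ 5) $ 1 = a"
  "(vector [a, b, c, d, e] :: 'a::zero ^ 5) $ 2 = b"
  "(vector [a, b, c, d, e] :: 'a::zero ^ 5) $ 3 = c"
  "(vector [a, b, c, d, e] :: 'a::zero ^ 5) $ 4 = d"
  "(vector [a, b, c, d, e] :: 'a::zero ^ 5) $ 5 = e"
  unfolding vector_def by simp_all

text \<open>The roots of \<open>e1\<close> to \<open>e6\<close> are \<epsilon>1 - \<epsilon>2,
  \<epsilon>2, \<epsilon>1, \<epsilon>1 + \<epsilon>2, 2\<epsilon>1 and 2\<epsilon>2;
  \<open>f1\<close> to \<open>f6\<close> have the opposite roots. The vectors with index 2 or 3 are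
  odd.\<close>

definition e1 :: mat5 where "e1 = mat_unit 1 2 - mat_unit 4 3"
definition e2 :: mat5 where "e2 = mat_unit 2 5 + mat_unit 5 4"
definition e3 :: mat5 where "e3 = mat_unit 1 5 + mat_unit 5 3"
definition e4 :: mat5 where "e4 = mat_unit 1 4 + mat_unit 2 3"
definition e5 :: mat5 where "e5 = mat_unit 1 3"
definition e6 :: mat5 where "e6 = mat_unit 2 4"
definition f3 :: mat5 where "f3 = mat_unit 5 1 - mat_unit 3 5"
definition f4 :: mat5 where "f4 = mat_unit 4 1 + mat_unit 3 2"
definition f5 :: mat5 where "f5 = mat_unit 3 1"
definition f6 :: mat5 where "f6 = mat_unit 4 2"

lemmas basis_defs = H1_def H2_def e1_def e2_def e3_def e4_def e5_def e6_def
  f1_def f2_def f3_def f4_def f5_def f6_def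

lemmas mat5_entries = vec_eq_iff forall_5 spo_matrix_def vector_5 basis_defs mat_unit_def
  mat_scale_def

lemma basis_as_spo_matrix:
  "H1 = spo_matrix 1 0 0 0 0 0 0 0 0 0 0 0 0 0"
  "H2 = spo_matrix 0 0 0 1 0 0 0 0 0 0 0 0 0 0"
  "e1 = spo_matrix 0 1 0 0 0 0 0 0 0 0 0 0 0 0"
  "f1 = spo_matrix 0 0 1 0 0 0 0 0 0 0 0 0 0 0"
  "e5 = spo_matrix 0 0 0 0 1 0 0 0 0 0 0 0 0 0"
  "e4 = spo_matrix 0 0 0 0 0 1 0 0 0 0 0 0 0 0"
  "e6 = spo_matrix 0 0 0 0 0 0 1 0 0 0 0 0 0 0"
  "f5 = spo_matrix 0 0 0 0 0 0 0 1 0 0 0 0 0 0"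
  "f4 = spo_matrix 0 0 0 0 0 0 0 0 1 0 0 0 0 0"
  "f6 = spo_matrix 0 0 0 0 0 0 0 0 0 1 0 0 0 0"
  "e3 = spo_matrix 0 0 0 0 0 0 0 0 0 0 1 0 0 0"
  "e2 = spo_matrix 0 0 0 0 0 0 0 0 0 0 0 1 0 0"
  "f3 = spo_matrix 0 0 0 0 0 0 0 0 0 0 0 0 (-1) 0"
  "f2 = spo_matrix 0 0 0 0 0 0 0 0 0 0 0 0 0 (-1)"
  by (simp_all add: mat5_entries)

lemma even_basis:
  "H1 \<in> spo_part False" "H2 \<in> spo_part False" "e1 \<in> spo_part False" "f1 \<in> spo_part False"
  "e4 \<in> spo_part False" "e5 \<in> spo_part False" "e6 \<in> spo_part False"
  "f4 \<in> spo_part False" "f5 \<in> spo_part False" "f6 \<in> spo_part False"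
  by (simp_all add: basis_as_spo_matrix spo_part_def) blast+

lemma odd_basis:
  "e2 \<in> spo_part True" "f2 \<in> spo_part True" "e3 \<in> spo_part True" "f3 \<in> spo_part True"
  by (simp_all add: basis_as_spo_matrix spo_part_def) blast+

lemma spo_part_subset: "X \<in> spo_part p \<Longrightarrow> X \<in> spo"
  unfolding spo_part_def spo_def by (cases p; simp; blast)

lemma spo_matrix_expand:
  "spo_matrix a11 a12 a21 a22 b11 b12 b22 c11 c12 c22 p1 p2 q1 q2 =
    mat_scale a11 H1 + mat_scale a12 e1 + mat_scale a21 f1 + mat_scale a22 H2
    + mat_scale b11 e5 + mat_scale b12 e4 + mat_scale b22 e6
    + mat_scale c11 f5 + mat_scale c12 f4 + mat_scale c22 f6
    + mat_scale p1 e3 + mat_scale p2 e2 + mat_scale (- q1) f3 + mat_scale (- q2) f2"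
  by (simp add: mat5_entries)

lemma spo_matrix_add:
  "spo_matrix a11 a12 a21 a22 b11 b12 b22 c11 c12 c22 p1 p2 q1 q2
   + spo_matrix a11' a12' a21' a22' b11' b12' b22' c11' c12' c22' p1' p2' q1' q2' =
   spo_matrix (a11 + a11') (a12 + a12') (a21 + a21') (a22 + a22') (b11 + b11') (b12 + b12')
    (b22 + b22') (c11 + c11') (c12 + c12') (c22 + c22') (p1 + p1') (p2 + p2') (q1 + q1') (q2 + q2')"
  by (simp add: mat5_entries)

lemma mat_scale_spo_matrix:
  "mat_scale c (spo_matrix a11 a12 a21 a22 b11 b12 b22 c11 c12 c22 p1 p2 q1 q2) =
   spo_matrix (c * a11) (c * a12) (c * a21) (c * a22) (c * b11) (c * b12) (c * b22)
    (c * c11) (c * c12) (c * c22) (c * p1) (c * p2) (c * q1) (c * q2)"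
  by (simp add: mat5_entries)

lemma spo_add: "X \<in> spo \<Longrightarrow> Y \<in> spo \<Longrightarrow> X + Y \<in> spo"
  unfolding spo_def mem_Collect_eq by (elim exE) (simp only: spo_matrix_add, blast)

lemma spo_scale: "X \<in> spo \<Longrightarrow> mat_scale c X \<in> spo"
  unfolding spo_def mem_Collect_eq by (elim exE) (simp only: mat_scale_spo_matrix, blast)

lemmas spo_basis = even_basis[THEN spo_part_subset] odd_basis[THEN spo_part_subset]

lemmas supercommutator_entries = mat5_entries supercommutator_def even_part_def odd_part_def
  matrix_matrix_mult_def sum_5

lemma simple_brackets:
  "supercommutator e1 f1 = H1 + mat_scale (-1) H2"
  "supercommutator e2 f2 = H2"
  "supercommutator e1 f2 = 0"
  "supercommutator e2 f1 = 0"
  "supercommutator e1 e2 = e3"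
  "supercommutator e2 e2 = mat_scale 2 e6"
  "supercommutator f2 f2 = mat_scale (-2) f6"
  "supercommutator H1 H2 = 0"
  by (simp_all add: supercommutator_entries)

lemma cartan_brackets:
  "supercommutator H1 e1 = e1" "supercommutator H2 e1 = mat_scale (-1) e1"
  "supercommutator H1 e2 = 0" "supercommutator H2 e2 = e2"
  "supercommutator H1 f1 = mat_scale (-1) f1" "supercommutator H2 f1 = f1"
  "supercommutator H1 f2 = 0" "supercommutator H2 f2 = mat_scale (-1) f2"
  by (simp_all add: supercommutator_entries)

lemma root_vector_brackets_e:
  "supercommutator e3 f1 = mat_scale (-1) e2" "supercommutator e3 f2 = e1"
  "supercommutator e4 f1 = mat_scale (-2) e6" "supercommutator e4 f2 = mat_scale (-1) e3"
  "supercommutator e5 f1 = mat_scale (-1) e4" "supercommutator e5 f2 = 0"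
  "supercommutator e6 f1 = 0" "supercommutator e6 f2 = mat_scale (-1) e2"
  "supercommutator e3 e2 = e4" "supercommutator e3 e3 = mat_scale 2 e5"
  by (simp_all add: supercommutator_entries)

lemma root_vector_brackets_f:
  "supercommutator f1 f2 = mat_scale (-1) f3"
  "supercommutator f3 f1 = 0" "supercommutator f3 f2 = mat_scale (-1) f4"
  "supercommutator f4 f1 = mat_scale 2 f5" "supercommutator f4 f2 = 0"
  "supercommutator f5 f1 = 0" "supercommutator f5 f2 = 0"
  "supercommutator f6 f1 = f4" "supercommutator f6 f2 = 0"
  "supercommutator f3 f3 = mat_scale (-2) f5"
  by (simp_all add: supercommutator_entries)

lemma positive_roots_simple: "weight_of 1 (-1) \<in> positive_roots" "weight_of 0 1 \<in> positive_roots"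
  by (simp_all add: positive_roots_def)

lemma simple_root_vectors: "e1 \<in> root_space (weight_of 1 (-1))" "e2 \<in> root_space (weight_of 0 1)"
proof -
  have "supercommutator (mat_scale a H1 + mat_scale b H2) e1 = mat_scale (a - b) e1"
    "supercommutator (mat_scale a H1 + mat_scale b H2) e2 = mat_scale b e2" for a b
    by (simp_all add: supercommutator_entries)
  moreover have "weight_of 1 (-1) (mat_scale a H1 + mat_scale b H2) = a - b"
    "weight_of 0 1 (mat_scale a H1 + mat_scale b H2) = b" for a b
    by (simp_all add: weight_of_def eps1_def eps2_def mat5_entries)
  ultimately show "e1 \<in> root_space (weight_of 1 (-1))" "e2 \<in> root_space (weight_of 0 1)"
    by (auto simp: root_space_def spo_basis cartan_def)
qed

section \<open>Ladder operators\<close>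

lemma (in vector_space) subspace_scale_cancel:
  assumes "subspace M" "scale c x \<in> M" "c \<noteq> 0" shows "x \<in> M"
  using subspace_scale[OF assms(1,2), of "inverse c"] assms(3) by simp

text \<open>Applying \<open>T - t j\<close> to the sum kills the component \<open>z j\<close> and
  multiplies every other one by the nonzero scalar \<open>t i - t j\<close>, so induction on
  \<open>I\<close> isolates the components inside \<open>M\<close>.\<close>

lemma (in vector_space) eigencomponents_in_subspace:
  assumes M: "subspace M" and T: "\<And>x. x \<in> M \<Longrightarrow> T x \<in> M"
    and lin: "Vector_Spaces.linear scale scale T"
  shows "finite I \<Longrightarrow> inj_on t I \<Longrightarrow> (\<And>i. i \<in> I \<Longrightarrow> T (z i) = scale (t i) (z i)) \<Longrightarrow>
    (\<Sum>i\<in>I. z i) \<in> M \<Longrightarrow> i \<in> I \<Longrightarrow> z i \<in> M"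
proof (induction I arbitrary: z i rule: finite_induct)
  case (insert j I)
  interpret T: Vector_Spaces.linear scale scale T by (rule lin)
  let ?s = "\<Sum>i\<in>insert j I. z i"
  have "T ?s = (\<Sum>i\<in>insert j I. scale (t i) (z i))"
    using insert.prems(2) by (simp only: T.sum) (intro sum.cong refl, blast)
  then have "T ?s - scale (t j) ?s = (\<Sum>i\<in>I. scale (t i - t j) (z i))"
    using insert.hyps
    by (simp add: scale_right_distrib scale_sum_right sum_subtractf scale_left_diff_distrib)
  moreover have "T ?s - scale (t j) ?s \<in> M"
    using M T insert.prems(3) by (intro subspace_diff subspace_scale) auto
  ultimately have *: "(\<Sum>i\<in>I. scale (t i - t j) (z i)) \<in> M" by simp
  have scaled: "scale (t i - t j) (z i) \<in> M" if "i \<in> I" for i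
    using insert.prems(1,2) that *
    by (intro insert.IH[where z = "\<lambda>i. scale (t i - t j) (z i)"])
      (auto simp: T.scale mult.commute)
  have rest: "z i \<in> M" if "i \<in> I" for i
  proof (rule subspace_scale_cancel[OF M scaled[OF that]])
    show "t i - t j \<noteq> 0" using that insert.hyps insert.prems(1) by (auto simp: inj_on_def)
  qed
  have "z j = ?s - (\<Sum>i\<in>I. z i)" using insert.hyps by simp
  also have "\<dots> \<in> M" by (rule subspace_diff[OF M insert.prems(3) subspace_sum[OF M rest]])
  finally show ?case using rest insert.prems(4) by auto
qed simp

text \<open>
  For \<open>\<sigma> = 1\<close> and \<open>\<delta> = 2\<close> this is an \<open>sl\<^sub>2\<close>-triple; for \<open>\<sigma> = -1\<close> and \<open>\<delta> = 1\<close> the odd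
  generators and the Cartan element of \<open>osp(1|2)\<close>.
\<close>

locale ladder = vector_space scale
  for scale :: "complex \<Rightarrow> 'v::ab_group_add \<Rightarrow> 'v" (infixr "\<cdot>" 75) +
  fixes e f h :: "'v \<Rightarrow> 'v" and \<sigma> \<delta> :: complex
  assumes lin_e: "Vector_Spaces.linear scale scale e"
    and lin_f: "Vector_Spaces.linear scale scale f"
    and lin_h: "Vector_Spaces.linear scale scale h"
    and ef: "e (f u) = \<sigma> \<cdot> f (e u) + h u"
    and he: "h (e u) = e (h u) + \<delta> \<cdot> e u"
    and hf: "h (f u) = f (h u) - \<delta> \<cdot> f u"
    and sgn: "\<sigma> * \<sigma> = 1"
begin

interpretation e: Vector_Spaces.linear scale scale e by (rule lin_e)
interpretation f: Vector_Spaces.linear scale scale f by (rule lin_f)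
interpretation h: Vector_Spaces.linear scale scale h by (rule lin_h)

text \<open>The relations are symmetric in \<open>e\<close> and \<open>f\<close> up to signs, so
  each rule for moving \<open>e\<close> past powers of \<open>f\<close> also yields one for moving
  \<open>f\<close> past powers of \<open>e\<close>.\<close>

lemma dual_ladder: "ladder scale f e (\<lambda>u. (- \<sigma>) \<cdot> h u) \<sigma> (\<sigma> * \<delta>)"
proof
  show "f (e u) = \<sigma> \<cdot> e (f u) + (- \<sigma>) \<cdot> h u" for u
    using sgn by (simp add: ef scale_right_distrib)
  show "(- \<sigma>) \<cdot> h (f u) = f ((- \<sigma>) \<cdot> h u) + (\<sigma> * \<delta>) \<cdot> f u" for u
    by (simp add: hf f.scale f.neg scale_right_diff_distrib)
  show "(- \<sigma>) \<cdot> h (e u) = e ((- \<sigma>) \<cdot> h u) - (\<sigma> * \<delta>) \<cdot> e u" for u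
    by (simp add: he e.scale e.neg scale_right_distrib)
qed (auto simp: lin_e lin_f sgn scale_right_distrib h.add h.scale ac_simps)

lemma h_f_pow: "h u = t \<cdot> u \<Longrightarrow> h ((f ^^ k) u) = (t - \<delta> * of_nat k) \<cdot> (f ^^ k) u"
proof (induction k)
  case (Suc k)
  have "h ((f ^^ Suc k) u) = (t - \<delta> * of_nat k - \<delta>) \<cdot> (f ^^ Suc k) u"
    using Suc by (simp add: hf f.scale f.diff scale_left_diff_distrib)
  then show ?case by (simp add: algebra_simps)
qed simp

text \<open>The scalar that remains when \<open>e\<close> passes \<open>f^k\<close> on an
  \<open>h\<close>-eigenvector of eigenvalue \<open>t\<close>. The recursion is uniform, whereas the
  closed forms differ: \<open>k (t - k + 1)\<close> for sl2, and a formula depending on the parity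
  of \<open>k\<close> for osp(1|2), see \<open>kappa\<close>.\<close>

primrec kap :: "nat \<Rightarrow> complex \<Rightarrow> complex" where
  "kap 0 t = 0"
| "kap (Suc k) t = \<sigma> * kap k t + (t - \<delta> * of_nat k)"

lemma e_f_pow:
  assumes "h u = t \<cdot> u"
  shows "e ((f ^^ k) u) = \<sigma> ^ k \<cdot> (f ^^ k) (e u) + kap k t \<cdot> (f ^^ (k - 1)) u"
proof (induction k)
  case (Suc k)
  \<comment> \<open>For \<open>k = 0\<close> the exponent \<open>k - 1\<close> is truncated to 0,
    but then the coefficient \<open>kap 0 t\<close> vanishes.\<close>
  have "f ((f ^^ (k - 1)) u) = (f ^^ k) u" if "k \<noteq> 0" using that by (cases k) auto
  then have "kap k t \<cdot> f ((f ^^ (k - 1)) u) = kap k t \<cdot> (f ^^ k) u" by (cases k) auto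
  then show ?case
    by (simp add: ef Suc h_f_pow[OF assms] f.add f.scale scale_right_distrib scale_left_distrib
        scale_left_diff_distrib del: kap.simps(1))
      (metis scale_scale)
qed simp

lemma funpow_add_apply: "(g ^^ a) ((g ^^ b) x) = (g ^^ (a + b)) x" for g :: "'v \<Rightarrow> 'v"
  by (simp add: funpow_add)

lemma subspace_funpow: "(\<And>x. x \<in> G \<Longrightarrow> g x \<in> G) \<Longrightarrow> x \<in> G \<Longrightarrow> (g ^^ n) x \<in> G"
  for g :: "'v \<Rightarrow> 'v" by (induction n) auto

text \<open>
  Both orderings of the powers of \<open>e\<close> and \<open>f\<close> span the submodule generated by \<open>x\<close>, and in
  \<open>e\<^sup>i f\<^sup>j x\<close> it suffices to take \<open>j \<le> J\<close>. Reordering never raises the power of \<open>f\<close>.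
\<close>

lemma truncated_f_powers:
  assumes x: "h x = t \<cdot> x" and G: "subspace G" "\<And>y. y \<in> G \<Longrightarrow> e y \<in> G" "\<And>y. y \<in> G \<Longrightarrow> f y \<in> G"
    and J: "(f ^^ Suc J) x \<in> G"
  shows "(f ^^ j) ((e ^^ i) x) \<in> span ({(f ^^ j') ((e ^^ i') x) | j' i'. j' \<le> J} \<union> G)"
proof -
  interpret d: ladder scale f e "\<lambda>u. (- \<sigma>) \<cdot> h u" \<sigma> "\<sigma> * \<delta>" by (rule dual_ladder)
  have h_e_pow: "\<exists>s. h ((e ^^ i) x) = s \<cdot> (e ^^ i) x" for i
    by (induction i) (auto simp: x he e.scale simp flip: scale_left_distrib)
  \<comment> \<open>\<open>?Z\<close> is stable under \<open>f\<close> and contains all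
    \<open>e^i x\<close>, hence all \<open>f^j e^i x\<close>. \<open>?Z'\<close> is stable under
    \<open>e\<close> and contains \<open>G\<close> and the \<open>f^j x\<close> with
    \<open>j \<le> J\<close>, hence all of \<open>?Z\<close>.\<close>
  let ?Z = "span ({(e ^^ i) ((f ^^ j) x) | j i. j \<le> J} \<union> G)"
  let ?Z' = "span ({(f ^^ j') ((e ^^ i') x) | j' i'. j' \<le> J} \<union> G)"
  have Z1: "(e ^^ i) ((f ^^ j) x) \<in> ?Z" if "j \<le> Suc J" for i j
  proof (cases "j = Suc J")
    case True
    then show ?thesis using subspace_funpow[of G e, OF G(2) J] by (auto intro: span_base)
  next
    case False
    with that show ?thesis by (intro span_base) (auto simp: less_Suc_eq_le)
  qed
  have f_Z: "f y \<in> ?Z" if "y \<in> ?Z" for y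
    using that
  proof (induction rule: span_induct_alt)
    case (step c y z)
    have "f y \<in> ?Z"
    proof (cases "y \<in> G")
      case False
      with step obtain i j where y: "y = (e ^^ i) ((f ^^ j) x)" and j: "j \<le> J" by auto
      have "(- \<sigma>) \<cdot> h ((f ^^ j) x) = (- \<sigma> * (t - \<delta> * of_nat j)) \<cdot> (f ^^ j) x"
        using h_f_pow[OF x, of j] by simp
      from d.e_f_pow[OF this, of i] have "f y = \<sigma> ^ i \<cdot> (e ^^ i) ((f ^^ Suc j) x) +
        d.kap i (- \<sigma> * (t - \<delta> * of_nat j)) \<cdot> (e ^^ (i - 1)) ((f ^^ j) x)" by (simp add: y)
      also have "\<dots> \<in> ?Z" using j by (intro span_add span_scale Z1) auto
      finally show ?thesis .
    qed (auto intro: span_base G)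
    then show ?case using step by (auto simp: f.add f.scale intro: span_add span_scale)
  qed (simp add: f.zero span_zero)
  have e_Z': "e y \<in> ?Z'" if "y \<in> ?Z'" for y
    using that
  proof (induction rule: span_induct_alt)
    case (step c y z)
    have "e y \<in> ?Z'"
    proof (cases "y \<in> G")
      case False
      with step obtain i j where y: "y = (f ^^ j) ((e ^^ i) x)" and j: "j \<le> J" by auto
      obtain s where "h ((e ^^ i) x) = s \<cdot> (e ^^ i) x" using h_e_pow by blast
      from e_f_pow[OF this, of j] have "e y = \<sigma> ^ j \<cdot> (f ^^ j) ((e ^^ Suc i) x) +
        kap j s \<cdot> (f ^^ (j - 1)) ((e ^^ i) x)" by (simp add: y)
      moreover have "(f ^^ j) ((e ^^ Suc i) x) \<in> ?Z'" "(f ^^ (j - 1)) ((e ^^ i) x) \<in> ?Z'"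
        using j by (intro span_base; (force simp del: funpow.simps))+
      ultimately show ?thesis by (auto intro: span_add span_scale)
    qed (auto intro: span_base G)
    then show ?case using step by (auto simp: e.add e.scale intro: span_add span_scale)
  qed (simp add: e.zero span_zero)
  have "(f ^^ j) ((e ^^ i) x) \<in> ?Z"
    using Z1[of 0 i] subspace_funpow[of ?Z f, OF f_Z] by simp
  also have "?Z \<subseteq> ?Z'"
  proof (rule span_minimal)
    have "(f ^^ j) x \<in> ?Z'" if "j \<le> J" for j
      using that by (intro span_base) (force intro: exI[of _ "0::nat"])
    then show "{(e ^^ i) ((f ^^ j) x) | j i. j \<le> J} \<union> G \<subseteq> ?Z'"
      using subspace_funpow[of ?Z' e, OF e_Z'] by (auto intro: span_base)
  qed simp
  finally show ?thesis .
qed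

text \<open>Each \<open>f\<close> is pulled to the left through \<open>e^a\<close> at the cost of
  one \<open>e\<close>, so the number of \<open>e\<close> needed to land in \<open>G\<close> grows
  by one per \<open>f\<close>.\<close>

lemma e_pow_f_pow_in:
  assumes x: "h x = t \<cdot> x" and G: "subspace G" "\<And>y. y \<in> G \<Longrightarrow> f y \<in> G"
    and N: "\<And>i. i \<ge> N \<Longrightarrow> (e ^^ i) x \<in> G"
  shows "a \<ge> N + b \<Longrightarrow> (e ^^ a) ((f ^^ b) x) \<in> G"
proof (induction b arbitrary: a)
  case (Suc b)
  interpret d: ladder scale f e "\<lambda>u. (- \<sigma>) \<cdot> h u" \<sigma> "\<sigma> * \<delta>" by (rule dual_ladder)
  have "(- \<sigma>) \<cdot> h ((f ^^ b) x) = (- \<sigma> * (t - \<delta> * of_nat b)) \<cdot> (f ^^ b) x"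
    using h_f_pow[OF x, of b] by simp
  from d.e_f_pow[OF this, of a]
  have "\<sigma> ^ a \<cdot> (e ^^ a) ((f ^^ Suc b) x) = f ((e ^^ a) ((f ^^ b) x)) -
    d.kap a (- \<sigma> * (t - \<delta> * of_nat b)) \<cdot> (e ^^ (a - 1)) ((f ^^ b) x)" by simp
  also have "\<dots> \<in> G"
    using Suc by (intro subspace_diff[OF G(1)] subspace_scale[OF G(1)] G(2)) auto
  finally have "\<sigma> ^ a \<cdot> (e ^^ a) ((f ^^ Suc b) x) \<in> G" .
  moreover have "\<sigma> ^ a \<noteq> 0" using sgn by auto
  ultimately show ?case by (rule subspace_scale_cancel[OF G(1)])
qed (use N in simp)

end

locale sl2_triple = ladder scale e f h 1 2
  for scale :: "complex \<Rightarrow> 'v::ab_group_add \<Rightarrow> 'v" (infixr "\<cdot>" 75) and e f h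
begin

interpretation e: Vector_Spaces.linear scale scale e by (rule lin_e)
interpretation f: Vector_Spaces.linear scale scale f by (rule lin_f)
interpretation d: ladder scale f e "\<lambda>u. (- 1) \<cdot> h u" 1 "1 * 2" by (rule dual_ladder)

lemma kap_sl2: "kap k t = of_nat k * (t - of_nat k + 1)"
  by (induction k) (simp_all add: algebra_simps)

text \<open>If \<open>f^m u\<close> is the last nonzero power, then 0 = \<open>e (f^(m+1) u)\<close>
  = (m + 1)(t - m) \<open>f^m u\<close>, which forces t = m.\<close>

lemma hw_dominant:
  assumes "h u = t \<cdot> u" "e u = 0" "u \<noteq> 0" "(f ^^ k) u = 0"
  shows "\<exists>n::nat. t = of_nat n"
proof -
  define n where "n = (LEAST k. (f ^^ k) u = 0)"
  have n: "(f ^^ n) u = 0" unfolding n_def by (rule LeastI) fact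
  with assms obtain m where m: "n = Suc m" by (cases n) auto
  have "(f ^^ m) u \<noteq> 0" using not_less_Least[of m "\<lambda>k. (f ^^ k) u = 0"] m n_def by auto
  moreover have "kap n t \<cdot> (f ^^ m) u = 0"
  proof -
    have "(f ^^ k) 0 = 0" for k by (induction k) (simp_all add: f.zero)
    then show ?thesis using e_f_pow[OF assms(1), of n] n assms m by (simp add: e.zero)
  qed
  ultimately have "kap n t = 0" by simp
  then have "t = of_nat m" unfolding kap_sl2 m mult_eq_0_iff of_nat_eq_0_iff by simp
  then show ?thesis ..
qed

text \<open>\<open>e\<close> maps \<open>f^(k+1) u\<close> to (k + 1)(n - k) \<open>f^k u\<close>,
  and this scalar is nonzero for k < n.\<close>

lemma f_pow_nonzero:
  assumes "h u = of_nat n \<cdot> u" "e u = 0" "u \<noteq> 0"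
  shows "k \<le> n \<Longrightarrow> (f ^^ k) u \<noteq> 0"
proof (induction k)
  case (Suc k)
  have "(f ^^ k) 0 = 0" for k by (induction k) (simp_all add: f.zero)
  then have "e ((f ^^ Suc k) u) = kap (Suc k) (of_nat n) \<cdot> (f ^^ k) u"
    using e_f_pow[OF assms(1), of "Suc k"] by (simp only: assms(2)) simp
  moreover have "kap (Suc k) (of_nat n) \<noteq> 0"
  proof -
    have "kap (Suc k) (of_nat n) = of_nat (Suc k) * of_nat (n - k)"
      using Suc.prems by (simp only: kap_sl2 of_nat_Suc of_nat_diff) (simp add: of_nat_diff)
    then show ?thesis using Suc.prems by (simp only: mult_eq_0_iff of_nat_eq_0_iff) simp
  qed
  ultimately show ?case using Suc by (auto simp: e.zero)
qed (use assms in simp)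

text \<open>
  On the quotient by \<open>G\<close>, the power \<open>e\<^sup>N\<close> is injective on the weight \<open>-N\<close>.
\<close>

lemma raise_injective:
  assumes G: "subspace G" "\<And>y. y \<in> G \<Longrightarrow> e y \<in> G" "\<And>y. y \<in> G \<Longrightarrow> f y \<in> G"
    and z: "h z = (- of_nat N) \<cdot> z" "(e ^^ N) z \<in> G" "(f ^^ k) z \<in> G"
  shows "z \<in> G"
proof (rule ccontr)
  assume "z \<notin> G"
  define n where "n = (LEAST k. (f ^^ k) z \<in> G)"
  have n: "(f ^^ n) z \<in> G" unfolding n_def by (rule LeastI) fact
  with \<open>z \<notin> G\<close> obtain j where j: "n = Suc j" by (cases n) auto
  \<comment> \<open>Modulo \<open>G\<close>, \<open>y\<close> is a lowest weight vector of weight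
    \<open>- (N + 2 * j)\<close>.\<close>
  define y where "y = (f ^^ j) z"
  have y: "y \<notin> G" "f y \<in> G"
    using not_less_Least[of j "\<lambda>k. (f ^^ k) z \<in> G"] n j n_def by (auto simp: y_def)
  have hf': "h ((f ^^ b) z) = (- of_nat (N + 2 * b)) \<cdot> (f ^^ b) z" for b
    using h_f_pow[OF z(1), of b] by simp
  have e_up: "f ((e ^^ r) u) = (e ^^ r) (f u) +
      (of_nat r * (of_nat q - of_nat r + 1)) \<cdot> (e ^^ (r - 1)) u"
    if "h u = (- of_nat q) \<cdot> u" for u r q
    using d.e_f_pow[of u "of_nat q" r] that by (simp add: kap_sl2)
  have "(e ^^ i) z \<in> G" if "i \<ge> N" for i
  proof -
    have "(e ^^ i) z = (e ^^ (i - N)) ((e ^^ N) z)" using that by (simp add: funpow_add_apply)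
    then show ?thesis using subspace_funpow[of G e, OF G(2) z(2)] by simp
  qed
  from e_pow_f_pow_in[OF z(1) G(1,3) this]
  have "(e ^^ a) ((f ^^ b) z) \<in> G" if "a \<ge> N + b" for a b using that by blast
  \<comment> \<open>This contradicts the length of the string above \<open>y\<close>: its powers up
    to \<open>N + 2 * j\<close>, which is at least \<open>N + j\<close>, stay outside
    \<open>G\<close>.\<close>
  then have "(e ^^ (N + j)) y \<in> G" by (simp add: y_def)
  moreover have "(e ^^ r) y \<notin> G" if "r \<le> N + 2 * j" for r
    using that
  proof (induction r)
    case (Suc r)
    show ?case
    proof
      assume *: "(e ^^ Suc r) y \<in> G"
      let ?c = "of_nat (Suc r) * (of_nat (N + 2 * j) - of_nat (Suc r) + 1) :: complex"
      have "?c \<cdot> (e ^^ r) y = f ((e ^^ Suc r) y) - (e ^^ Suc r) (f y)"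
        using e_up[OF hf', of "Suc r" j] by (simp add: y_def)
      also have "\<dots> \<in> G"
        using subspace_diff[OF G(1) G(3)[OF *] subspace_funpow[of G e, OF G(2) y(2)]] .
      finally have "?c \<cdot> (e ^^ r) y \<in> G" .
      moreover have "?c \<noteq> 0"
      proof -
        have "?c = of_nat (Suc r) * of_nat (N + 2 * j - r)"
          using Suc.prems by (simp add: of_nat_diff)
        then show ?thesis using Suc.prems by (simp only: mult_eq_0_iff of_nat_eq_0_iff) simp
      qed
      ultimately show False using Suc subspace_scale_cancel[OF G(1)] by simp
    qed
  qed (use y in simp)
  ultimately show False by simp
qed

end

section \<open>Modules generated by a highest weight vector\<close>

text \<open>The action without a grading of the space: the common ground of the irreducible module,
  the tensor power and their direct sum.\<close>

locale spo_module = vector_space scale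
  for scale :: "complex \<Rightarrow> 'v::ab_group_add \<Rightarrow> 'v" (infixr "\<cdot>" 75) +
  fixes \<rho> :: "mat5 \<Rightarrow> 'v \<Rightarrow> 'v"
  assumes rho_linear: "X \<in> spo \<Longrightarrow> Vector_Spaces.linear scale scale (\<rho> X)"
    and rho_add: "X \<in> spo \<Longrightarrow> Y \<in> spo \<Longrightarrow> \<rho> (X + Y) u = \<rho> X u + \<rho> Y u"
    and rho_scale: "X \<in> spo \<Longrightarrow> \<rho> (mat_scale c X) u = c \<cdot> \<rho> X u"
    and rho_bracket: "X \<in> spo_part p \<Longrightarrow> Y \<in> spo_part q \<Longrightarrow>
      \<rho> (supercommutator X Y) u =
        (if p \<and> q then \<rho> X (\<rho> Y u) + \<rho> Y (\<rho> X u) else \<rho> X (\<rho> Y u) - \<rho> Y (\<rho> X u))"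
begin

section \<open>Relations among the root vectors as operators\<close>

lemma rho_simps:
  assumes "X \<in> spo"
  shows "\<rho> X (u + w) = \<rho> X u + \<rho> X w" "\<rho> X (u - w) = \<rho> X u - \<rho> X w" "\<rho> X (- u) = - \<rho> X u"
    "\<rho> X (c \<cdot> u) = c \<cdot> \<rho> X u" "\<rho> X 0 = 0"
proof -
  interpret Vector_Spaces.linear scale scale "\<rho> X" by (rule rho_linear[OF assms])
  show "\<rho> X (u + w) = \<rho> X u + \<rho> X w" "\<rho> X (u - w) = \<rho> X u - \<rho> X w" "\<rho> X (- u) = - \<rho> X u"
    "\<rho> X (c \<cdot> u) = c \<cdot> \<rho> X u" "\<rho> X 0 = 0"
    by (simp_all add: add diff neg scale zero)
qed

lemma rho_span:
  assumes "X \<in> spo" "\<And>x. x \<in> S \<Longrightarrow> \<rho> X x \<in> span T" "x \<in> span S"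
  shows "\<rho> X x \<in> span T"
  using assms(3)
  by (induction rule: span_induct_alt)
    (auto simp: rho_simps assms(1) span_zero intro: span_add span_scale assms(2))

lemma rho_pow_zero: "X \<in> spo \<Longrightarrow> (\<rho> X ^^ k) 0 = 0"
  by (induction k) (simp_all add: rho_simps)

lemma rho_pow_scale: "X \<in> spo \<Longrightarrow> (\<rho> X ^^ k) (c \<cdot> u) = c \<cdot> (\<rho> X ^^ k) u"
  by (induction k) (simp_all add: rho_simps)

lemma rho_pow_add: "X \<in> spo \<Longrightarrow> (\<rho> X ^^ k) (u + w) = (\<rho> X ^^ k) u + (\<rho> X ^^ k) w"
  by (induction k) (simp_all add: rho_simps)

lemma rho_zero: "\<rho> 0 u = 0"
proof -
  have "mat_scale 0 H1 = 0" by (simp add: mat5_entries)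
  then show ?thesis using rho_scale[of H1 0 u] by (simp add: spo_basis)
qed

lemma rho_swap:
  assumes "X \<in> spo_part p" "Y \<in> spo_part q" "supercommutator X Y = Z"
  shows "\<rho> X (\<rho> Y u) = \<rho> Z u + (if p \<and> q then - \<rho> Y (\<rho> X u) else \<rho> Y (\<rho> X u))"
  using rho_bracket[OF assms(1,2), of u] assms(3) by (auto simp: algebra_simps split: if_splits)

lemmas bracket_simps = rho_zero rho_scale[OF spo_basis(1)] rho_scale[OF spo_basis(2)]
  rho_scale[OF spo_basis(3)] rho_scale[OF spo_basis(4)] rho_scale[OF spo_basis(5)]
  rho_scale[OF spo_basis(6)] rho_scale[OF spo_basis(7)] rho_scale[OF spo_basis(8)]
  rho_scale[OF spo_basis(9)] rho_scale[OF spo_basis(10)] rho_scale[OF spo_basis(11)]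
  rho_scale[OF spo_basis(12)] rho_scale[OF spo_basis(13)] rho_scale[OF spo_basis(14)]

lemma twice: "2 \<cdot> u = u + u"
  by (metis one_add_one scale_left_distrib scale_one)

text \<open>Together with \<open>cartan_relations\<close>, \<open>e_past_simple_f\<close> and
  \<open>f_past_simple_f\<close> these are oriented as rewrite rules that move simple
  \<open>f\<close> to the left and Cartan elements to the right. This normal ordering makes
  identities such as \<open>casimir_f\<close> a matter of rewriting.\<close>

lemma simple_relations:
  "\<rho> e1 (\<rho> f1 u) = \<rho> f1 (\<rho> e1 u) + \<rho> H1 u - \<rho> H2 u"
  "\<rho> e2 (\<rho> f2 u) = \<rho> H2 u - \<rho> f2 (\<rho> e2 u)"
  "\<rho> e1 (\<rho> f2 u) = \<rho> f2 (\<rho> e1 u)"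
  "\<rho> e2 (\<rho> f1 u) = \<rho> f1 (\<rho> e2 u)"
  "\<rho> f2 (\<rho> f1 u) = \<rho> f3 u + \<rho> f1 (\<rho> f2 u)"
  "\<rho> H1 (\<rho> H2 u) = \<rho> H2 (\<rho> H1 u)"
  using rho_swap[OF even_basis(3) even_basis(4) simple_brackets(1), of u]
    rho_swap[OF odd_basis(1) odd_basis(2) simple_brackets(2), of u]
    rho_swap[OF even_basis(3) odd_basis(2) simple_brackets(3), of u]
    rho_swap[OF odd_basis(1) even_basis(4) simple_brackets(4), of u]
    rho_swap[OF even_basis(4) odd_basis(2) root_vector_brackets_f(1), of u]
    rho_swap[OF even_basis(1) even_basis(2) simple_brackets(8), of u]
  by (simp_all add: rho_add spo_basis spo_scale bracket_simps algebra_simps)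

text \<open>The bracket of an odd element with itself acts as twice its square.\<close>

lemma squares:
  "\<rho> e2 (\<rho> e2 u) = \<rho> e6 u" "\<rho> f2 (\<rho> f2 u) = - \<rho> f6 u"
  "\<rho> e3 (\<rho> e3 u) = \<rho> e5 u" "\<rho> f3 (\<rho> f3 u) = - \<rho> f5 u"
proof -
  have *: "x = y" if "2 \<cdot> y = x + x" for x y :: 'v
    using that by (metis scale_left_imp_eq twice zero_neq_numeral)
  show "\<rho> e2 (\<rho> e2 u) = \<rho> e6 u"
    by (rule *) (use rho_bracket[OF odd_basis(1) odd_basis(1), of u] in
        \<open>simp add: simple_brackets bracket_simps\<close>)
  show "\<rho> f2 (\<rho> f2 u) = - \<rho> f6 u"
    by (rule *) (use rho_bracket[OF odd_basis(2) odd_basis(2), of u] in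
        \<open>simp add: simple_brackets bracket_simps\<close>)
  show "\<rho> e3 (\<rho> e3 u) = \<rho> e5 u"
    by (rule *) (use rho_bracket[OF odd_basis(3) odd_basis(3), of u] in
        \<open>simp add: root_vector_brackets_e bracket_simps\<close>)
  show "\<rho> f3 (\<rho> f3 u) = - \<rho> f5 u"
    by (rule *) (use rho_bracket[OF odd_basis(4) odd_basis(4), of u] in
        \<open>simp add: root_vector_brackets_f bracket_simps\<close>)
qed

lemma composite_e:
  "\<rho> e3 u = \<rho> e1 (\<rho> e2 u) - \<rho> e2 (\<rho> e1 u)"
  "\<rho> e4 u = \<rho> e3 (\<rho> e2 u) + \<rho> e2 (\<rho> e3 u)"
  using rho_bracket[OF even_basis(3) odd_basis(1), of u]
    rho_bracket[OF odd_basis(3) odd_basis(1), of u]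
  by (simp_all add: simple_brackets root_vector_brackets_e)

lemma composite_f:
  "\<rho> f4 u = - (\<rho> f3 (\<rho> f2 u) + \<rho> f2 (\<rho> f3 u))"
  using rho_bracket[OF odd_basis(4) odd_basis(2), of u]
  by (simp add: bracket_simps root_vector_brackets_f) (metis minus_minus minus_add_distrib
      add_uminus_conv_diff)

lemma cartan_relations:
  "\<rho> H1 (\<rho> e1 u) = \<rho> e1 (\<rho> H1 u) + \<rho> e1 u" "\<rho> H2 (\<rho> e1 u) = \<rho> e1 (\<rho> H2 u) - \<rho> e1 u"
  "\<rho> H1 (\<rho> e2 u) = \<rho> e2 (\<rho> H1 u)" "\<rho> H2 (\<rho> e2 u) = \<rho> e2 (\<rho> H2 u) + \<rho> e2 u"
  "\<rho> H1 (\<rho> f1 u) = \<rho> f1 (\<rho> H1 u) - \<rho> f1 u" "\<rho> H2 (\<rho> f1 u) = \<rho> f1 (\<rho> H2 u) + \<rho> f1 u"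
  "\<rho> H1 (\<rho> f2 u) = \<rho> f2 (\<rho> H1 u)" "\<rho> H2 (\<rho> f2 u) = \<rho> f2 (\<rho> H2 u) - \<rho> f2 u"
  using rho_swap[OF even_basis(1) even_basis(3) cartan_brackets(1), of u]
    rho_swap[OF even_basis(2) even_basis(3) cartan_brackets(2), of u]
    rho_swap[OF even_basis(1) odd_basis(1) cartan_brackets(3), of u]
    rho_swap[OF even_basis(2) odd_basis(1) cartan_brackets(4), of u]
    rho_swap[OF even_basis(1) even_basis(4) cartan_brackets(5), of u]
    rho_swap[OF even_basis(2) even_basis(4) cartan_brackets(6), of u]
    rho_swap[OF even_basis(1) odd_basis(2) cartan_brackets(7), of u]
    rho_swap[OF even_basis(2) odd_basis(2) cartan_brackets(8), of u]
  by (simp_all add: bracket_simps algebra_simps)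

lemma e_past_simple_f:
  "\<rho> e3 (\<rho> f1 u) = \<rho> f1 (\<rho> e3 u) - \<rho> e2 u" "\<rho> e3 (\<rho> f2 u) = \<rho> e1 u - \<rho> f2 (\<rho> e3 u)"
  "\<rho> e4 (\<rho> f1 u) = \<rho> f1 (\<rho> e4 u) - (\<rho> e6 u + \<rho> e6 u)" "\<rho> e4 (\<rho> f2 u) = \<rho> f2 (\<rho> e4 u) - \<rho> e3 u"
  "\<rho> e5 (\<rho> f1 u) = \<rho> f1 (\<rho> e5 u) - \<rho> e4 u" "\<rho> e5 (\<rho> f2 u) = \<rho> f2 (\<rho> e5 u)"
  "\<rho> e6 (\<rho> f1 u) = \<rho> f1 (\<rho> e6 u)" "\<rho> e6 (\<rho> f2 u) = \<rho> f2 (\<rho> e6 u) - \<rho> e2 u"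
  using rho_swap[OF odd_basis(3) even_basis(4) root_vector_brackets_e(1), of u]
    rho_swap[OF odd_basis(3) odd_basis(2) root_vector_brackets_e(2), of u]
    rho_swap[OF even_basis(5) even_basis(4) root_vector_brackets_e(3), of u]
    rho_swap[OF even_basis(5) odd_basis(2) root_vector_brackets_e(4), of u]
    rho_swap[OF even_basis(6) even_basis(4) root_vector_brackets_e(5), of u]
    rho_swap[OF even_basis(6) odd_basis(2) root_vector_brackets_e(6), of u]
    rho_swap[OF even_basis(7) even_basis(4) root_vector_brackets_e(7), of u]
    rho_swap[OF even_basis(7) odd_basis(2) root_vector_brackets_e(8), of u]
  by (simp_all add: bracket_simps twice algebra_simps)

lemma f_past_simple_f:
  "\<rho> f3 (\<rho> f1 u) = \<rho> f1 (\<rho> f3 u)" "\<rho> f3 (\<rho> f2 u) = - \<rho> f4 u - \<rho> f2 (\<rho> f3 u)"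
  "\<rho> f4 (\<rho> f1 u) = \<rho> f1 (\<rho> f4 u) + (\<rho> f5 u + \<rho> f5 u)" "\<rho> f4 (\<rho> f2 u) = \<rho> f2 (\<rho> f4 u)"
  "\<rho> f5 (\<rho> f1 u) = \<rho> f1 (\<rho> f5 u)" "\<rho> f5 (\<rho> f2 u) = \<rho> f2 (\<rho> f5 u)"
  "\<rho> f6 (\<rho> f1 u) = \<rho> f1 (\<rho> f6 u) + \<rho> f4 u" "\<rho> f6 (\<rho> f2 u) = \<rho> f2 (\<rho> f6 u)"
  using rho_swap[OF odd_basis(4) even_basis(4) root_vector_brackets_f(2), of u]
    rho_swap[OF odd_basis(4) odd_basis(2) root_vector_brackets_f(3), of u]
    rho_swap[OF even_basis(8) even_basis(4) root_vector_brackets_f(4), of u]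
    rho_swap[OF even_basis(8) odd_basis(2) root_vector_brackets_f(5), of u]
    rho_swap[OF even_basis(9) even_basis(4) root_vector_brackets_f(6), of u]
    rho_swap[OF even_basis(9) odd_basis(2) root_vector_brackets_f(7), of u]
    rho_swap[OF even_basis(10) even_basis(4) root_vector_brackets_f(8), of u]
    rho_swap[OF even_basis(10) odd_basis(2) root_vector_brackets_f(9), of u]
  by (simp_all add: bracket_simps twice add_ac)

text \<open>The quadratic Casimir element of the form str(XY)/2, normally ordered with
  \<open>f\<close> to the left of \<open>e\<close>. The linear part 3 \<open>H1\<close> +
  \<open>H2\<close> is the sum of the even positive roots minus the sum of the odd ones. The factor
  4 at the roots 2\<epsilon>1, 2\<epsilon>2 compensates that \<open>e5\<close>, \<open>f5\<close>
  and \<open>e6\<close>, \<open>f6\<close> pair to 1/2 instead of 1. Multiples are written as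
  repeated sums to suit additive normalization.\<close>

definition casimir :: "'v \<Rightarrow> 'v" where
  "casimir u = \<rho> H1 (\<rho> H1 u) + \<rho> H2 (\<rho> H2 u) + (\<rho> H1 u + \<rho> H1 u + \<rho> H1 u) + \<rho> H2 u
    + (\<rho> f1 (\<rho> e1 u) + \<rho> f1 (\<rho> e1 u)) + (\<rho> f2 (\<rho> e2 u) + \<rho> f2 (\<rho> e2 u))
    + (\<rho> f3 (\<rho> e3 u) + \<rho> f3 (\<rho> e3 u)) + (\<rho> f4 (\<rho> e4 u) + \<rho> f4 (\<rho> e4 u))
    + (\<rho> f5 (\<rho> e5 u) + \<rho> f5 (\<rho> e5 u) + \<rho> f5 (\<rho> e5 u) + \<rho> f5 (\<rho> e5 u))
    + (\<rho> f6 (\<rho> e6 u) + \<rho> f6 (\<rho> e6 u) + \<rho> f6 (\<rho> e6 u) + \<rho> f6 (\<rho> e6 u))"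

lemmas rho_basis_simps = rho_simps[OF spo_basis(1)] rho_simps[OF spo_basis(2)]
  rho_simps[OF spo_basis(3)] rho_simps[OF spo_basis(4)] rho_simps[OF spo_basis(5)]
  rho_simps[OF spo_basis(6)] rho_simps[OF spo_basis(7)] rho_simps[OF spo_basis(8)]
  rho_simps[OF spo_basis(9)] rho_simps[OF spo_basis(10)] rho_simps[OF spo_basis(11)]
  rho_simps[OF spo_basis(12)] rho_simps[OF spo_basis(13)] rho_simps[OF spo_basis(14)]

text \<open>Commuting with \<open>f1\<close> and \<open>f2\<close> is what is used: these generate
  the modules in question from a highest weight vector.\<close>

lemma casimir_f: "casimir (\<rho> f1 u) = \<rho> f1 (casimir u)" "casimir (\<rho> f2 u) = \<rho> f2 (casimir u)"
  by (simp_all add: casimir_def rho_basis_simps simple_relations cartan_relations e_past_simple_f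
      f_past_simple_f squares algebra_simps)

lemma casimir_linear: "casimir (u + w) = casimir u + casimir w" "casimir (c \<cdot> u) = c \<cdot> casimir u"
  by (simp_all add: casimir_def rho_basis_simps scale_right_distrib algebra_simps)

section \<open>Rank one subalgebras and weight vectors\<close>

lemma sl2_e1_f1: "sl2_triple scale (\<rho> e1) (\<rho> f1) (\<lambda>u. \<rho> H1 u - \<rho> H2 u)"
proof (intro sl2_triple.intro ladder.intro ladder_axioms.intro vector_space_axioms)
  show "Vector_Spaces.linear scale scale (\<lambda>u. \<rho> H1 u - \<rho> H2 u)"
    by unfold_locales (simp_all add: rho_basis_simps scale_right_diff_distrib)
qed (simp_all add: rho_linear spo_basis simple_relations cartan_relations rho_basis_simps
    algebra_simps twice)

text \<open>The even sl2 inside the osp(1|2) of \<open>e2\<close> and \<open>f2\<close>: since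
  \<open>e6\<close> and \<open>-f6\<close> are the squares of \<open>e2\<close> and
  \<open>f2\<close>, its relations follow from those of the odd generators.\<close>

lemma sl2_e6_f6: "sl2_triple scale (\<rho> e6) (\<rho> f6) (\<rho> H2)"
proof (intro sl2_triple.intro ladder.intro ladder_axioms.intro vector_space_axioms)
  have e6: "\<rho> e6 u = \<rho> e2 (\<rho> e2 u)" and f6: "\<rho> f6 u = - \<rho> f2 (\<rho> f2 u)" for u
    by (simp_all add: squares)
  show "\<rho> e6 (\<rho> f6 u) = 1 \<cdot> \<rho> f6 (\<rho> e6 u) + \<rho> H2 u" for u
    by (simp add: e6 f6 simple_relations cartan_relations rho_basis_simps algebra_simps)
  show "\<rho> H2 (\<rho> e6 u) = \<rho> e6 (\<rho> H2 u) + 2 \<cdot> \<rho> e6 u"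
    "\<rho> H2 (\<rho> f6 u) = \<rho> f6 (\<rho> H2 u) - 2 \<cdot> \<rho> f6 u" for u
    by (simp_all add: e6 f6 cartan_relations rho_basis_simps algebra_simps twice)
qed (simp_all add: rho_linear spo_basis)

lemma odd_ladder: "ladder scale (\<rho> e2) (\<rho> f2) (\<rho> H2) (- 1) 1"
  by (intro ladder.intro ladder_axioms.intro vector_space_axioms)
    (simp_all add: rho_linear spo_basis simple_relations cartan_relations rho_basis_simps)

text \<open>The zero vector has every weight, so that closure under operators and spans needs no
  case distinction.\<close>

definition wt :: "complex \<Rightarrow> complex \<Rightarrow> 'v \<Rightarrow> bool" where
  "wt x y u \<longleftrightarrow> \<rho> H1 u = x \<cdot> u \<and> \<rho> H2 u = y \<cdot> u"

lemma wt_simple: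
  assumes "wt x y u"
  shows "wt (x + 1) (y - 1) (\<rho> e1 u)" "wt x (y + 1) (\<rho> e2 u)"
    "wt (x - 1) (y + 1) (\<rho> f1 u)" "wt x (y - 1) (\<rho> f2 u)"
  using assms
  by (simp_all add: wt_def cartan_relations rho_basis_simps scale_left_distrib
      scale_left_diff_distrib)

lemma wt_pow:
  assumes "wt x y u"
  shows "wt (x + of_nat k) (y - of_nat k) ((\<rho> e1 ^^ k) u)" "wt x (y + of_nat k) ((\<rho> e2 ^^ k) u)"
    "wt (x - of_nat k) (y + of_nat k) ((\<rho> f1 ^^ k) u)" "wt x (y - of_nat k) ((\<rho> f2 ^^ k) u)"
proof -
  have "wt a b w \<Longrightarrow> a = a' \<Longrightarrow> b = b' \<Longrightarrow> wt a' b' w" for a b a' b' w by simp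
  note * = this[OF wt_simple(1)] this[OF wt_simple(2)] this[OF wt_simple(3)] this[OF wt_simple(4)]
  show "wt (x + of_nat k) (y - of_nat k) ((\<rho> e1 ^^ k) u)"
    by (induction k) (auto simp: assms intro: *(1))
  show "wt x (y + of_nat k) ((\<rho> e2 ^^ k) u)"
    by (induction k) (auto simp: assms intro: *(2))
  show "wt (x - of_nat k) (y + of_nat k) ((\<rho> f1 ^^ k) u)"
    by (induction k) (auto simp: assms intro: *(3))
  show "wt x (y - of_nat k) ((\<rho> f2 ^^ k) u)"
    by (induction k) (auto simp: assms intro: *(4))
qed

lemma wt_span:
  assumes "\<And>x. x \<in> S \<Longrightarrow> wt a b x" "x \<in> span S" shows "wt a b x"
  using assms(2)
  by (induction rule: span_induct_alt)
    (use assms(1) in \<open>auto simp: wt_def rho_basis_simps scale_right_distrib mult.commute\<close>)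

lemma f6_pow: "\<exists>c. c \<noteq> 0 \<and> (\<rho> f6 ^^ k) u = c \<cdot> (\<rho> f2 ^^ (2 * k)) u"
proof (induction k)
  case 0
  then show ?case by (intro exI[of _ 1]) simp
next
  case (Suc k)
  then obtain c where c: "c \<noteq> 0" "(\<rho> f6 ^^ k) u = c \<cdot> (\<rho> f2 ^^ (2 * k)) u" by blast
  have "\<rho> f6 w = - \<rho> f2 (\<rho> f2 w)" for w by (simp add: squares)
  with c have "(\<rho> f6 ^^ Suc k) u = (- c) \<cdot> (\<rho> f2 ^^ (2 * Suc k)) u"
    by (simp add: rho_basis_simps)
  with c(1) show ?case by (intro exI[of _ "- c"]) simp
qed

lemma e6_pow: "(\<rho> e6 ^^ k) u = (\<rho> e2 ^^ (2 * k)) u"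
  by (induction k) (simp_all add: squares)

text \<open>All terms beginning with an application of some \<open>e\<close> vanish, because
  \<open>e3\<close> to \<open>e6\<close> are composed of \<open>e1\<close> and \<open>e2\<close>;
  only the Cartan part is left.\<close>

lemma casimir_hw:
  assumes "wt x y u" "\<rho> e1 u = 0" "\<rho> e2 u = 0"
  shows "casimir u = (x * x + y * y + 3 * x + y) \<cdot> u"
proof -
  have e3: "\<rho> e3 u = 0" by (simp add: composite_e(1) assms rho_basis_simps)
  then have "\<rho> e4 u = 0" "\<rho> e5 u = 0" "\<rho> e6 u = 0"
    by (simp_all add: composite_e(2) assms rho_basis_simps flip: squares(1,3))
  moreover have "\<rho> H1 (\<rho> H1 u) = (x * x) \<cdot> u" "\<rho> H2 (\<rho> H2 u) = (y * y) \<cdot> u"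
    using assms(1) by (simp_all add: wt_def rho_basis_simps)
  moreover have "\<rho> H1 u + \<rho> H1 u + \<rho> H1 u = (3 * x) \<cdot> u" "\<rho> H2 u = y \<cdot> u"
    using assms(1) by (simp_all add: wt_def flip: scale_left_distrib)
  ultimately show ?thesis
    using assms e3 by (simp add: casimir_def rho_basis_simps scale_left_distrib)
qed

section \<open>Weight spaces of a module generated by \<open>f1\<close> and
  \<open>f2\<close>\<close>

inductive f_word :: "'v \<Rightarrow> nat \<Rightarrow> nat \<Rightarrow> 'v \<Rightarrow> bool" for u where
  f_word_base: "f_word u 0 0 u"
| f_word_f1: "f_word u n1 n2 x \<Longrightarrow> f_word u (Suc n1) n2 (\<rho> f1 x)"
| f_word_f2: "f_word u n1 n2 x \<Longrightarrow> f_word u n1 (Suc n2) (\<rho> f2 x)"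

text \<open>For a highest weight vector \<open>u\<close> of weight \<lambda> this consists of
  vectors of weight \<lambda> - n1 \<alpha>1 - n2 \<alpha>2. Indexing by the counts supplies the
  depth \<open>n1 + n2\<close> for a minimality argument.\<close>

definition f_space :: "'v \<Rightarrow> nat \<Rightarrow> nat \<Rightarrow> 'v set" where
  "f_space u n1 n2 = span {x. f_word u n1 n2 x}"

definition generated :: "'v \<Rightarrow> 'v set" where
  "generated u = span {x. \<exists>n1 n2. f_word u n1 n2 x}"

lemma subspace_f_space: "subspace (f_space u n1 n2)"
  by (simp add: f_space_def)

lemma f_space_f:
  assumes "x \<in> f_space u n1 n2"
  shows "\<rho> f1 x \<in> f_space u (Suc n1) n2" "\<rho> f2 x \<in> f_space u n1 (Suc n2)"
  using rho_span[of f1 "{x. f_word u n1 n2 x}" "{x. f_word u (Suc n1) n2 x}" x]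
    rho_span[of f2 "{x. f_word u n1 n2 x}" "{x. f_word u n1 (Suc n2) x}" x] assms
  by (auto simp: f_space_def spo_basis intro: span_base f_word.intros)

lemma f_word_zero: "f_word u 0 0 x \<Longrightarrow> x = u"
  by (erule f_word.cases) auto

lemma f_space_zero: "x \<in> f_space u 0 0 \<Longrightarrow> \<exists>c. x = c \<cdot> u"
proof -
  have "{x. f_word u 0 0 x} = {u}" by (auto intro: f_word_base dest: f_word_zero)
  then show "x \<in> f_space u 0 0 \<Longrightarrow> \<exists>c. x = c \<cdot> u"
    by (auto simp: f_space_def span_singleton)
qed

lemma generated_decompose:
  assumes "z \<in> generated u"
  shows "\<exists>I g. finite I \<and> (\<forall>p\<in>I. g p \<in> f_space u (fst p) (snd p)) \<and> z = (\<Sum>p\<in>I. g p)"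
  using assms unfolding generated_def
proof (induction rule: span_induct_alt)
  case base
  show ?case by (intro exI[of _ "{}"]) simp
next
  case (step c x z)
  then obtain I g n1 n2 where I: "finite I" "\<forall>p\<in>I. g p \<in> f_space u (fst p) (snd p)"
    "z = (\<Sum>p\<in>I. g p)" and x: "f_word u n1 n2 x" by auto
  let ?p = "(n1, n2)"
  \<comment> \<open>The new term is added to the component at \<open>?p\<close>, whether or not
    \<open>I\<close> already has one there.\<close>
  let ?g = "\<lambda>p. (if p \<in> I then g p else 0) + (if p = ?p then c \<cdot> x else 0)"
  have g: "g (a, b) \<in> f_space u a b" if "(a, b) \<in> I" for a b using I(2) that by force
  have x': "c \<cdot> x \<in> f_space u n1 n2"
    using x by (auto simp: f_space_def intro: span_scale span_base)
  have "(\<Sum>p\<in>insert ?p I. if p \<in> I then g p else 0) = (\<Sum>p\<in>I. g p)"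
    using I(1) by (intro sum.mono_neutral_cong_right) auto
  then have "c \<cdot> x + z = (\<Sum>p\<in>insert ?p I. ?g p)"
    using I(1,3) by (simp add: sum.distrib add.commute)
  moreover have "\<forall>p\<in>insert ?p I. ?g p \<in> f_space u (fst p) (snd p)"
    using g x' subspace_f_space by (auto intro: subspace_add subspace_0)
  ultimately show ?case using I(1) by (intro exI[of _ "insert ?p I"] exI[of _ ?g]) simp
qed

context
  fixes l1 l2 :: nat and u :: 'v
  assumes hw: "wt (of_nat l1) (of_nat l2) u" "\<rho> e1 u = 0" "\<rho> e2 u = 0"
begin

lemma wt_f_word:
  "f_word u n1 n2 x \<Longrightarrow> wt (of_nat l1 - of_nat n1) (of_nat l2 + of_nat n1 - of_nat n2) x"
proof (induction rule: f_word.induct)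
  case (f_word_f1 n1 n2 x)
  show ?case using wt_simple(3)[OF f_word_f1.IH] by (simp add: algebra_simps)
next
  case (f_word_f2 n1 n2 x)
  show ?case using wt_simple(4)[OF f_word_f2.IH] by (simp add: algebra_simps)
qed (use hw in simp)

lemma wt_f_space:
  "x \<in> f_space u n1 n2 \<Longrightarrow> wt (of_nat l1 - of_nat n1) (of_nat l2 + of_nat n1 - of_nat n2) x"
  unfolding f_space_def by (rule wt_span[rotated]) (auto intro: wt_f_word)

lemma f_space_cartan:
  assumes "x \<in> f_space u n1 n2" shows "\<rho> H1 x \<in> f_space u n1 n2" "\<rho> H2 x \<in> f_space u n1 n2"
  using wt_f_space[OF assms] assms by (auto simp: wt_def f_space_def intro: span_scale)

text \<open>Moved through a word, \<open>e1\<close> commutes with \<open>f2\<close> and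
  \<open>e2\<close> with \<open>f1\<close>; each passage of \<open>e1\<close> over \<open>f1\<close>
  or of \<open>e2\<close> over \<open>f2\<close> leaves a Cartan element, which acts on the weight
  space by a scalar.\<close>

lemma e_f_word:
  "f_word u n1 n2 x \<Longrightarrow>
    (case n1 of 0 \<Rightarrow> \<rho> e1 x = 0 | Suc n \<Rightarrow> \<rho> e1 x \<in> f_space u n n2) \<and>
    (case n2 of 0 \<Rightarrow> \<rho> e2 x = 0 | Suc n \<Rightarrow> \<rho> e2 x \<in> f_space u n1 n)"
proof (induction rule: f_word.induct)
  case f_word_base
  then show ?case using hw by simp
next
  case (f_word_f1 n1 n2 x)
  have x: "x \<in> f_space u n1 n2"
    using f_word_f1 by (auto simp: f_space_def intro: span_base)
  have "\<rho> f1 (\<rho> e1 x) \<in> f_space u n1 n2"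
    using f_word_f1 by (cases n1) (auto simp: rho_basis_simps f_space_f, simp add: f_space_def span_zero)
  then have "\<rho> e1 (\<rho> f1 x) \<in> f_space u n1 n2"
    using f_space_cartan[OF x]
    by (auto simp: simple_relations f_space_def intro!: span_add span_diff)
  then show ?case
    using f_word_f1 by (auto simp: simple_relations rho_basis_simps f_space_f split: nat.splits)
next
  case (f_word_f2 n1 n2 x)
  have x: "x \<in> f_space u n1 n2"
    using f_word_f2 by (auto simp: f_space_def intro: span_base)
  have "\<rho> f2 (\<rho> e2 x) \<in> f_space u n1 n2"
    using f_word_f2 by (cases n2) (auto simp: rho_basis_simps f_space_f, simp add: f_space_def span_zero)
  then have "\<rho> e2 (\<rho> f2 x) \<in> f_space u n1 n2"
    using f_space_cartan[OF x]
    by (auto simp: simple_relations f_space_def intro!: span_add span_diff)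
  then show ?case
    using f_word_f2 by (auto simp: simple_relations rho_basis_simps f_space_f split: nat.splits)
qed

lemma e_f_space:
  assumes "x \<in> f_space u n1 n2"
  shows "n1 = 0 \<Longrightarrow> \<rho> e1 x = 0" "n1 = Suc n \<Longrightarrow> \<rho> e1 x \<in> f_space u n n2"
    "n2 = 0 \<Longrightarrow> \<rho> e2 x = 0" "n2 = Suc n \<Longrightarrow> \<rho> e2 x \<in> f_space u n1 n"
proof -
  let ?S = "{x. f_word u n1 n2 x}"
  have x: "x \<in> span ?S" using assms by (simp add: f_space_def)
  show "\<rho> e1 x = 0" if "n1 = 0"
    using rho_span[OF spo_basis(3) _ x, of "{}"] e_f_word that by force
  show "\<rho> e1 x \<in> f_space u n n2" if "n1 = Suc n"
    unfolding f_space_def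
    by (rule rho_span[OF spo_basis(3) _ x]) (use e_f_word that in \<open>force simp: f_space_def\<close>)
  show "\<rho> e2 x = 0" if "n2 = 0"
    using rho_span[OF spo_basis(11) _ x, of "{}"] e_f_word that by force
  show "\<rho> e2 x \<in> f_space u n1 n" if "n2 = Suc n"
    unfolding f_space_def
    by (rule rho_span[OF spo_basis(11) _ x]) (use e_f_word that in \<open>force simp: f_space_def\<close>)
qed

lemma casimir_generated:
  assumes "x \<in> f_space u n1 n2"
  shows "casimir x =
    (of_nat l1 * of_nat l1 + of_nat l2 * of_nat l2 + 3 * of_nat l1 + of_nat l2) \<cdot> x"
proof -
  have word: "casimir x =
    (of_nat l1 * of_nat l1 + of_nat l2 * of_nat l2 + 3 * of_nat l1 + of_nat l2) \<cdot> x"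
    if "f_word u n1 n2 x" for x
    using that
    by (induction rule: f_word.induct) (simp_all add: casimir_hw[OF hw] casimir_f rho_basis_simps)
  have "casimir 0 = 0" using casimir_linear(2)[of 0 0] by simp
  with assms show ?thesis
    unfolding f_space_def
  proof (induction rule: span_induct_alt)
    case (step c x y)
    then show ?case using word[of x]
      by (simp add: casimir_linear scale_right_distrib mult.commute)
  qed simp
qed

lemma nilpotent_generated:
  assumes "X \<in> spo" "\<And>n1 n2 x. f_word u n1 n2 x \<Longrightarrow> \<exists>k. (\<rho> X ^^ k) x = 0" "x \<in> generated u"
  shows "\<exists>k. (\<rho> X ^^ k) x = 0"
  using assms(3) unfolding generated_def
proof (induction rule: span_induct_alt)
  case base
  then show ?case by (intro exI[of _ 0]) simp
next
  case (step c x y)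
  then obtain k l where "(\<rho> X ^^ k) x = 0" "(\<rho> X ^^ l) y = 0" using assms(2) by blast
  then have "(\<rho> X ^^ (k + l)) x = 0" "(\<rho> X ^^ (k + l)) y = 0"
    using rho_pow_zero[OF assms(1)] by (simp_all add: funpow_add add.commute[of k l])
      (metis add.commute comp_apply funpow_add)
  then show ?case
    by (intro exI[of _ "k + l"]) (simp add: rho_pow_add rho_pow_scale assms(1))
qed

lemma f_space_subset_generated: "f_space u n1 n2 \<subseteq> generated u"
  unfolding f_space_def generated_def by (intro span_mono) auto

text \<open>
  A nonzero weight vector of minimal depth in \<open>M\<close> is a highest weight vector. Its weight \<open>\<mu>\<close> is
  dominant, and equality of the Casimir eigenvalues \<open>(\<mu>, \<mu> + 2\<rho>) = (\<lambda>, \<lambda> + 2\<rho>)\<close> with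
  \<open>2\<rho> = 3\<epsilon>\<^sub>1 + \<epsilon>\<^sub>2\<close> forces \<open>\<mu> = \<lambda>\<close>.
\<close>

lemma generator_in_submodule:
  assumes "l2 \<le> l1"
    and nil: "\<And>n1 n2 x. f_word u n1 n2 x \<Longrightarrow> \<exists>k. (\<rho> f1 ^^ k) x = 0"
      "\<And>n1 n2 x. f_word u n1 n2 x \<Longrightarrow> \<exists>k. (\<rho> f2 ^^ k) x = 0"
    and M: "subspace M" "M \<subseteq> generated u" "\<And>x. x \<in> M \<Longrightarrow> \<rho> e1 x \<in> M" "\<And>x. x \<in> M \<Longrightarrow> \<rho> e2 x \<in> M"
      "\<And>x. x \<in> M \<Longrightarrow> \<rho> H1 x \<in> M" "\<And>x. x \<in> M \<Longrightarrow> \<rho> H2 x \<in> M"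
    and "z \<in> M" "z \<noteq> 0"
  shows "u \<in> M"
proof -
  have "\<exists>y n1 n2. y \<in> M \<and> y \<noteq> 0 \<and> y \<in> f_space u n1 n2"
  proof -
    obtain I g where I: "finite I" "\<forall>p\<in>I. g p \<in> f_space u (fst p) (snd p)" "z = (\<Sum>p\<in>I. g p)"
      using generated_decompose[of z u] M(2) \<open>z \<in> M\<close> by blast
    \<comment> \<open>One operator that separates all weights: its eigenvalues have the two real
      coordinates of the weight as real and imaginary part.\<close>
    define T where "T x = \<rho> H1 x + \<i> \<cdot> \<rho> H2 x" for x
    let ?t = "\<lambda>p::nat \<times> nat. of_nat l1 - of_nat (fst p) +
      \<i> * (of_nat l2 + of_nat (fst p) - of_nat (snd p)) :: complex"
    have "g p \<in> M" if "p \<in> I" for p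
    proof (rule eigencomponents_in_subspace[OF M(1), of T I ?t])
      show "Vector_Spaces.linear scale scale T"
        unfolding T_def
        by unfold_locales (simp_all add: rho_basis_simps scale_right_distrib mult.commute)
      show "inj_on ?t I"
      proof (rule inj_onI)
        fix p q assume *: "?t p = ?t q"
        have "fst p = fst q" using arg_cong[OF *, of Re] by simp
        moreover from this have "snd p = snd q" using arg_cong[OF *, of Im] by simp
        ultimately show "p = q" by (rule prod_eqI)
      qed
      show "T (g p) = ?t p \<cdot> g p" if "p \<in> I" for p
        using wt_f_space[OF bspec[OF I(2) that]] by (simp add: T_def wt_def scale_left_distrib)
      show "T x \<in> M" if "x \<in> M" for x
        unfolding T_def using that by (intro subspace_add[OF M(1)] subspace_scale[OF M(1)] M(5,6))
      show "(\<Sum>p\<in>I. g p) \<in> M" using \<open>z \<in> M\<close> I(3) by simp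
    qed (fact I(1), fact that)
    moreover have "\<exists>p\<in>I. g p \<noteq> 0"
    proof (rule ccontr)
      assume "\<not> (\<exists>p\<in>I. g p \<noteq> 0)"
      then have "(\<Sum>p\<in>I. g p) = 0" by (intro sum.neutral) auto
      then show False using I(3) \<open>z \<noteq> 0\<close> by simp
    qed
    then obtain p where "p \<in> I" "g p \<noteq> 0" by auto
    ultimately show ?thesis using I(2) by (intro exI[of _ "g p"] exI conjI) auto
  qed
  then have ex: "\<exists>n y n1 n2. y \<in> M \<and> y \<noteq> 0 \<and> y \<in> f_space u n1 n2 \<and> n = n1 + n2"
    by (elim exE) (intro exI, auto)
  define P where "P n \<longleftrightarrow> (\<exists>y n1 n2. y \<in> M \<and> y \<noteq> 0 \<and> y \<in> f_space u n1 n2 \<and> n = n1 + n2)" for n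
  define n where "n = (LEAST n. P n)"
  have "P n" unfolding n_def by (rule LeastI_ex) (use ex in \<open>simp add: P_def\<close>)
  then obtain y n1 n2 where y: "y \<in> M" "y \<noteq> 0" "y \<in> f_space u n1 n2" and n: "n = n1 + n2"
    by (auto simp: P_def)
  have least: "w = 0" if "w \<in> M" "w \<in> f_space u k1 k2" "k1 + k2 < n" for w k1 k2
  proof -
    have "\<not> P (k1 + k2)" using that(3) unfolding n_def by (rule not_less_Least)
    then show ?thesis using that(1,2) unfolding P_def by blast
  qed
  have e1: "\<rho> e1 y = 0"
    using e_f_space(1,2)[OF y(3)] least[of "\<rho> e1 y" "n1 - 1" n2] M(3)[OF y(1)] n
    by (cases n1) auto
  have e2: "\<rho> e2 y = 0"
    using e_f_space(3,4)[OF y(3)] least[of "\<rho> e2 y" n1 "n2 - 1"] M(4)[OF y(1)] n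
    by (cases n2) auto
  define p q :: int where "p = int l1 - int n1" and "q = int l2 + int n1 - int n2"
  have wt_y: "wt (of_int p) (of_int q) y"
    using wt_f_space[OF y(3)] by (simp add: p_def q_def)
  have y_gen: "y \<in> generated u" using y(3) f_space_subset_generated by blast
  have "q \<le> p"
  proof -
    interpret sl2_triple scale "\<rho> e1" "\<rho> f1" "\<lambda>u. \<rho> H1 u - \<rho> H2 u" by (rule sl2_e1_f1)
    have "\<exists>k. (\<rho> f1 ^^ k) y = 0"
      by (rule nilpotent_generated) (fact spo_basis(4), erule nil(1), fact y_gen)
    then obtain k where "(\<rho> f1 ^^ k) y = 0" ..
    moreover have "\<rho> H1 y - \<rho> H2 y = of_int (p - q) \<cdot> y"
      using wt_y by (simp add: wt_def scale_left_diff_distrib)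
    ultimately obtain m :: nat where "(of_int (p - q) :: complex) = of_nat m"
      using hw_dominant e1 y(2) by blast
    then have "p - q = int m" by (metis of_int_eq_iff of_int_of_nat_eq)
    then show ?thesis by simp
  qed
  moreover have "q \<ge> 0"
  proof -
    interpret sl2_triple scale "\<rho> e6" "\<rho> f6" "\<rho> H2" by (rule sl2_e6_f6)
    have "\<exists>k. (\<rho> f2 ^^ k) y = 0"
      by (rule nilpotent_generated) (fact spo_basis(12), erule nil(2), fact y_gen)
    then obtain k where k: "(\<rho> f2 ^^ k) y = 0" ..
    have "(\<rho> f2 ^^ (2 * k)) y = 0"
      using k rho_pow_zero[OF spo_basis(12)] by (simp add: mult_2 funpow_add)
    then have "(\<rho> f6 ^^ k) y = 0" using f6_pow[of k y] by auto
    moreover have "\<rho> e6 y = 0" using e2 by (simp add: rho_basis_simps flip: squares(1))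
    ultimately obtain m :: nat where "(of_int q :: complex) = of_nat m"
      using hw_dominant[of y "of_int q"] wt_y y(2) by (auto simp: wt_def)
    then have "q = int m" by (metis of_int_eq_iff of_int_of_nat_eq)
    then show ?thesis by simp
  qed
  moreover have "p * p + q * q + 3 * p + q = int l1 * int l1 + int l2 * int l2 + 3 * int l1 + int l2"
  proof -
    have "(of_int (p * p + q * q + 3 * p + q) -
        of_int (int l1 * int l1 + int l2 * int l2 + 3 * int l1 + int l2)) \<cdot> y = 0"
      using casimir_hw[OF wt_y e1 e2] casimir_generated[OF y(3)]
      by (auto simp: scale_left_diff_distrib)
    then show ?thesis using y(2) by (simp only: scale_eq_0_iff right_minus_eq of_int_eq_iff) simp
  qed
  \<comment> \<open>With \<mu> = (p, q), the difference of the Casimir eigenvalues is (\<lambda> -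
    \<mu>, \<lambda> + \<mu> + 2\<rho>), where \<lambda> - \<mu> = n1 \<alpha>1 + n2 \<alpha>2. By
    dominance both simple roots pair positively with the second argument, so \<open>n1\<close> and
    \<open>n2\<close> must vanish.\<close>
  moreover have "p * p + q * q + 3 * p + q +
      (int n1 * (int l1 + p + 2 - int l2 - q) + int n2 * (int l2 + q + 1)) =
      int l1 * int l1 + int l2 * int l2 + 3 * int l1 + int l2"
    unfolding p_def q_def by (simp add: algebra_simps)
  ultimately have "int n1 * (int l1 + p + 2 - int l2 - q) + int n2 * (int l2 + q + 1) = 0"
    and pos: "int l1 + p + 2 - int l2 - q > 0" "int l2 + q + 1 > 0"
    using \<open>l2 \<le> l1\<close> by linarith+
  moreover have "int n1 * (int l1 + p + 2 - int l2 - q) \<ge> 0" "int n2 * (int l2 + q + 1) \<ge> 0"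
    using pos by simp_all
  ultimately have "int n1 * (int l1 + p + 2 - int l2 - q) = 0" "int n2 * (int l2 + q + 1) = 0"
    by linarith+
  then have "n1 = 0" "n2 = 0" using pos by auto
  then obtain c where c: "y = c \<cdot> u" using f_space_zero y(3) by blast
  then show ?thesis using y(1,2) subspace_scale_cancel[OF M(1), of c u] by auto
qed

end

end

section \<open>Verma vectors span\<close>

locale spo_hw_module = spo_module scale \<rho>
  for scale :: "complex \<Rightarrow> 'v::ab_group_add \<Rightarrow> 'v" (infixr "\<cdot>" 75) and \<rho> +
  fixes m1 m2 :: nat and v :: 'v
  assumes hw: "wt (of_nat (m1 + m2)) (of_nat m2) v" "\<rho> e1 v = 0" "\<rho> e2 v = 0"
    and v_nonzero: "v \<noteq> 0"
    and generated_v: "generated v = UNIV"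
    and nilpotent_f1: "\<exists>k. (\<rho> f1 ^^ k) u = 0"
    and nilpotent_f2: "\<exists>k. (\<rho> f2 ^^ k) u = 0"
begin

section \<open>The weights lie in the octagon spanned by the Weyl group orbit\<close>

lemma wt_unique: "wt x y u \<Longrightarrow> wt x' y' u \<Longrightarrow> u \<noteq> 0 \<Longrightarrow> x = x' \<and> y = y'"
  by (metis wt_def scale_right_imp_eq)

lemma wt_cong: "wt x y u \<Longrightarrow> x = x' \<Longrightarrow> y = y' \<Longrightarrow> wt x' y' u"
  by simp

lemma wt_h: "wt x y u \<Longrightarrow> x - y = t \<Longrightarrow> \<rho> H1 u - \<rho> H2 u = t \<cdot> u"
  by (auto simp: wt_def scale_left_diff_distrib)

text \<open>\<open>f2\<close> is a square root of \<open>f6\<close> up to sign, so a string of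
  length \<open>n\<close> for \<open>f6\<close> gives one of length \<open>2 * n\<close> for
  \<open>f2\<close>. This is where the bound \<open>2 * m2\<close> comes from.\<close>

lemma f2_pow_nonzero:
  assumes "\<rho> H2 u = of_nat n \<cdot> u" "\<rho> e2 u = 0" "u \<noteq> 0"
  shows "(\<rho> f2 ^^ (2 * n)) u \<noteq> 0"
proof -
  interpret sl2_triple scale "\<rho> e6" "\<rho> f6" "\<rho> H2" by (rule sl2_e6_f6)
  have "\<rho> e6 u = 0" by (simp add: assms(2) rho_basis_simps flip: squares(1))
  then have "(\<rho> f6 ^^ n) u \<noteq> 0" using f_pow_nonzero[OF assms(1) _ assms(3) order_refl] by simp
  then show ?thesis using f6_pow[of n u] by auto
qed

text \<open>The line through \<open>z\<close> is stable under \<open>H1\<close> and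
  \<open>H2\<close>, hence contains the components of \<open>z\<close> in the spaces
  \<open>f_space\<close>. A nonzero component is a multiple of \<open>z\<close> and shows its
  weight.\<close>

lemma weights_below:
  assumes "wt x y z" "z \<noteq> 0"
  shows "\<exists>n1 n2. x = of_nat (m1 + m2) - of_nat n1 \<and> y = of_nat m2 + of_nat n1 - of_nat n2"
proof -
  obtain I g where I: "finite I" "\<forall>p\<in>I. g p \<in> f_space v (fst p) (snd p)" "z = (\<Sum>p\<in>I. g p)"
    using generated_decompose[of z v] generated_v by auto
  have wt_g: "wt (of_nat (m1 + m2) - of_nat (fst p)) (of_nat m2 + of_nat (fst p) - of_nat (snd p)) (g p)"
    if "p \<in> I" for p
    using wt_f_space[OF hw bspec[OF I(2) that]] .
  define T where "T x = \<rho> H1 x + \<i> \<cdot> \<rho> H2 x" for x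
  let ?t = "\<lambda>p::nat \<times> nat. of_nat (m1 + m2) - of_nat (fst p) +
    \<i> * (of_nat m2 + of_nat (fst p) - of_nat (snd p)) :: complex"
  have g_span: "g p \<in> span {z}" if "p \<in> I" for p
  proof (rule eigencomponents_in_subspace[of "span {z}" T I ?t])
    show "Vector_Spaces.linear scale scale T"
      unfolding T_def
      by unfold_locales (simp_all add: rho_basis_simps scale_right_distrib mult.commute)
    show "inj_on ?t I"
    proof (rule inj_onI)
      fix p q assume *: "?t p = ?t q"
      have "fst p = fst q" using arg_cong[OF *, of Re] by simp
      moreover from this have "snd p = snd q" using arg_cong[OF *, of Im] by simp
      ultimately show "p = q" by (rule prod_eqI)
    qed
    show "T (g p) = ?t p \<cdot> g p" if "p \<in> I" for p
      using wt_g[OF that] by (simp add: T_def wt_def scale_left_distrib)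
    show "T x \<in> span {z}" if x: "x \<in> span {z}" for x
    proof -
      obtain c where "x = c \<cdot> z" using x by (auto simp: span_singleton)
      then have "T x = (c * (x' + \<i> * y')) \<cdot> z" if "wt x' y' z" for x' y'
        using that by (simp add: T_def wt_def rho_basis_simps scale_left_distrib distrib_left mult.left_commute)
      then show ?thesis using assms(1) by (auto simp: span_singleton)
    qed
    show "(\<Sum>p\<in>I. g p) \<in> span {z}" using I(3) by (simp add: span_base)
  qed (simp, fact I(1), fact that)
  have "\<exists>p\<in>I. g p \<noteq> 0"
  proof (rule ccontr)
    assume "\<not> (\<exists>p\<in>I. g p \<noteq> 0)"
    then have "(\<Sum>p\<in>I. g p) = 0" by (intro sum.neutral) auto
    then show False using I(3) \<open>z \<noteq> 0\<close> by simp
  qed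
  then obtain p where p: "p \<in> I" "g p \<noteq> 0" by auto
  obtain c where "g p = c \<cdot> z" using g_span[OF p(1)] by (auto simp: span_singleton)
  then have "wt x y (g p)"
    using assms(1) by (simp add: wt_def rho_basis_simps mult.commute)
  then show ?thesis using wt_unique[OF _ wt_g[OF p(1)] p(2)] by blast
qed

definition is_weight :: "int \<Rightarrow> int \<Rightarrow> bool" where
  "is_weight a b \<longleftrightarrow> (\<exists>z. z \<noteq> 0 \<and> wt (of_int a) (of_int b) z)"

lemma is_weight_below: "is_weight a b \<Longrightarrow> a \<le> int (m1 + m2) \<and> a + b \<le> int (m1 + m2) + int m2"
proof -
  assume "is_weight a b"
  then obtain z where z: "z \<noteq> 0" "wt (of_int a) (of_int b) z" by (auto simp: is_weight_def)
  obtain n1 n2 where "(of_int a :: complex) = of_nat (m1 + m2) - of_nat n1"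
    "(of_int b :: complex) = of_nat m2 + of_nat n1 - of_nat n2"
    using weights_below[OF z(2,1)] by auto
  then have "(of_int a :: complex) = of_int (int (m1 + m2) - int n1)"
    "(of_int b :: complex) = of_int (int m2 + int n1 - int n2)" by simp_all
  then show ?thesis unfolding of_int_eq_iff by auto
qed

text \<open>The reflection in \<epsilon>2: \<open>e6^N\<close> is injective on vectors of
  \<open>H2\<close>-weight \<open>-N\<close>, and it raises this weight to \<open>N\<close>. Only
  this upward direction is used, which suffices to move weights toward the dominant chamber.\<close>

lemma reflect_short: "is_weight a b \<Longrightarrow> b \<le> 0 \<Longrightarrow> is_weight a (- b)"
proof -
  assume "is_weight a b" "b \<le> 0"
  then obtain z where z: "z \<noteq> 0" "wt (of_int a) (of_int b) z" by (auto simp: is_weight_def)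
  interpret sl2_triple scale "\<rho> e6" "\<rho> f6" "\<rho> H2" by (rule sl2_e6_f6)
  define N where "N = nat (- b)"
  have b: "(of_int b :: complex) = - of_nat N" using \<open>b \<le> 0\<close> by (simp add: N_def of_nat_nat)
  obtain k where "(\<rho> f2 ^^ k) z = 0" using nilpotent_f2 by blast
  then have "(\<rho> f2 ^^ (2 * k)) z = 0"
    using rho_pow_zero[OF spo_basis(12)] by (simp add: mult_2 funpow_add)
  then have "(\<rho> f6 ^^ k) z = 0" using f6_pow[of k z] by auto
  then have "(\<rho> e6 ^^ N) z \<noteq> 0"
    using raise_injective[of "{0}" z N k] z by (auto simp: wt_def b rho_basis_simps)
  then have nz: "(\<rho> e2 ^^ (2 * N)) z \<noteq> 0" by (simp add: e6_pow)
  have eq: "(of_int b + of_nat (2 * N) :: complex) = of_int (- b)" by (simp add: b)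
  show ?thesis
    unfolding is_weight_def using nz wt_pow(2)[OF z(2), of "2 * N"] unfolding eq by blast
qed

text \<open>The reflection in \<epsilon>1 - \<epsilon>2, by injectivity of a power of
  \<open>e1\<close>.\<close>

lemma reflect_long: "is_weight a b \<Longrightarrow> a \<le> b \<Longrightarrow> is_weight b a"
proof -
  assume "is_weight a b" "a \<le> b"
  then obtain z where z: "z \<noteq> 0" "wt (of_int a) (of_int b) z" by (auto simp: is_weight_def)
  interpret sl2_triple scale "\<rho> e1" "\<rho> f1" "\<lambda>u. \<rho> H1 u - \<rho> H2 u" by (rule sl2_e1_f1)
  define N where "N = nat (b - a)"
  have N: "(of_nat N :: complex) = of_int b - of_int a" using \<open>a \<le> b\<close> by (simp add: N_def of_nat_nat)
  obtain k where "(\<rho> f1 ^^ k) z = 0" using nilpotent_f1 by blast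
  moreover have "\<rho> H1 z - \<rho> H2 z = (- of_nat N) \<cdot> z"
    using z(2) by (simp add: wt_def N scale_left_diff_distrib)
  ultimately have "(\<rho> e1 ^^ N) z \<noteq> 0"
    using raise_injective[of "{0}" z N k] z(1) by (auto simp: rho_basis_simps)
  moreover have "wt (of_int b) (of_int a) ((\<rho> e1 ^^ N) z)"
    using wt_pow(1)[OF z(2), of N] by (simp add: N)
  ultimately show ?thesis unfolding is_weight_def by blast
qed

text \<open>\<open>is_weight_below\<close> supplies two of the eight sides, and the reflections
  carry them to the other six. As the reflections are available upward only, the signs of the
  coordinates have to be distinguished.\<close>

lemma weights_in_octagon:
  assumes "is_weight a b"
  shows "\<bar>a\<bar> \<le> int (m1 + m2)" "\<bar>b\<bar> \<le> int (m1 + m2)" "\<bar>a\<bar> + \<bar>b\<bar> \<le> int (m1 + m2) + int m2"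
proof -
  have upper: "b \<le> int (m1 + m2)" if "is_weight a b" for a b
    using reflect_long[OF that] is_weight_below[of b a] is_weight_below[OF that] by linarith
  have lower: "- b \<le> int (m1 + m2) \<and> a - b \<le> int (m1 + m2) + int m2" if "is_weight a b" for a b
    using reflect_short[OF that] upper[of a "- b"] is_weight_below[of a "- b"]
      is_weight_below[OF that] by linarith
  have left: "- a \<le> int (m1 + m2) \<and> - a + b \<le> int (m1 + m2) + int m2 \<and>
    - a - b \<le> int (m1 + m2) + int m2" if "is_weight a b" "a < 0" for a b
  proof (cases "a \<le> b")
    case True
    then have ba: "is_weight b a" by (rule reflect_long[OF that(1)])
    have "- a - b \<le> int (m1 + m2) + int m2" if "b \<le> 0"
    proof -
      have "is_weight (- a) b"
        using reflect_long[OF reflect_short[OF ba]] \<open>a < 0\<close> that by simp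
      then show ?thesis using lower by force
    qed
    moreover have "- a - b \<le> b - a" if "b > 0" using that by simp
    ultimately show ?thesis using lower[OF ba] by linarith
  next
    case False
    then have "is_weight (- b) a"
      using reflect_long[OF reflect_short[OF that(1)]] that(2) by simp
    then show ?thesis using lower[of "- b" a] False by linarith
  qed
  show "\<bar>a\<bar> \<le> int (m1 + m2)" "\<bar>b\<bar> \<le> int (m1 + m2)" "\<bar>a\<bar> + \<bar>b\<bar> \<le> int (m1 + m2) + int m2"
    using upper[OF assms] lower[OF assms] left[OF assms] is_weight_below[OF assms] by linarith+
qed

lemma outside_octagon:
  assumes "wt x y z" "x = of_int a" "y = of_int b"
    "\<bar>a\<bar> > int (m1 + m2) \<or> \<bar>b\<bar> > int (m1 + m2) \<or> \<bar>a\<bar> + \<bar>b\<bar> > int (m1 + m2) + int m2"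
  shows "z = 0"
  using weights_in_octagon[of a b] assms unfolding is_weight_def by force

section \<open>Shortening the strings\<close>

definition Y :: "nat \<Rightarrow> nat \<Rightarrow> nat \<Rightarrow> 'v" where
  "Y a b c = (\<rho> f2 ^^ c) ((\<rho> f1 ^^ b) ((\<rho> f2 ^^ a) v))"

lemma wt_Y: "wt (of_nat (m1 + m2) - of_nat b) (of_nat m2 - of_nat a + of_nat b - of_nat c) (Y a b c)"
  unfolding Y_def by (intro wt_pow hw)

lemma e1_f2_pow: "\<rho> e1 ((\<rho> f2 ^^ k) u) = (\<rho> f2 ^^ k) (\<rho> e1 u)"
  by (induction k) (simp_all add: simple_relations)

lemma e2_f1_pow: "\<rho> e2 ((\<rho> f1 ^^ k) u) = (\<rho> f1 ^^ k) (\<rho> e2 u)"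
  by (induction k) (simp_all add: simple_relations)

lemma Y_vanishes: "a > 2 * m2 \<Longrightarrow> Y a b c = 0" "b > m1 + a \<Longrightarrow> Y a b c = 0"
proof -
  have "(\<rho> f2 ^^ a) v = 0" if "a > 2 * m2"
    by (rule outside_octagon[where a = "int (m1 + m2)" and b = "int m2 - int a", OF wt_pow(4)[OF hw(1)]])
      (use that in auto)
  then show "a > 2 * m2 \<Longrightarrow> Y a b c = 0" by (simp add: Y_def rho_pow_zero spo_basis)
  have "(\<rho> f1 ^^ b) ((\<rho> f2 ^^ a) v) = 0" if "b > m1 + a"
    by (rule outside_octagon[where a = "int (m1 + m2) - int b" and b = "int m2 - int a + int b",
          OF wt_pow(3)[OF wt_pow(4)[OF hw(1)]]])
      (use that in auto)
  then show "b > m1 + a \<Longrightarrow> Y a b c = 0" by (simp add: Y_def rho_pow_zero spo_basis)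
qed

text \<open>\<open>e1\<close> commutes with \<open>f2\<close>, so only the middle string
  contributes, and it starts at \<open>f2^a v\<close>, a vector killed by \<open>e1\<close> of
  weight \<open>m1 + a\<close> for this sl2.\<close>

lemma e1_Y: "\<rho> e1 (Y a b c) = (of_nat b * (of_nat m1 + of_nat a - of_nat b + 1)) \<cdot> Y a (b - 1) c"
proof -
  interpret sl2_triple scale "\<rho> e1" "\<rho> f1" "\<lambda>u. \<rho> H1 u - \<rho> H2 u" by (rule sl2_e1_f1)
  let ?u = "(\<rho> f2 ^^ a) v"
  have "\<rho> H1 ?u - \<rho> H2 ?u = (of_nat m1 + of_nat a) \<cdot> ?u"
    using wt_pow(4)[OF hw(1), of a] by (simp add: wt_def flip: scale_left_diff_distrib)
  from e_f_pow[OF this, of b] show ?thesis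
    by (simp add: Y_def e1_f2_pow hw kap_sl2 rho_pow_zero rho_pow_scale spo_basis)
qed

text \<open>The closed form of \<open>kap a m2\<close> for osp(1|2). It is nonzero for
  \<open>0 < a \<le> 2 * m2\<close> and vanishes at \<open>a = 2 * m2 + 1\<close>.\<close>

definition kappa :: "nat \<Rightarrow> complex" where
  "kappa a = (if even a then - of_nat (a div 2) else of_nat m2 - of_nat (a div 2))"

lemma e2_f2_pow_v: "\<rho> e2 ((\<rho> f2 ^^ a) v) = kappa a \<cdot> (\<rho> f2 ^^ (a - 1)) v"
proof -
  interpret ladder scale "\<rho> e2" "\<rho> f2" "\<rho> H2" "- 1" 1 by (rule odd_ladder)
  have "kap a (of_nat m2) = kappa a"
    by (induction a) (auto simp: kappa_def elim!: oddE)
  then show ?thesis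
    using e_f_pow[of v "of_nat m2" a] hw by (simp add: wt_def rho_pow_zero spo_basis)
qed

lemma kappa_nonzero: "0 < a \<Longrightarrow> a \<le> 2 * m2 \<Longrightarrow> kappa a \<noteq> 0"
  by (auto simp: kappa_def elim!: oddE evenE)

text \<open>\<open>Y (2 * m2) b 0\<close> has weight (m1 + m2 - b, b - m2). More than
  \<open>b + m1\<close> applications of \<open>f2\<close> leave the octagon through the side y =
  -(m1 + m2), more than \<open>2 * b\<close> through the side x - y = m1 + 2 m2.\<close>

definition J :: "nat \<Rightarrow> nat" where "J b = min (b + m1) (2 * b)"

text \<open>\<open>e2\<close> commutes with \<open>f1\<close>, so from the bottom of the first
  string it climbs through all \<open>Y a b 0\<close> with the nonzero coefficients
  \<open>kappa\<close>.\<close>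

lemma e2_pow_bottom:
  "i \<le> 2 * m2 \<Longrightarrow> \<exists>c. c \<noteq> 0 \<and> (\<rho> e2 ^^ i) (Y (2 * m2) b 0) = c \<cdot> Y (2 * m2 - i) b 0"
proof (induction i)
  case 0
  then show ?case by (intro exI[of _ 1]) simp
next
  case (Suc i)
  then obtain c where c: "c \<noteq> 0" "(\<rho> e2 ^^ i) (Y (2 * m2) b 0) = c \<cdot> Y (2 * m2 - i) b 0" by auto
  have "\<rho> e2 (Y a b 0) = kappa a \<cdot> Y (a - 1) b 0" for a
    by (simp add: Y_def e2_f1_pow e2_f2_pow_v rho_pow_scale spo_basis)
  then show ?case using c Suc.prems kappa_nonzero[of "2 * m2 - i"]
    by (intro exI[of _ "c * kappa (2 * m2 - i)"]) (simp add: rho_basis_simps)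
qed

lemma e2_pow_bottom_zero: "i > 2 * m2 \<Longrightarrow> (\<rho> e2 ^^ i) (Y (2 * m2) b 0) = 0"
proof -
  assume i: "i > 2 * m2"
  obtain c where "(\<rho> e2 ^^ (2 * m2)) (Y (2 * m2) b 0) = c \<cdot> Y 0 b 0"
    using e2_pow_bottom[of "2 * m2" b] by auto
  then have "(\<rho> e2 ^^ Suc (2 * m2)) (Y (2 * m2) b 0) = 0"
    using hw by (simp add: Y_def e2_f1_pow rho_pow_zero rho_basis_simps spo_basis)
  moreover have "(\<rho> e2 ^^ i) u = (\<rho> e2 ^^ (i - Suc (2 * m2))) ((\<rho> e2 ^^ Suc (2 * m2)) u)" for u
    using i by (simp only: funpow_add[symmetric, THEN fun_cong, unfolded comp_apply]) simp
  ultimately show ?thesis by (simp only:) (simp add: rho_pow_zero spo_basis)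
qed

text \<open>Up to nonzero scalars all \<open>Y a b 0\<close> with \<open>a \<le> 2 * m2\<close> form
  the \<open>e2\<close>-string above \<open>Y (2 * m2) b 0\<close>. The octagon stops the
  \<open>f2\<close>-string of that one vector after \<open>J b\<close> steps, and
  \<open>truncated_f_powers\<close> transfers the bound to the whole
  \<open>e2\<close>-string.\<close>

lemma Y_reduce: "Y a b c \<in> span {Y a' b c' | a' c'. a' \<le> 2 * m2 \<and> c' \<le> c \<and> c' \<le> J b}"
proof (cases "c \<le> J b \<or> a > 2 * m2")
  case True
  show ?thesis
  proof (cases "a > 2 * m2")
    case False
    with True have "c \<le> J b" "a \<le> 2 * m2" by auto
    then show ?thesis by (intro span_base) auto
  qed (simp add: Y_vanishes span_zero)
next
  case False
  interpret ladder scale "\<rho> e2" "\<rho> f2" "\<rho> H2" "- 1" 1 by (rule odd_ladder)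
  let ?x = "Y (2 * m2) b 0"
  let ?S = "{Y a' b c' | a' c'. a' \<le> 2 * m2 \<and> c' \<le> c \<and> c' \<le> J b}"
  have Y_c: "Y a b c = (\<rho> f2 ^^ c) (Y a b 0)" for a c by (simp add: Y_def)
  have "(\<rho> f2 ^^ Suc (J b)) ?x = 0"
    by (rule outside_octagon[where a = "int (m1 + m2) - int b"
          and b = "int b - int m2 - int (Suc (J b))", OF wt_pow(4)[OF wt_Y]])
      (auto simp: J_def min_def)
  moreover have "\<rho> H2 ?x = (of_nat m2 - of_nat (2 * m2) + of_nat b - of_nat 0) \<cdot> ?x"
    using wt_Y[of b "2 * m2" 0] by (simp add: wt_def)
  ultimately have *: "(\<rho> f2 ^^ c) ((\<rho> e2 ^^ i) ?x) \<in>
      span ({(\<rho> f2 ^^ j) ((\<rho> e2 ^^ i) ?x) | j i. j \<le> J b} \<union> {0})" for i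
    by (intro truncated_f_powers) (auto simp: rho_basis_simps)
  have "{(\<rho> f2 ^^ j) ((\<rho> e2 ^^ i) ?x) | j i. j \<le> J b} \<union> {0} \<subseteq> span ?S"
  proof safe
    fix j i assume j: "j \<le> J b"
    show "(\<rho> f2 ^^ j) ((\<rho> e2 ^^ i) ?x) \<in> span ?S"
    proof (cases "i \<le> 2 * m2")
      case True
      then obtain k where "(\<rho> e2 ^^ i) ?x = k \<cdot> Y (2 * m2 - i) b 0" using e2_pow_bottom by blast
      then have "(\<rho> f2 ^^ j) ((\<rho> e2 ^^ i) ?x) = k \<cdot> Y (2 * m2 - i) b j"
        by (simp add: rho_pow_scale spo_basis Y_def)
      then show ?thesis using j False
        by (simp only:) (intro span_scale span_base CollectI, rule exI[of _ "2 * m2 - i"],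
            rule exI[of _ j], auto)
    qed (simp add: e2_pow_bottom_zero rho_pow_zero spo_basis span_zero)
  qed (rule span_zero)
  then have "(\<rho> f2 ^^ c) ((\<rho> e2 ^^ i) ?x) \<in> span ?S" for i
    using * span_minimal[OF _ subspace_span] by blast
  moreover obtain k where "k \<noteq> 0" "(\<rho> e2 ^^ (2 * m2 - a)) ?x = k \<cdot> Y a b 0"
    using e2_pow_bottom[of "2 * m2 - a" b] False by auto
  ultimately show ?thesis
    using subspace_scale_cancel[OF subspace_span, of k "Y a b c"] Y_c[of a c]
    by (metis (no_types, lifting) rho_pow_scale spo_basis(12))
qed

definition verma_span :: "'v set" where
  "verma_span = span {(\<rho> f1 ^^ b4) (Y b1 b2 b3) | b1 b2 b3 b4.
    b1 \<le> 2 * m2 \<and> b2 \<le> m1 + b1 \<and> b3 \<le> J b2 \<and> b4 \<le> min m1 (b3 div 2)}"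

lemma subspace_verma_span: "subspace verma_span"
  by (simp add: verma_span_def)

lemma e1_f1_Y: "\<exists>t. \<rho> e1 ((\<rho> f1 ^^ j) (Y a b c)) =
  (of_nat b * (of_nat m1 + of_nat a - of_nat b + 1)) \<cdot> (\<rho> f1 ^^ j) (Y a (b - 1) c)
  + t \<cdot> (\<rho> f1 ^^ (j - 1)) (Y a b c)"
proof -
  interpret sl2_triple scale "\<rho> e1" "\<rho> f1" "\<lambda>u. \<rho> H1 u - \<rho> H2 u" by (rule sl2_e1_f1)
  obtain s where "\<rho> H1 (Y a b c) - \<rho> H2 (Y a b c) = s \<cdot> Y a b c"
    using wt_Y[of b a c] by (auto simp: wt_def simp flip: scale_left_diff_distrib)
  from e_f_pow[OF this, of j] show ?thesis
    by (auto simp: e1_Y rho_pow_scale spo_basis)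
qed

text \<open>The counterpart of \<open>e2_pow_bottom\<close> for the second string: from its end
  \<open>b = m1 + a\<close>, every smaller \<open>b\<close> is reached with a nonzero
  coefficient.\<close>

lemma e1_pow_top:
  "i \<le> m1 + a \<Longrightarrow> \<exists>k. k \<noteq> 0 \<and> (\<rho> e1 ^^ i) (Y a (m1 + a) c) = k \<cdot> Y a (m1 + a - i) c"
proof (induction i)
  case 0
  then show ?case by (intro exI[of _ 1]) simp
next
  case (Suc i)
  then obtain k where k: "k \<noteq> 0" "(\<rho> e1 ^^ i) (Y a (m1 + a) c) = k \<cdot> Y a (m1 + a - i) c" by auto
  define k' :: complex where
    "k' = of_nat (m1 + a - i) * (of_nat m1 + of_nat a - of_nat (m1 + a - i) + 1)"
  have "of_nat m1 + of_nat a - of_nat (m1 + a - i) + 1 = (of_nat (Suc i) :: complex)"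
    using Suc.prems by (simp add: of_nat_diff)
  then have "k' \<noteq> 0"
    using Suc.prems by (simp only: k'_def mult_eq_0_iff of_nat_eq_0_iff) simp
  moreover have "\<rho> e1 (Y a (m1 + a - i) c) = k' \<cdot> Y a (m1 + a - i - 1) c"
    by (simp only: e1_Y k'_def)
  then have "(\<rho> e1 ^^ Suc i) (Y a (m1 + a) c) = (k * k') \<cdot> Y a (m1 + a - Suc i) c"
    using k(2) by (simp add: rho_basis_simps)
  ultimately show ?case using k(1) by (intro exI[of _ "k * k'"]) simp
qed

lemma e1_pow_top_zero: "i > m1 + a \<Longrightarrow> (\<rho> e1 ^^ i) (Y a (m1 + a) c) = 0"
proof -
  assume i: "i > m1 + a"
  obtain k where "(\<rho> e1 ^^ (m1 + a)) (Y a (m1 + a) c) = k \<cdot> Y a 0 c"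
    using e1_pow_top[of "m1 + a" a c] by auto
  then have "(\<rho> e1 ^^ Suc (m1 + a)) (Y a (m1 + a) c) = 0"
    by (simp add: rho_basis_simps e1_Y)
  moreover have "(\<rho> e1 ^^ i) u = (\<rho> e1 ^^ (i - Suc (m1 + a))) ((\<rho> e1 ^^ Suc (m1 + a)) u)" for u
    using i by (simp only: funpow_add[symmetric, THEN fun_cong, unfolded comp_apply]) simp
  ultimately show ?thesis by (simp only:) (simp add: rho_pow_zero spo_basis)
qed

text \<open>The filtration by the exponent of the third string. Neither \<open>e1\<close> nor
  \<open>f1\<close> raises that exponent, so the sl2 of \<open>e1\<close>, \<open>f1\<close> acts on
  the quotients.\<close>

definition lower :: "nat \<Rightarrow> 'v set" where
  "lower c = span {(\<rho> f1 ^^ j) (Y a b c') | j a b c'. c' < c}"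

lemma lower_base: "c' < c \<Longrightarrow> (\<rho> f1 ^^ j) (Y a b c') \<in> lower c"
  unfolding lower_def by (rule span_base) auto

lemma subspace_lower: "subspace (lower c)"
  by (simp add: lower_def)

lemma lower_f1: "x \<in> lower c \<Longrightarrow> \<rho> f1 x \<in> lower c"
  unfolding lower_def
proof (rule rho_span[OF spo_basis(4)])
  fix x assume "x \<in> {(\<rho> f1 ^^ j) (Y a b c') | j a b c'. c' < c}"
  then obtain j a b c' where "x = (\<rho> f1 ^^ j) (Y a b c')" "c' < c" by auto
  then show "\<rho> f1 x \<in> span {(\<rho> f1 ^^ j) (Y a b c') | j a b c'. c' < c}"
    using lower_base[of c' c "Suc j" a b] by (simp add: lower_def)
qed

lemma lower_e1: "x \<in> lower c \<Longrightarrow> \<rho> e1 x \<in> lower c"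
  unfolding lower_def
proof (rule rho_span[OF spo_basis(3)])
  fix x assume "x \<in> {(\<rho> f1 ^^ j) (Y a b c') | j a b c'. c' < c}"
  then obtain j a b c' where "x = (\<rho> f1 ^^ j) (Y a b c')" "c' < c" by auto
  then have "\<rho> e1 x \<in> lower c"
    using e1_f1_Y[of j a b c'] subspace_add[OF subspace_lower] subspace_scale[OF subspace_lower]
      lower_base by auto
  then show "\<rho> e1 x \<in> span {(\<rho> f1 ^^ j) (Y a b c') | j a b c'. c' < c}"
    by (simp add: lower_def)
qed

lemma Y_in_lower:
  assumes "c > J b" shows "(\<rho> f1 ^^ j) (Y a b c) \<in> lower c"
proof -
  have "span {Y a' b c' | a' c'. a' \<le> 2 * m2 \<and> c' \<le> c \<and> c' \<le> J b} \<subseteq> lower c"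
    using assms lower_base[of _ c 0] by (intro span_minimal subspace_lower) force
  then have "Y a b c \<in> lower c" using Y_reduce by blast
  then show ?thesis by (induction j) (auto intro: lower_f1)
qed

text \<open>
  Modulo \<open>lower c\<close>, the vectors \<open>Y a b c\<close> with fixed \<open>a\<close> and \<open>c\<close> form an \<open>e\<^sub>1\<close>-string with
  top \<open>b = max (c/2) (c - m1)\<close> and bottom \<open>b = m1 + a\<close>. Its weights run from \<open>n\<close> down to \<open>p\<close>
  with \<open>(n + p)/2 = min m1 (c/2)\<close>, so \<open>f\<^sub>1\<close> to the next power sends the bottom to the weight
  \<open>-n-2\<close>, where it must vanish.
\<close>

lemma f1_pow_bottom_in_lower:
  assumes "c \<le> 2 * m1 + a"
  shows "(\<rho> f1 ^^ Suc (min m1 (c div 2))) (Y a (m1 + a) c) \<in> lower c"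
proof -
  interpret sl2_triple scale "\<rho> e1" "\<rho> f1" "\<lambda>u. \<rho> H1 u - \<rho> H2 u" by (rule sl2_e1_f1)
  define r where "r = min m1 (c div 2)"
  let ?y = "Y a (m1 + a) c"
  \<comment> \<open>\<open>?y\<close> has weight c - a - m1, hence \<open>f1^(r + 1) ?y\<close> has
    weight \<open>-N\<close>, as \<open>raise_injective\<close> requires.\<close>
  define N where "N = 2 * Suc r + a + m1 - c"
  have c: "c \<le> Suc r + a + m1" using assms by (auto simp: r_def min_def)
  have wt_y: "\<rho> H1 ?y - \<rho> H2 ?y = (of_nat c - of_nat a - of_nat m1) \<cdot> ?y"
    using wt_Y[of "m1 + a" a c] by (simp add: wt_def flip: scale_left_diff_distrib)
  \<comment> \<open>From this \<open>i\<close> on, \<open>b = m1 + a - i\<close> is at most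
    \<open>c - r - 1\<close>, and for either value of the minimum \<open>r\<close> this gives
    \<open>J b < c\<close>.\<close>
  have top: "(\<rho> e1 ^^ i) ?y \<in> lower c" if "i \<ge> Suc r + a + m1 - c" for i
  proof (cases "i \<le> m1 + a")
    case True
    then obtain k where "(\<rho> e1 ^^ i) ?y = k \<cdot> Y a (m1 + a - i) c" using e1_pow_top by blast
    moreover have "J (m1 + a - i) < c"
      using that True c by (auto simp: J_def r_def min_def split: if_splits)
    then have "Y a (m1 + a - i) c \<in> lower c" using Y_in_lower[of "m1 + a - i" c 0] by simp
    ultimately show ?thesis using subspace_scale[OF subspace_lower] by simp
  qed (simp add: e1_pow_top_zero subspace_0[OF subspace_lower])
  have "(\<rho> e1 ^^ N) ((\<rho> f1 ^^ Suc r) ?y) \<in> lower c"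
    by (rule e_pow_f_pow_in[where N = "Suc r + a + m1 - c", OF wt_y subspace_lower lower_f1 top])
      (use c in \<open>auto simp: N_def\<close>)
  moreover have "\<rho> H1 ((\<rho> f1 ^^ Suc r) ?y) - \<rho> H2 ((\<rho> f1 ^^ Suc r) ?y) =
    (- of_nat N) \<cdot> (\<rho> f1 ^^ Suc r) ?y"
  proof -
    have "of_nat c - of_nat a - of_nat m1 - 2 * of_nat (Suc r) = (- of_nat N :: complex)"
      using c by (simp add: N_def of_nat_diff)
    then show ?thesis using h_f_pow[OF wt_y, of "Suc r"] by simp
  qed
  moreover obtain k where "(\<rho> f1 ^^ k) ((\<rho> f1 ^^ Suc r) ?y) = 0" using nilpotent_f1 by blast
  then have "(\<rho> f1 ^^ k) ((\<rho> f1 ^^ Suc r) ?y) \<in> lower c"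
    by (simp only: subspace_0[OF subspace_lower])
  ultimately show ?thesis
    using raise_injective[OF subspace_lower lower_e1 lower_f1] unfolding r_def by blast
qed

text \<open>By induction on \<open>c\<close> everything in \<open>lower c\<close> is already
  covered, so one may work modulo \<open>lower c\<close>. In the essential case the vectors
  \<open>Y a b c\<close> lie on the \<open>e1\<close>-string above \<open>Y a (m1 + a) c\<close>,
  and \<open>truncated_f_powers\<close> limits the last \<open>f1\<close>-string along it to the
  length found for its end.\<close>

lemma f1_Y_in_verma_span: "(\<rho> f1 ^^ j) (Y a b c) \<in> verma_span"
proof (induction c arbitrary: a b j rule: less_induct)
  case (less c)
  have lower: "lower c \<subseteq> verma_span"
    unfolding lower_def using less.IH by (intro span_minimal subspace_verma_span) auto
  consider "a > 2 * m2 \<or> b > m1 + a" | "c > J b" | "c > J (m1 + a)" "b \<le> m1 + a"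
    | "a \<le> 2 * m2" "b \<le> m1 + a" "c \<le> J b" "c \<le> J (m1 + a)"
    by linarith
  then show ?case
  proof cases
    case 1
    then have "Y a b c = 0" using Y_vanishes by blast
    then show ?thesis by (simp add: rho_pow_zero spo_basis subspace_0[OF subspace_verma_span])
  next
    case 2
    then show ?thesis using Y_in_lower lower by blast
  next
    case 3
    \<comment> \<open>\<open>J\<close> is monotone, so a third string too long for
      \<open>b = m1 + a\<close> is too long for every smaller \<open>b\<close>.\<close>
    then have "c > J b" by (auto simp: J_def)
    then show ?thesis using Y_in_lower lower by blast
  next
    case 4
    interpret sl2_triple scale "\<rho> e1" "\<rho> f1" "\<lambda>u. \<rho> H1 u - \<rho> H2 u" by (rule sl2_e1_f1)
    let ?y = "Y a (m1 + a) c"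
    let ?r = "min m1 (c div 2)"
    have "c \<le> 2 * m1 + a" using 4 by (simp add: J_def)
    note bottom = f1_pow_bottom_in_lower[OF this]
    have wt_y: "\<rho> H1 ?y - \<rho> H2 ?y = (of_nat c - of_nat a - of_nat m1) \<cdot> ?y"
      using wt_Y[of "m1 + a" a c] by (simp add: wt_def flip: scale_left_diff_distrib)
    have "(\<rho> f1 ^^ j) ((\<rho> e1 ^^ (m1 + a - b)) ?y) \<in>
        span ({(\<rho> f1 ^^ j') ((\<rho> e1 ^^ i') ?y) | j' i'. j' \<le> ?r} \<union> lower c)"
      using wt_y subspace_lower lower_e1 lower_f1 bottom by (rule truncated_f_powers)
    also have "\<dots> \<subseteq> verma_span"
    proof (intro span_minimal subspace_verma_span Un_least lower subsetI)
      fix x assume "x \<in> {(\<rho> f1 ^^ j') ((\<rho> e1 ^^ i') ?y) | j' i'. j' \<le> ?r}"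
      then obtain j' i where x: "x = (\<rho> f1 ^^ j') ((\<rho> e1 ^^ i) ?y)" and j': "j' \<le> ?r" by auto
      show "x \<in> verma_span"
      proof (cases "i \<le> m1 + a")
        case True
        then obtain k where "(\<rho> e1 ^^ i) ?y = k \<cdot> Y a (m1 + a - i) c" using e1_pow_top by blast
        then have "x = k \<cdot> (\<rho> f1 ^^ j') (Y a (m1 + a - i) c)"
          by (simp add: x rho_pow_scale spo_basis)
        moreover have "(\<rho> f1 ^^ j') (Y a (m1 + a - i) c) \<in> verma_span"
        proof (cases "c > J (m1 + a - i)")
          case True
          then show ?thesis using Y_in_lower lower by blast
        next
          case False
          show ?thesis
            unfolding verma_span_def
            by (intro span_base CollectI, rule exI[of _ a], rule exI[of _ "m1 + a - i"],
                rule exI[of _ c], rule exI[of _ j']) (use 4 j' False in auto)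
        qed
        ultimately show ?thesis using subspace_scale[OF subspace_verma_span] by simp
      qed (simp add: x e1_pow_top_zero rho_pow_zero spo_basis subspace_0[OF subspace_verma_span])
    qed
    finally have "(\<rho> f1 ^^ j) ((\<rho> e1 ^^ (m1 + a - b)) ?y) \<in> verma_span" .
    moreover obtain k where "k \<noteq> 0" "(\<rho> e1 ^^ (m1 + a - b)) ?y = k \<cdot> Y a b c"
      using e1_pow_top[of "m1 + a - b" a c] 4 by auto
    ultimately show ?thesis
      using subspace_scale_cancel[OF subspace_verma_span, of k]
      by (simp add: rho_pow_scale spo_basis)
  qed
qed

lemma verma_span_eq: "verma_span = span {(\<rho> f1 ^^ j) (Y a b c) | j a b c. True}"
proof (rule antisym)
  show "verma_span \<subseteq> span {(\<rho> f1 ^^ j) (Y a b c) | j a b c. True}"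
    unfolding verma_span_def by (rule span_mono) auto
  show "span {(\<rho> f1 ^^ j) (Y a b c) | j a b c. True} \<subseteq> verma_span"
    using f1_Y_in_verma_span by (intro span_minimal subspace_verma_span) auto
qed

text \<open>Stability under the raising operators is accessible because they pass through all four
  strings. An \<open>f2\<close> to the left of the last \<open>f1\<close>-string has no such
  control, so the whole module must be reached from below.\<close>

lemma verma_span_e:
  assumes "x \<in> verma_span" shows "\<rho> e1 x \<in> verma_span" "\<rho> e2 x \<in> verma_span"
proof -
  have e1: "\<rho> e1 ((\<rho> f1 ^^ j) (Y a b c)) \<in> verma_span" for j a b c
    using e1_f1_Y[of j a b c] subspace_add[OF subspace_verma_span]
      subspace_scale[OF subspace_verma_span] f1_Y_in_verma_span by auto
  have e2: "\<rho> e2 ((\<rho> f1 ^^ j) (Y a b c)) \<in> verma_span" for j a b c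
  proof -
    interpret ladder scale "\<rho> e2" "\<rho> f2" "\<rho> H2" "- 1" 1 by (rule odd_ladder)
    have "\<rho> H2 (Y a b 0) = (of_nat m2 - of_nat a + of_nat b - of_nat 0) \<cdot> Y a b 0"
      using wt_Y[of b a 0] by (simp add: wt_def)
    from e_f_pow[OF this, of c] obtain t where "\<rho> e2 (Y a b c) =
      ((- 1) ^ c) \<cdot> (\<rho> f2 ^^ c) (\<rho> e2 (Y a b 0)) + t \<cdot> Y a b (c - 1)" by (auto simp: Y_def)
    moreover have "\<rho> e2 (Y a b 0) = kappa a \<cdot> Y (a - 1) b 0"
      by (simp add: Y_def e2_f1_pow e2_f2_pow_v rho_pow_scale spo_basis)
    ultimately have "\<rho> e2 (Y a b c) = ((- 1) ^ c * kappa a) \<cdot> Y (a - 1) b c + t \<cdot> Y a b (c - 1)"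
      by (simp add: rho_pow_scale spo_basis Y_def)
    then have "\<rho> e2 ((\<rho> f1 ^^ j) (Y a b c)) = ((- 1) ^ c * kappa a) \<cdot> (\<rho> f1 ^^ j) (Y (a - 1) b c)
      + t \<cdot> (\<rho> f1 ^^ j) (Y a b (c - 1))"
      by (simp only: e2_f1_pow rho_pow_add[OF spo_basis(4)] rho_pow_scale[OF spo_basis(4)])
    then show ?thesis
      using subspace_add[OF subspace_verma_span] subspace_scale[OF subspace_verma_span]
        f1_Y_in_verma_span by simp
  qed
  show "\<rho> e1 x \<in> verma_span"
    using assms e1 rho_span[OF spo_basis(3), of "{(\<rho> f1 ^^ j) (Y a b c) | j a b c. True}"
        "{(\<rho> f1 ^^ j) (Y a b c) | j a b c. True}"]
    unfolding verma_span_eq by blast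
  show "\<rho> e2 x \<in> verma_span"
    using assms e2 rho_span[OF spo_basis(11), of "{(\<rho> f1 ^^ j) (Y a b c) | j a b c. True}"
        "{(\<rho> f1 ^^ j) (Y a b c) | j a b c. True}"]
    unfolding verma_span_eq by blast
qed

section \<open>The lowest weight vector\<close>

inductive e_word :: "'v \<Rightarrow> 'v \<Rightarrow> bool" for x where
  e_word_base: "e_word x x"
| e_word_e1: "e_word x y \<Longrightarrow> e_word x (\<rho> e1 y)"
| e_word_e2: "e_word x y \<Longrightarrow> e_word x (\<rho> e2 y)"

definition lowest :: 'v where
  "lowest = (\<rho> f1 ^^ m1) (Y (2 * m2) (m1 + 2 * m2) (2 * (m1 + m2)))"

text \<open>
  \<open>lowest\<close> is obtained from \<open>v\<close> by passing through the extremal weights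
  \<open>(l\<^sub>1, -l\<^sub>2)\<close>, \<open>(-l\<^sub>2, l\<^sub>1)\<close>, \<open>(-l\<^sub>2, -l\<^sub>1)\<close>, \<open>(-l\<^sub>1, -l\<^sub>2)\<close> of the octagon.
\<close>

lemma lowest_nonzero: "lowest \<noteq> 0"
proof -
  interpret A: sl2_triple scale "\<rho> e1" "\<rho> f1" "\<lambda>u. \<rho> H1 u - \<rho> H2 u" by (rule sl2_e1_f1)
  define x1 where "x1 = (\<rho> f2 ^^ (2 * m2)) v"
  define x2 where "x2 = (\<rho> f1 ^^ (m1 + 2 * m2)) x1"
  define x3 where "x3 = (\<rho> f2 ^^ (2 * (m1 + m2))) x2"
  have wt1: "wt (of_int (int (m1 + m2))) (of_int (- int m2)) x1"
    using wt_pow(4)[OF hw(1), of "2 * m2"] by (simp add: x1_def)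
  have wt2: "wt (of_int (- int m2)) (of_int (int (m1 + m2))) x2"
  proof -
    have "(of_int (int (m1 + m2)) - of_nat (m1 + 2 * m2) :: complex) = of_int (- int m2)"
      "(of_int (- int m2) + of_nat (m1 + 2 * m2) :: complex) = of_int (int (m1 + m2))"
      by simp_all
    then show ?thesis unfolding x2_def using wt_pow(3)[OF wt1, of "m1 + 2 * m2"] by (simp only:)
  qed
  have wt3: "wt (of_int (- int m2)) (of_int (- int (m1 + m2))) x3"
    using wt_pow(4)[OF wt2, of "2 * (m1 + m2)"] by (simp add: x3_def)
  have "x1 \<noteq> 0"
    unfolding x1_def using hw v_nonzero by (intro f2_pow_nonzero) (simp_all add: wt_def)
  moreover have "\<rho> e1 x1 = 0" by (simp add: x1_def e1_f2_pow hw rho_pow_zero spo_basis)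
  moreover have "\<rho> H1 x1 - \<rho> H2 x1 = of_nat (m1 + 2 * m2) \<cdot> x1"
    by (rule wt_h[OF wt1]) simp
  ultimately have "x2 \<noteq> 0"
    unfolding x2_def by (intro A.f_pow_nonzero[of x1 "m1 + 2 * m2"]) simp_all
  moreover have "\<rho> e2 x2 = 0"
    by (rule outside_octagon[where a = "- int m2" and b = "int (m1 + m2) + 1", OF wt_simple(2)[OF wt2]])
      auto
  ultimately have "x3 \<noteq> 0"
    unfolding x3_def using wt2 by (intro f2_pow_nonzero) (simp_all add: wt_def)
  moreover have "\<rho> e1 x3 = 0"
    by (rule outside_octagon[where a = "- int m2 + 1" and b = "- int (m1 + m2) - 1",
          OF wt_simple(1)[OF wt3]]) auto
  moreover have "\<rho> H1 x3 - \<rho> H2 x3 = of_nat m1 \<cdot> x3"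
    by (rule wt_h[OF wt3]) simp
  ultimately have "(\<rho> f1 ^^ m1) x3 \<noteq> 0" by (intro A.f_pow_nonzero[of x3 m1]) simp_all
  then show ?thesis by (simp add: lowest_def Y_def x1_def x2_def x3_def)
qed

lemma wt_lowest: "wt (of_int (- int (m1 + m2))) (of_int (- int m2)) lowest"
  unfolding lowest_def
  by (rule wt_cong[OF wt_pow(3)[OF wt_Y]]) simp_all

lemma lowest_killed: "\<rho> f1 lowest = 0" "\<rho> f2 lowest = 0"
proof -
  show "\<rho> f1 lowest = 0"
    by (rule outside_octagon[where a = "- int (m1 + m2) - 1" and b = "- int m2 + 1",
          OF wt_simple(3)[OF wt_lowest]]) auto
  show "\<rho> f2 lowest = 0"
    by (rule outside_octagon[where a = "- int (m1 + m2)" and b = "- int m2 - 1",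
          OF wt_simple(4)[OF wt_lowest]]) auto
qed

text \<open>Since \<open>f1\<close> and \<open>f2\<close> kill \<open>lowest\<close>, the vectors
  obtained from it by \<open>e1\<close> and \<open>e2\<close> span a submodule \<open>M\<close>. It
  is nonzero, so it contains \<open>v\<close> and is the whole module; and it lies in
  \<open>verma_span\<close>, which contains \<open>lowest\<close> and is stable under
  \<open>e1\<close> and \<open>e2\<close>.\<close>

theorem verma_span_UNIV: "verma_span = UNIV"
proof -
  define M where "M = span {x. e_word lowest x}"
  have M: "subspace M" by (simp add: M_def)
  have base: "e_word lowest x \<Longrightarrow> x \<in> M" for x by (auto simp: M_def intro: span_base)
  have stable: "\<rho> X x \<in> M" if "X \<in> spo" "\<And>x. e_word lowest x \<Longrightarrow> \<rho> X x \<in> M" "x \<in> M" for X x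
    using rho_span[OF that(1), of "{x. e_word lowest x}" "{x. e_word lowest x}"] that(2,3)
    by (simp add: M_def)
  have *: "\<exists>a b. wt a b x" if "e_word lowest x" for x
    using that
  proof (induction rule: e_word.induct)
    case e_word_base
    then show ?case using wt_lowest by blast
  qed (use wt_simple(1,2) in blast)+
  have H: "\<rho> H1 x \<in> M" "\<rho> H2 x \<in> M" if "x \<in> M" for x
    by (rule stable[OF spo_basis(1) _ that], use * base subspace_scale[OF M] in \<open>force simp: wt_def\<close>)
      (rule stable[OF spo_basis(2) _ that], use * base subspace_scale[OF M] in \<open>force simp: wt_def\<close>)
  have e: "\<rho> e1 x \<in> M" "\<rho> e2 x \<in> M" if "x \<in> M" for x
    using stable[OF spo_basis(3) _ that] stable[OF spo_basis(11) _ that] base e_word.intros by blast+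
  have "\<rho> f1 x \<in> M \<and> \<rho> f2 x \<in> M" if "e_word lowest x" for x
    using that
  proof (induction rule: e_word.induct)
    case e_word_base
    then show ?case by (simp add: lowest_killed subspace_0[OF M])
  next
    case (e_word_e1 x)
    have "\<rho> f1 (\<rho> e1 x) = \<rho> e1 (\<rho> f1 x) - (\<rho> H1 x - \<rho> H2 x)" "\<rho> f2 (\<rho> e1 x) = \<rho> e1 (\<rho> f2 x)"
      by (simp_all add: simple_relations)
    then show ?case using e_word_e1 e H base subspace_diff[OF M] by simp
  next
    case (e_word_e2 x)
    have "\<rho> f1 (\<rho> e2 x) = \<rho> e2 (\<rho> f1 x)" "\<rho> f2 (\<rho> e2 x) = \<rho> H2 x - \<rho> e2 (\<rho> f2 x)"
      by (simp_all add: simple_relations)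
    then show ?case using e_word_e2 e H base subspace_diff[OF M] by simp
  qed
  then have f: "\<rho> f1 x \<in> M" "\<rho> f2 x \<in> M" if "x \<in> M" for x
    using stable[OF spo_basis(4) _ that] stable[OF spo_basis(12) _ that] by blast+
  have "v \<in> M"
    by (rule generator_in_submodule[OF hw, of M lowest])
      (use nilpotent_f1 nilpotent_f2 M e H base e_word_base lowest_nonzero generated_v in auto)
  have "x \<in> M" if "f_word v n1 n2 x" for x n1 n2
    using that \<open>v \<in> M\<close> by (induction rule: f_word.induct) (auto intro: f)
  then have "generated v \<subseteq> M" unfolding generated_def by (intro span_minimal M) auto
  moreover have "x \<in> verma_span" if "e_word lowest x" for x
    using that
  proof (induction rule: e_word.induct)
    case e_word_base
    then show ?case unfolding lowest_def by (rule f1_Y_in_verma_span)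
  qed (auto intro: verma_span_e)
  then have "M \<subseteq> verma_span" unfolding M_def by (intro span_minimal subspace_verma_span) auto
  ultimately show ?thesis using generated_v by auto
qed

end

section \<open>Tensor powers of the natural module\<close>

text \<open>
  A vector of the \<open>n\<close>-th tensor power of the natural module is given by its coordinates, which
  are indexed by the words of length \<open>n\<close> over the index type.
\<close>

type_synonym tensor = "5 list \<Rightarrow> complex"

definition tscale :: "complex \<Rightarrow> tensor \<Rightarrow> tensor" where
  "tscale c g = (\<lambda>w. c * g w)"

lemma tscale_apply [simp]: "tscale c g w = c * g w"
  by (simp add: tscale_def)

interpretation tensor: vector_space tscale
  by unfold_locales (auto simp: fun_eq_iff algebra_simps)

text \<open>The derivation rule with Koszul sign: the odd part of \<open>X\<close> changes sign when
  it passes an odd basis vector, which is letter 5. Splitting \<open>X\<close> into its parts makes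
  the action linear in arbitrary matrices.\<close>

primrec act_word :: "5 list \<Rightarrow> mat5 \<Rightarrow> tensor \<Rightarrow> complex" where
  "act_word [] X g = 0"
| "act_word (l # r) X g = (\<Sum>j\<in>UNIV. X $ l $ j * g (j # r)) +
    act_word r (if l = 5 then even_part X - odd_part X else X) (\<lambda>s. g (l # s))"

definition act :: "mat5 \<Rightarrow> tensor \<Rightarrow> tensor" where
  "act X g w = act_word w X g"

lemma act_Nil: "act X g [] = 0"
  by (simp add: act_def)

lemma act_word_linear:
  "act_word w X (\<lambda>s. g s + k s) = act_word w X g + act_word w X k"
  "act_word w X (\<lambda>s. c * g s) = c * act_word w X g"
  by (induction w arbitrary: X g k)
    (simp_all add: sum.distrib distrib_left sum_distrib_left mult.left_commute add_ac)

lemma act_word_matrix: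
  "act_word w (X + Y) g = act_word w X g + act_word w Y g"
  "act_word w (mat_scale c X) g = c * act_word w X g"
proof (induction w arbitrary: X Y g)
  case (Cons l r)
  { case 1
    have "even_part (X + Y) - odd_part (X + Y) = (even_part X - odd_part X) + (even_part Y - odd_part Y)"
      by (simp add: vec_eq_iff even_part_def odd_part_def)
    then show ?case using Cons by (simp add: sum.distrib distrib_right add_ac) }
  { case 2
    have "even_part (mat_scale c X) - odd_part (mat_scale c X) = mat_scale c (even_part X - odd_part X)"
      by (simp add: vec_eq_iff even_part_def odd_part_def mat_scale_def right_diff_distrib)
    moreover have "(\<Sum>j\<in>UNIV. mat_scale c X $ l $ j * g (j # r)) = c * (\<Sum>j\<in>UNIV. X $ l $ j * g (j # r))"
      by (simp add: mat_scale_def sum_distrib_left mult.assoc)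
    ultimately show ?case using Cons by (simp add: distrib_left) }
qed simp_all

definition homogeneous :: "bool \<Rightarrow> mat5 \<Rightarrow> bool" where
  "homogeneous p X \<longleftrightarrow> (\<forall>i j. X $ i $ j \<noteq> 0 \<longrightarrow> ((i = 5) \<noteq> (j = 5)) = p)"

lemma homogeneous_spo_part: "X \<in> spo_part p \<Longrightarrow> homogeneous p X"
proof -
  have "homogeneous True (spo_matrix 0 0 0 0 0 0 0 0 0 0 p1 p2 q1 q2)" for p1 p2 q1 q2
    by (simp add: homogeneous_def forall_5 spo_matrix_def vector_5)
  moreover have "homogeneous False (spo_matrix a11 a12 a21 a22 b11 b12 b22 c11 c12 c22 0 0 0 0)"
    for a11 a12 a21 a22 b11 b12 b22 c11 c12 c22
    by (simp add: homogeneous_def forall_5 spo_matrix_def vector_5)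
  ultimately show "X \<in> spo_part p \<Longrightarrow> homogeneous p X"
    by (auto simp: spo_part_def split: if_splits)
qed

lemma homogeneous_parts:
  assumes "homogeneous p X"
  shows "even_part X = (if p then 0 else X)" "odd_part X = (if p then X else 0)"
  using assms by (auto simp: homogeneous_def even_part_def odd_part_def vec_eq_iff)

definition parity_sign :: "bool \<Rightarrow> 5 \<Rightarrow> complex" where
  "parity_sign p l = (if p \<and> l = 5 then - 1 else 1)"

lemma act_Cons:
  assumes "homogeneous p X"
  shows "act X g (l # r) = (\<Sum>j\<in>UNIV. X $ l $ j * g (j # r)) + parity_sign p l * act X (\<lambda>s. g (l # s)) r"
proof -
  have "mat_scale (- 1) X = - X" by (simp add: mat_scale_def vec_eq_iff)
  then have "act_word r (- X) k = - act_word r X k" for k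
    using act_word_matrix(2)[of r "- 1" X k] by simp
  then show ?thesis
    by (simp add: act_def homogeneous_parts[OF assms] parity_sign_def)
qed

lemma act_linear: "act X (g + k) = act X g + act X k" "act X (tscale c g) = tscale c (act X g)"
  using act_word_linear(1)[where X = X and g = g and k = k]
    act_word_linear(2)[where X = X and g = g and c = c]
  by (simp_all add: fun_eq_iff act_def plus_fun_def tscale_def)

lemma act_sum: "act X (\<lambda>s. \<Sum>j\<in>A. k j * g j s) r = (\<Sum>j\<in>A. k j * act X (g j) r)" if "finite A"
  using that
proof (induction A rule: finite_induct)
  case empty
  then show ?case using act_word_linear(2)[of r X 0 "\<lambda>_. 0"] by (simp add: act_def)
next
  case (insert x A)
  then show ?case
    using act_word_linear(1)[of r X "\<lambda>s. k x * g x s" "\<lambda>s. \<Sum>j\<in>A. k j * g j s"]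
    by (simp add: act_def act_word_linear(2))
qed

text \<open>Induction on the word. Both operators on the first factor give the matrix products, both
  on the tail give the induction hypothesis, and the mixed terms cancel by the sign rule
  \<open>cross\<close>.\<close>

lemma act_homogeneous_bracket:
  assumes X: "homogeneous p X" and Y: "homogeneous q Y"
    and Z: "Z = X ** Y - (if p \<and> q then - (Y ** X) else Y ** X)"
  shows "act Z g w = act X (act Y g) w - (if p \<and> q then - 1 else 1) * act Y (act X g) w"
proof (induction w arbitrary: g)
  case (Cons l r)
  define s :: complex where "s = (if p \<and> q then - 1 else 1)"
  have "homogeneous (p \<noteq> q) Z"
    unfolding homogeneous_def
  proof (intro allI impI)
    fix i k assume "Z $ i $ k \<noteq> 0"
    then have "(X ** Y) $ i $ k \<noteq> 0 \<or> (Y ** X) $ i $ k \<noteq> 0" by (auto simp: Z split: if_splits)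
    moreover have "\<exists>j. A $ i $ j \<noteq> 0 \<and> B $ j $ k \<noteq> 0" if "(A ** B) $ i $ k \<noteq> 0" for A B :: mat5
    proof (rule ccontr)
      assume "\<nexists>j. A $ i $ j \<noteq> 0 \<and> B $ j $ k \<noteq> 0"
      then have "(A ** B) $ i $ k = 0"
        by (auto simp: matrix_matrix_mult_def intro!: sum.neutral)
      then show False using that by simp
    qed
    ultimately obtain j where "X $ i $ j \<noteq> 0 \<and> Y $ j $ k \<noteq> 0 \<or> Y $ i $ j \<noteq> 0 \<and> X $ j $ k \<noteq> 0"
      by metis
    then show "((i = 5) \<noteq> (k = 5)) = (p \<noteq> q)"
      using X Y unfolding homogeneous_def by metis
  qed
  note act_Z = act_Cons[OF this]
  have sgn: "parity_sign (p \<noteq> q) l = parity_sign p l * parity_sign q l"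
    by (auto simp: parity_sign_def)
  \<comment> \<open>A nonzero entry in row \<open>l\<close> and column \<open>j\<close> of
    \<open>X\<close> changes the parity exactly if \<open>X\<close> is odd, so the two signs differ
    by the factor \<open>s\<close>, the sign of exchanging \<open>X\<close> and
    \<open>Y\<close>.\<close>
  have cross: "X $ l $ j * parity_sign q j = s * parity_sign q l * X $ l $ j"
    "Y $ l $ j * parity_sign p j = s * parity_sign p l * Y $ l $ j" for j
    using X Y by (auto simp: homogeneous_def parity_sign_def s_def)
  have expand: "act A (act B g) (l # r) = (\<Sum>k\<in>UNIV. (A ** B) $ l $ k * g (k # r)) +
      (\<Sum>j\<in>UNIV. A $ l $ j * parity_sign b j * act B (\<lambda>s. g (j # s)) r) +
      (\<Sum>j\<in>UNIV. parity_sign a l * B $ l $ j * act A (\<lambda>s. g (j # s)) r) +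
      parity_sign a l * parity_sign b l * act A (act B (\<lambda>s. g (l # s))) r"
    if A: "homogeneous a A" and B: "homogeneous b B" for A B a b
  proof -
    have 1: "(\<Sum>j\<in>UNIV. A $ l $ j * act B g (j # r)) =
      (\<Sum>k\<in>UNIV. (A ** B) $ l $ k * g (k # r)) +
      (\<Sum>j\<in>UNIV. A $ l $ j * parity_sign b j * act B (\<lambda>s. g (j # s)) r)"
    proof -
      have "(\<Sum>j\<in>UNIV. A $ l $ j * (\<Sum>k\<in>UNIV. B $ j $ k * g (k # r))) =
        (\<Sum>k\<in>UNIV. (A ** B) $ l $ k * g (k # r))"
        unfolding matrix_matrix_mult_def
        by (simp add: sum_distrib_left sum_distrib_right mult.assoc) (rule sum.swap)
      then show ?thesis by (simp add: act_Cons[OF B] distrib_left sum.distrib mult.assoc)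
    qed
    have 2: "act A (\<lambda>s. act B g (l # s)) r =
      (\<Sum>j\<in>UNIV. B $ l $ j * act A (\<lambda>s. g (j # s)) r) +
      parity_sign b l * act A (act B (\<lambda>s. g (l # s))) r"
      using act_word_linear(1)[of r A "\<lambda>s. \<Sum>j\<in>UNIV. B $ l $ j * g (j # s)"
          "\<lambda>s. parity_sign b l * act B (\<lambda>s. g (l # s)) s"]
        act_sum[of UNIV A "\<lambda>j. B $ l $ j" "\<lambda>j s. g (j # s)" r]
      by (simp add: act_Cons[OF B] act_word_linear(2) flip: act_def)
    show ?thesis
      by (subst act_Cons[OF A]) (simp add: 1 2 distrib_left sum_distrib_left mult.assoc)
  qed
  have 1: "act Z g (l # r) = (\<Sum>j\<in>UNIV. Z $ l $ j * g (j # r)) +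
    parity_sign p l * parity_sign q l *
      (act X (act Y (\<lambda>s. g (l # s))) r - s * act Y (act X (\<lambda>s. g (l # s))) r)"
    unfolding act_Z sgn Cons.IH s_def by simp
  have 2: "(\<Sum>j\<in>UNIV. Z $ l $ j * g (j # r)) =
    (\<Sum>j\<in>UNIV. (X ** Y) $ l $ j * g (j # r)) - s * (\<Sum>j\<in>UNIV. (Y ** X) $ l $ j * g (j # r))"
    by (simp add: Z s_def left_diff_distrib sum_subtractf distrib_right sum.distrib sum_negf)
  have "s * s = 1" by (simp add: s_def)
  then have 3: "(\<Sum>j\<in>UNIV. parity_sign p l * Y $ l $ j * act X (\<lambda>s. g (j # s)) r) =
     s * (\<Sum>j\<in>UNIV. Y $ l $ j * parity_sign p j * act X (\<lambda>s. g (j # s)) r)"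
    by (simp add: cross sum_distrib_left flip: mult.assoc)
  have 4: "(\<Sum>j\<in>UNIV. X $ l $ j * parity_sign q j * act Y (\<lambda>s. g (j # s)) r) =
     s * (\<Sum>j\<in>UNIV. parity_sign q l * X $ l $ j * act Y (\<lambda>s. g (j # s)) r)"
    by (simp add: cross sum_distrib_left mult.assoc)
  show ?case
    unfolding expand[OF X Y] expand[OF Y X] s_def[symmetric] 1 2 3 4
    by (simp add: algebra_simps)
qed (simp add: act_Nil)

lemma act_bracket:
  assumes "X \<in> spo_part p" "Y \<in> spo_part q"
  shows "act (supercommutator X Y) g =
    (if p \<and> q then act X (act Y g) + act Y (act X g) else act X (act Y g) - act Y (act X g))"
proof
  fix w
  note hom = assms[THEN homogeneous_spo_part]
  have "supercommutator X Y = X ** Y - (if p \<and> q then - (Y ** X) else Y ** X)"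
    by (auto simp: supercommutator_def homogeneous_parts[OF hom(1)] homogeneous_parts[OF hom(2)]
        matrix_matrix_mult_def vec_eq_iff)
  from act_homogeneous_bracket[OF hom this, of g w] show "act (supercommutator X Y) g w =
    (if p \<and> q then act X (act Y g) + act Y (act X g) else act X (act Y g) - act Y (act X g)) w"
    by simp
qed

interpretation tensor: spo_module tscale act
proof
  show "act (X + Y) u = act X u + act Y u" "act (mat_scale c X) u = tscale c (act X u)" for X Y u c
    by (simp_all add: fun_eq_iff act_def act_word_matrix)
qed (simp_all add: act_linear act_bracket)

definition pscale :: "(complex \<Rightarrow> 'v \<Rightarrow> 'v) \<Rightarrow> complex \<Rightarrow> 'v \<times> tensor \<Rightarrow> 'v \<times> tensor" where
  "pscale sc c x = (sc c (fst x), tscale c (snd x))"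

definition pact :: "(mat5 \<Rightarrow> 'v \<Rightarrow> 'v) \<Rightarrow> mat5 \<Rightarrow> 'v \<times> tensor \<Rightarrow> 'v \<times> tensor" where
  "pact \<rho> X x = (\<rho> X (fst x), act X (snd x))"

lemma (in spo_module) product_module: "spo_module (pscale scale) (pact \<rho>)"
proof -
  have vs: "vector_space (pscale scale)"
    by unfold_locales
      (simp_all add: pscale_def prod_eq_iff scale_right_distrib scale_left_distrib fun_eq_iff
        distrib_left distrib_right)
  interpret P: vector_space "pscale scale" by (rule vs)
  show ?thesis
  proof (intro spo_module.intro spo_module_axioms.intro vs)
    show "Vector_Spaces.linear (pscale scale) (pscale scale) (pact \<rho> X)" if "X \<in> spo" for X
      by unfold_locales (simp_all add: pact_def pscale_def prod_eq_iff rho_simps[OF that] act_linear)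
  qed (auto simp: pact_def pscale_def prod_eq_iff rho_add rho_scale rho_bracket act_bracket
      tensor.rho_add tensor.rho_scale)
qed

section \<open>Coordinates of Verma vectors in the tensor power\<close>

text \<open>The tensor v_j \<otimes> y for the basis vector v_j of the natural module.\<close>

definition ins :: "5 \<Rightarrow> tensor \<Rightarrow> tensor" where
  "ins j y w = (case w of [] \<Rightarrow> 0 | l # r \<Rightarrow> if l = j then y r else 0)"

lemma ins_simps [simp]: "ins j y [] = 0" "ins j y (l # r) = (if l = j then y r else 0)"
  by (simp_all add: ins_def)

lemma ins_linear:
  "ins j (x + y) = ins j x + ins j y" "ins j (x - y) = ins j x - ins j y" "ins j (- x) = - ins j x"
  "ins j (tscale c x) = tscale c (ins j x)"
  by (auto simp: fun_eq_iff ins_def split: list.split)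

text \<open>The derivation rule on v_j \<otimes> y, where X v_j is column \<open>j\<close> of
  \<open>X\<close>.\<close>

lemma act_ins:
  assumes "homogeneous p X"
  shows "act X (ins j y) = (\<Sum>l\<in>UNIV. tscale (X $ l $ j) (ins l y)) + tscale (parity_sign p j) (ins j (act X y))"
proof
  fix w
  have app: "(\<Sum>l\<in>UNIV. tscale (X $ l $ j) (ins l y)) w = (\<Sum>l\<in>UNIV. X $ l $ j * ins l y w)"
    unfolding sum_5 by simp
  show "act X (ins j y) w = ((\<Sum>l\<in>UNIV. tscale (X $ l $ j) (ins l y)) + tscale (parity_sign p j) (ins j (act X y))) w"
  proof (cases w)
    case (Cons i r)
    have "act X (\<lambda>s. ins j y (i # s)) r = (if i = j then act X y r else 0)"
      using act_linear(2)[of X 0 "\<lambda>_. 0"] by (auto simp: tscale_def)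
    moreover have "(\<Sum>k\<in>UNIV. X $ i $ k * ins j y (k # r)) = X $ i $ j * y r"
      by (simp add: if_distrib cong: if_cong)
    moreover have "(\<Sum>l\<in>UNIV. X $ l $ j * ins l y w) = X $ i $ j * y r"
      using Cons by (simp add: if_distrib cong: if_cong)
    ultimately show ?thesis
      unfolding plus_fun_apply app by (simp add: Cons act_Cons[OF assms])
  next
    case Nil
    then show ?thesis using app by (simp add: act_Nil)
  qed
qed

lemma f_entries:
  "f1 $ i $ j = (if i = 2 \<and> j = 1 then 1 else if i = 3 \<and> j = 4 then - 1 else 0)"
  "f2 $ i $ j = (if i = 5 \<and> j = 2 then 1 else if i = 4 \<and> j = 5 then - 1 else 0)"
  "e1 $ i $ j = (if i = 1 \<and> j = 2 then 1 else if i = 4 \<and> j = 3 then - 1 else 0)"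
  "e2 $ i $ j = (if i = 2 \<and> j = 5 then 1 else if i = 5 \<and> j = 4 then 1 else 0)"
  "H1 $ i $ j = (if i = 1 \<and> j = 1 then 1 else if i = 3 \<and> j = 3 then - 1 else 0)"
  "H2 $ i $ j = (if i = 2 \<and> j = 2 then 1 else if i = 4 \<and> j = 4 then - 1 else 0)"
  by (auto simp: f1_def f2_def e1_def e2_def H1_def H2_def mat_unit_def)

lemma tscale_simps: "tscale 0 y = 0" "tscale 1 y = y" "tscale (- 1) y = - y"
  by (auto simp: fun_eq_iff)

lemmas even_ins = act_ins[OF homogeneous_spo_part[OF even_basis(1)]]
  act_ins[OF homogeneous_spo_part[OF even_basis(2)]]
  act_ins[OF homogeneous_spo_part[OF even_basis(3)]]
  act_ins[OF homogeneous_spo_part[OF even_basis(4)]]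

lemmas odd_ins = act_ins[OF homogeneous_spo_part[OF odd_basis(1)]]
  act_ins[OF homogeneous_spo_part[OF odd_basis(2)]]

lemma act_f1_ins:
  "act f1 (ins 1 y) = ins 2 y + ins 1 (act f1 y)" "act f1 (ins 2 y) = ins 2 (act f1 y)"
  "act f1 (ins 3 y) = ins 3 (act f1 y)" "act f1 (ins 4 y) = - ins 3 y + ins 4 (act f1 y)"
  "act f1 (ins 5 y) = ins 5 (act f1 y)"
  by (simp_all add: even_ins sum_5 f_entries tscale_simps parity_sign_def)

lemma act_f2_ins:
  "act f2 (ins 1 y) = ins 1 (act f2 y)" "act f2 (ins 2 y) = ins 5 y + ins 2 (act f2 y)"
  "act f2 (ins 3 y) = ins 3 (act f2 y)" "act f2 (ins 4 y) = ins 4 (act f2 y)"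
  "act f2 (ins 5 y) = - ins 4 y - ins 5 (act f2 y)"
  by (simp_all add: odd_ins sum_5 f_entries tscale_simps parity_sign_def)

lemma act_e_ins:
  "act e1 (ins 1 y) = ins 1 (act e1 y)" "act e1 (ins 2 y) = ins 1 y + ins 2 (act e1 y)"
  "act e2 (ins 1 y) = ins 1 (act e2 y)" "act e2 (ins 2 y) = ins 2 (act e2 y)"
  "act H1 (ins 1 y) = ins 1 y + ins 1 (act H1 y)" "act H1 (ins 2 y) = ins 2 (act H1 y)"
  "act H2 (ins 1 y) = ins 1 (act H2 y)" "act H2 (ins 2 y) = ins 2 y + ins 2 (act H2 y)"
  by (simp_all add: odd_ins even_ins sum_5 f_entries tscale_simps parity_sign_def)

text \<open>
  The vectors \<open>wedge i j y\<close>, \<open>pair55 y\<close> and \<open>pair13 y\<close> are \<open>x \<otimes> y\<close> for weight vectors \<open>x\<close> of the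
  irreducible module generated by \<open>v\<^sub>1 \<otimes> v\<^sub>2 - v\<^sub>2 \<otimes> v\<^sub>1\<close> in the square of the natural module.
  Each of the words 12, 15, 14, 25, 55, 13, 54, 23, 53, 43 occurs as an initial segment of the
  support of only the vector named after it.
\<close>

definition wedge :: "5 \<Rightarrow> 5 \<Rightarrow> tensor \<Rightarrow> tensor" where
  "wedge i j y = ins i (ins j y) - ins j (ins i y)"

definition pair55 :: "tensor \<Rightarrow> tensor" where
  "pair55 y = tscale 2 (ins 5 (ins 5 y)) - wedge 2 4 y"

definition pair13 :: "tensor \<Rightarrow> tensor" where
  "pair13 y = wedge 2 4 y - wedge 1 3 y"

lemmas act_basis_simps = tensor.rho_basis_simps

lemma act_f1_pair:
  "act f1 (wedge 1 2 y) = wedge 1 2 (act f1 y)"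
  "act f1 (wedge 1 5 y) = wedge 2 5 y + wedge 1 5 (act f1 y)"
  "act f1 (wedge 1 4 y) = pair13 y + wedge 1 4 (act f1 y)"
  "act f1 (wedge 2 5 y) = wedge 2 5 (act f1 y)"
  "act f1 (pair55 y) = wedge 2 3 y + pair55 (act f1 y)"
  "act f1 (pair13 y) = - wedge 2 3 y - wedge 2 3 y + pair13 (act f1 y)"
  "act f1 (wedge 5 4 y) = - wedge 5 3 y + wedge 5 4 (act f1 y)"
  "act f1 (wedge 2 3 y) = wedge 2 3 (act f1 y)"
  "act f1 (wedge 5 3 y) = wedge 5 3 (act f1 y)"
  "act f1 (wedge 4 3 y) = wedge 4 3 (act f1 y)"
  by (simp_all add: wedge_def pair55_def pair13_def act_basis_simps act_f1_ins ins_linear)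

lemma act_f2_pair:
  "act f2 (wedge 1 2 y) = wedge 1 5 y + wedge 1 2 (act f2 y)"
  "act f2 (wedge 1 5 y) = - wedge 1 4 y - wedge 1 5 (act f2 y)"
  "act f2 (wedge 1 4 y) = wedge 1 4 (act f2 y)"
  "act f2 (wedge 2 5 y) = pair55 y - wedge 2 5 (act f2 y)"
  "act f2 (pair55 y) = wedge 5 4 y + pair55 (act f2 y)"
  "act f2 (pair13 y) = wedge 5 4 y + pair13 (act f2 y)"
  "act f2 (wedge 5 4 y) = - wedge 5 4 (act f2 y)"
  "act f2 (wedge 2 3 y) = wedge 5 3 y + wedge 2 3 (act f2 y)"
  "act f2 (wedge 5 3 y) = - wedge 4 3 y - wedge 5 3 (act f2 y)"
  "act f2 (wedge 4 3 y) = wedge 4 3 (act f2 y)"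
proof -
  have "act f2 (ins 5 (ins 5 y)) = wedge 5 4 y + ins 5 (ins 5 (act f2 y))"
    "act f2 (wedge 2 4 y) = wedge 5 4 y + wedge 2 4 (act f2 y)"
    by (simp_all add: wedge_def act_basis_simps act_f2_ins ins_linear)
  then have "act f2 (pair55 y) = tscale 2 (wedge 5 4 y + ins 5 (ins 5 (act f2 y)))
    - (wedge 5 4 y + wedge 2 4 (act f2 y))"
    by (simp only: pair55_def act_basis_simps)
  also have "\<dots> = wedge 5 4 y + pair55 (act f2 y)"
    by (simp add: pair55_def fun_eq_iff)
  finally show "act f2 (pair55 y) = wedge 5 4 y + pair55 (act f2 y)" .
  have "act f2 (wedge 2 5 y) = tscale 2 (ins 5 (ins 5 y)) - wedge 2 4 y - wedge 2 5 (act f2 y)"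
    by (simp add: wedge_def act_basis_simps act_f2_ins ins_linear tensor.twice)
  then show "act f2 (wedge 2 5 y) = pair55 y - wedge 2 5 (act f2 y)" by (simp add: pair55_def)
qed (simp_all add: wedge_def pair13_def act_basis_simps act_f2_ins ins_linear)

lemma act_cartan_pair:
  "act e1 (wedge 1 2 y) = wedge 1 2 (act e1 y)" "act e2 (wedge 1 2 y) = wedge 1 2 (act e2 y)"
  "act H1 (wedge 1 2 y) = wedge 1 2 y + wedge 1 2 (act H1 y)"
  "act H2 (wedge 1 2 y) = wedge 1 2 y + wedge 1 2 (act H2 y)"
  by (simp_all add: wedge_def act_basis_simps act_e_ins ins_linear)

section \<open>Powers of \<open>f1\<close> and \<open>f2\<close> on products\<close>

type_synonym exponents = "nat \<times> nat \<times> nat \<times> nat"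

fun verma :: "exponents \<Rightarrow> tensor \<Rightarrow> tensor" where
  "verma (b1, b2, b3, b4) y = (act f1 ^^ b4) ((act f2 ^^ b3) ((act f1 ^^ b2) ((act f2 ^^ b1) y)))"

lemmas act_pow_simps = tensor.rho_pow_add[OF spo_basis(4)] tensor.rho_pow_add[OF spo_basis(12)]
  tensor.rho_pow_scale[OF spo_basis(4)] tensor.rho_pow_scale[OF spo_basis(12)]

lemma f1_pow_commute: "(\<And>y. act f1 (g y) = g (act f1 y)) \<Longrightarrow> (act f1 ^^ n) (g y) = g ((act f1 ^^ n) y)"
  by (induction n) simp_all

lemma f2_pow_commute: "(\<And>y. act f2 (g y) = g (act f2 y)) \<Longrightarrow> (act f2 ^^ n) (g y) = g ((act f2 ^^ n) y)"
  by (induction n) simp_all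

text \<open>The Leibniz formula for a front factor that \<open>f1\<close> sends from
  \<open>g\<close> to \<open>c\<close> times \<open>k\<close> and then to 0: at most one of the
  \<open>n\<close> applications hits it.\<close>

lemma f1_pow_ladder:
  assumes g: "\<And>y. act f1 (g y) = tscale c (k y) + g (act f1 y)" "\<And>y. act f1 (k y) = k (act f1 y)"
  shows "(act f1 ^^ n) (g y) = tscale (c * of_nat n) (k ((act f1 ^^ (n - 1)) y)) + g ((act f1 ^^ n) y)"
proof (induction n)
  case (Suc n)
  have k: "tscale (c * of_nat n) (k (act f1 ((act f1 ^^ (n - 1)) y))) = tscale (c * of_nat n) (k ((act f1 ^^ n) y))"
    by (cases n) simp_all
  have "(act f1 ^^ Suc n) (g y) =
    act f1 (tscale (c * of_nat n) (k ((act f1 ^^ (n - 1)) y))) + act f1 (g ((act f1 ^^ n) y))"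
    by (simp only: funpow.simps comp_apply Suc.IH act_basis_simps)
  also have "\<dots> = tscale (c * of_nat n) (k ((act f1 ^^ n) y)) +
    (tscale c (k ((act f1 ^^ n) y)) + g ((act f1 ^^ Suc n) y))"
    by (simp only: act_basis_simps g k funpow.simps comp_apply)
  also have "\<dots> = tscale (c * of_nat (Suc n)) (k ((act f1 ^^ (Suc n - 1)) y)) + g ((act f1 ^^ Suc n) y)"
    by (simp add: fun_eq_iff algebra_simps del: funpow.simps)
  finally show ?case .
qed (simp add: fun_eq_iff)

text \<open>The same for a front factor that survives two applications: the first coefficient is n(n
  - 1)/2, the number of ways to choose both, times -2.\<close>

lemma f1_pow_ladder2:
  assumes g: "\<And>y. act f1 (g y) = k y + g (act f1 y)"
    "\<And>y. act f1 (k y) = tscale (- 2) (m y) + k (act f1 y)" "\<And>y. act f1 (m y) = m (act f1 y)"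
  shows "(act f1 ^^ n) (g y) = tscale (- (of_nat n * (of_nat n - 1))) (m ((act f1 ^^ (n - 2)) y)) +
    tscale (of_nat n) (k ((act f1 ^^ (n - 1)) y)) + g ((act f1 ^^ n) y)"
proof (induction n)
  case (Suc n)
  have k: "tscale (of_nat n) (k (act f1 ((act f1 ^^ (n - 1)) y))) = tscale (of_nat n) (k ((act f1 ^^ n) y))"
    by (cases n) simp_all
  \<comment> \<open>For \<open>n \<le> 1\<close> the exponent \<open>n - 2\<close> is truncated, but
    the coefficient n(n - 1) is 0.\<close>
  have m: "tscale (- (of_nat n * (of_nat n - 1))) (m (act f1 ((act f1 ^^ (n - 2)) y))) =
    tscale (- (of_nat n * (of_nat n - 1))) (m ((act f1 ^^ (n - 1)) y))"
  proof (cases "n \<le> 1")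
    case True
    then have "n = 0 \<or> n = 1" by auto
    then show ?thesis by auto
  next
    case False
    then obtain i where "n = Suc (Suc i)"
      using le_Suc_ex[of 2 n] by (auto simp: numeral_2_eq_2)
    then show ?thesis by simp
  qed
  have "(act f1 ^^ Suc n) (g y) =
    act f1 (tscale (- (of_nat n * (of_nat n - 1))) (m ((act f1 ^^ (n - 2)) y))) +
    act f1 (tscale (of_nat n) (k ((act f1 ^^ (n - 1)) y))) + act f1 (g ((act f1 ^^ n) y))"
    by (simp only: funpow.simps comp_apply Suc.IH act_basis_simps)
  also have "\<dots> = tscale (- (of_nat n * (of_nat n - 1))) (m ((act f1 ^^ (n - 1)) y)) +
    tscale (of_nat n) (tscale (- 2) (m ((act f1 ^^ (n - 1)) y))) +
    tscale (of_nat n) (k ((act f1 ^^ n) y)) + (k ((act f1 ^^ n) y) + g ((act f1 ^^ Suc n) y))"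
    by (simp only: act_basis_simps g m k tensor.scale_right_distrib funpow.simps comp_apply add.assoc)
  also have "\<dots> = tscale (- (of_nat (Suc n) * (of_nat (Suc n) - 1))) (m ((act f1 ^^ (Suc n - 2)) y)) +
    tscale (of_nat (Suc n)) (k ((act f1 ^^ (Suc n - 1)) y)) + g ((act f1 ^^ Suc n) y)"
    by (simp add: fun_eq_iff algebra_simps del: funpow.simps)
  finally show ?case .
qed (simp add: fun_eq_iff)

text \<open>
  Signs arise because \<open>act f2\<close> passes an odd \<open>g\<close> with a sign. Hence its square is an even derivation,
  and only the parity and the half of the exponent enter.
\<close>

lemma f2_pow_even:
  assumes g: "\<And>y. act f2 (g y) = k y + g (act f2 y)" "\<And>y. act f2 (k y) = - m y - k (act f2 y)"
    "\<And>y. act f2 (m y) = m (act f2 y)"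
  shows "(act f2 ^^ n) (g y) = g ((act f2 ^^ n) y)
    + tscale (of_nat (n mod 2)) (k ((act f2 ^^ (n - 1)) y))
    - tscale (of_nat (n div 2)) (m ((act f2 ^^ (n - 2)) y))"
proof (induction n rule: induct_nat_012)
  case (ge2 n)
  have sq: "act f2 (act f2 (g z)) = g (act f2 (act f2 z)) - m z"
    "act f2 (act f2 (k z)) = k (act f2 (act f2 z))"
    "act f2 (act f2 (m z)) = m (act f2 (act f2 z))" for z
    by (simp_all add: g act_basis_simps)
  have k: "tscale (of_nat (n mod 2)) (k (act f2 (act f2 ((act f2 ^^ (n - 1)) y)))) =
    tscale (of_nat (n mod 2)) (k (act f2 ((act f2 ^^ n) y)))"
    by (cases n) simp_all
  have m: "tscale (of_nat (n div 2)) (m (act f2 (act f2 ((act f2 ^^ (n - 2)) y)))) =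
    tscale (of_nat (n div 2)) (m ((act f2 ^^ n) y))"
  proof (cases "n \<le> 1")
    case False
    then obtain i where "n = Suc (Suc i)"
      using le_Suc_ex[of 2 n] by (auto simp: numeral_2_eq_2)
    then show ?thesis by simp
  next
    case True
    then have "n = 0 \<or> n = 1" by auto
    then show ?thesis by auto
  qed
  have "(act f2 ^^ Suc (Suc n)) (g y) = act f2 (act f2 (g ((act f2 ^^ n) y)))
    + tscale (of_nat (n mod 2)) (act f2 (act f2 (k ((act f2 ^^ (n - 1)) y))))
    - tscale (of_nat (n div 2)) (act f2 (act f2 (m ((act f2 ^^ (n - 2)) y))))"
    by (simp only: funpow.simps comp_apply ge2(1) act_basis_simps)
  also have "\<dots> = g ((act f2 ^^ Suc (Suc n)) y) - m ((act f2 ^^ n) y)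
    + tscale (of_nat (n mod 2)) (k ((act f2 ^^ Suc n) y)) - tscale (of_nat (n div 2)) (m ((act f2 ^^ n) y))"
    by (simp only: sq k m funpow.simps comp_apply)
  also have "\<dots> = g ((act f2 ^^ Suc (Suc n)) y)
    + tscale (of_nat (Suc (Suc n) mod 2)) (k ((act f2 ^^ (Suc (Suc n) - 1)) y))
    - tscale (of_nat (Suc (Suc n) div 2)) (m ((act f2 ^^ (Suc (Suc n) - 2)) y))"
    by (simp add: fun_eq_iff algebra_simps del: funpow.simps)
  finally show ?case .
qed (simp_all add: g fun_eq_iff)

lemma f2_pow_odd:
  assumes g: "\<And>y. act f2 (g y) = k y - g (act f2 y)" "\<And>y. act f2 (k y) = m y + k (act f2 y)"
    "\<And>y. act f2 (m y) = - m (act f2 y)"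
  shows "(act f2 ^^ n) (g y) = tscale ((- 1) ^ n) (g ((act f2 ^^ n) y))
    + tscale (of_nat (n mod 2)) (k ((act f2 ^^ (n - 1)) y))
    + tscale ((- 1) ^ n * of_nat (n div 2)) (m ((act f2 ^^ (n - 2)) y))"
proof (induction n rule: induct_nat_012)
  case (ge2 n)
  have sq: "act f2 (act f2 (g z)) = g (act f2 (act f2 z)) + m z"
    "act f2 (act f2 (k z)) = k (act f2 (act f2 z))"
    "act f2 (act f2 (m z)) = m (act f2 (act f2 z))" for z
    by (simp_all add: g act_basis_simps)
  have k: "tscale (of_nat (n mod 2)) (k (act f2 (act f2 ((act f2 ^^ (n - 1)) y)))) =
    tscale (of_nat (n mod 2)) (k (act f2 ((act f2 ^^ n) y)))"
    by (cases n) simp_all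
  have m: "tscale ((- 1) ^ n * of_nat (n div 2)) (m (act f2 (act f2 ((act f2 ^^ (n - 2)) y)))) =
    tscale ((- 1) ^ n * of_nat (n div 2)) (m ((act f2 ^^ n) y))"
  proof (cases "n \<le> 1")
    case False
    then obtain i where "n = Suc (Suc i)"
      using le_Suc_ex[of 2 n] by (auto simp: numeral_2_eq_2)
    then show ?thesis by simp
  next
    case True
    then have "n = 0 \<or> n = 1" by auto
    then show ?thesis by auto
  qed
  have "(act f2 ^^ Suc (Suc n)) (g y) = tscale ((- 1) ^ n) (act f2 (act f2 (g ((act f2 ^^ n) y))))
    + tscale (of_nat (n mod 2)) (act f2 (act f2 (k ((act f2 ^^ (n - 1)) y))))
    + tscale ((- 1) ^ n * of_nat (n div 2)) (act f2 (act f2 (m ((act f2 ^^ (n - 2)) y))))"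
    by (simp only: funpow.simps comp_apply ge2(1) act_basis_simps)
  also have "\<dots> = tscale ((- 1) ^ n) (g ((act f2 ^^ Suc (Suc n)) y) + m ((act f2 ^^ n) y))
    + tscale (of_nat (n mod 2)) (k ((act f2 ^^ Suc n) y))
    + tscale ((- 1) ^ n * of_nat (n div 2)) (m ((act f2 ^^ n) y))"
    by (simp only: sq k m funpow.simps comp_apply)
  also have "\<dots> = tscale ((- 1) ^ Suc (Suc n)) (g ((act f2 ^^ Suc (Suc n)) y))
    + tscale (of_nat (Suc (Suc n) mod 2)) (k ((act f2 ^^ (Suc (Suc n) - 1)) y))
    + tscale ((- 1) ^ Suc (Suc n) * of_nat (Suc (Suc n) div 2)) (m ((act f2 ^^ (Suc (Suc n) - 2)) y))"
    by (simp add: fun_eq_iff algebra_simps del: funpow.simps)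
  finally show ?case .
qed (simp_all add: g fun_eq_iff)

lemma act_pow_diff:
  "(act f1 ^^ n) (u - w) = (act f1 ^^ n) u - (act f1 ^^ n) w"
  "(act f2 ^^ n) (u - w) = (act f2 ^^ n) u - (act f2 ^^ n) w"
  "(act f1 ^^ n) (- u) = - (act f1 ^^ n) u" "(act f2 ^^ n) (- u) = - (act f2 ^^ n) u"
  by (induction n) (simp_all add: act_basis_simps)

lemma ins_pow:
  "(act f2 ^^ n) (ins 1 y) = ins 1 ((act f2 ^^ n) y)"
  "(act f1 ^^ n) (ins 1 y) = tscale (of_nat n) (ins 2 ((act f1 ^^ (n - 1)) y)) + ins 1 ((act f1 ^^ n) y)"
  "(act f1 ^^ n) (ins 2 y) = ins 2 ((act f1 ^^ n) y)"
  "(act f1 ^^ n) (ins 3 y) = ins 3 ((act f1 ^^ n) y)"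
  "(act f1 ^^ n) (ins 5 y) = ins 5 ((act f1 ^^ n) y)"
  "(act f2 ^^ n) (ins 2 y) = ins 2 ((act f2 ^^ n) y)
    + tscale (of_nat (n mod 2)) (ins 5 ((act f2 ^^ (n - 1)) y))
    - tscale (of_nat (n div 2)) (ins 4 ((act f2 ^^ (n - 2)) y))"
  "(act f1 ^^ n) (ins 4 y) = tscale (- of_nat n) (ins 3 ((act f1 ^^ (n - 1)) y)) + ins 4 ((act f1 ^^ n) y)"
  using f1_pow_ladder[of "ins 1" 1 "ins 2" n y] f1_pow_ladder[of "ins 4" "- 1" "ins 3" n y]
    f2_pow_even[of "ins 2" "ins 5" "ins 4" n y]
  by (simp_all add: f1_pow_commute f2_pow_commute act_f1_ins act_f2_ins tscale_simps)

lemma wedge_pow: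
  "(act f1 ^^ n) (wedge 1 2 y) = wedge 1 2 ((act f1 ^^ n) y)"
  "(act f1 ^^ n) (wedge 2 5 y) = wedge 2 5 ((act f1 ^^ n) y)"
  "(act f1 ^^ n) (wedge 2 3 y) = wedge 2 3 ((act f1 ^^ n) y)"
  "(act f1 ^^ n) (wedge 5 3 y) = wedge 5 3 ((act f1 ^^ n) y)"
  "(act f1 ^^ n) (wedge 4 3 y) = wedge 4 3 ((act f1 ^^ n) y)"
  "(act f1 ^^ n) (wedge 1 5 y) =
    tscale (of_nat n) (wedge 2 5 ((act f1 ^^ (n - 1)) y)) + wedge 1 5 ((act f1 ^^ n) y)"
  "(act f1 ^^ n) (pair55 y) =
    tscale (of_nat n) (wedge 2 3 ((act f1 ^^ (n - 1)) y)) + pair55 ((act f1 ^^ n) y)"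
  "(act f1 ^^ n) (pair13 y) =
    tscale (- 2 * of_nat n) (wedge 2 3 ((act f1 ^^ (n - 1)) y)) + pair13 ((act f1 ^^ n) y)"
  "(act f1 ^^ n) (wedge 5 4 y) =
    tscale (- of_nat n) (wedge 5 3 ((act f1 ^^ (n - 1)) y)) + wedge 5 4 ((act f1 ^^ n) y)"
  "(act f1 ^^ n) (wedge 1 4 y) =
    tscale (- (of_nat n * (of_nat n - 1))) (wedge 2 3 ((act f1 ^^ (n - 2)) y)) +
    tscale (of_nat n) (pair13 ((act f1 ^^ (n - 1)) y)) + wedge 1 4 ((act f1 ^^ n) y)"
  "(act f2 ^^ n) (wedge 1 4 y) = wedge 1 4 ((act f2 ^^ n) y)"
  "(act f2 ^^ n) (wedge 1 2 y) = wedge 1 2 ((act f2 ^^ n) y)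
    + tscale (of_nat (n mod 2)) (wedge 1 5 ((act f2 ^^ (n - 1)) y))
    - tscale (of_nat (n div 2)) (wedge 1 4 ((act f2 ^^ (n - 2)) y))"
  "(act f2 ^^ n) (wedge 2 3 y) = wedge 2 3 ((act f2 ^^ n) y)
    + tscale (of_nat (n mod 2)) (wedge 5 3 ((act f2 ^^ (n - 1)) y))
    - tscale (of_nat (n div 2)) (wedge 4 3 ((act f2 ^^ (n - 2)) y))"
  "(act f2 ^^ n) (pair13 y) = pair13 ((act f2 ^^ n) y)
    + tscale (of_nat (n mod 2)) (wedge 5 4 ((act f2 ^^ (n - 1)) y))"
  "(act f2 ^^ n) (wedge 1 5 y) = tscale ((- 1) ^ n) (wedge 1 5 ((act f2 ^^ n) y))
    - tscale (of_nat (n mod 2)) (wedge 1 4 ((act f2 ^^ (n - 1)) y))"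
  "(act f2 ^^ n) (wedge 2 5 y) = tscale ((- 1) ^ n) (wedge 2 5 ((act f2 ^^ n) y))
    + tscale (of_nat (n mod 2)) (pair55 ((act f2 ^^ (n - 1)) y))
    + tscale ((- 1) ^ n * of_nat (n div 2)) (wedge 5 4 ((act f2 ^^ (n - 2)) y))"
proof -
  note simps = act_f1_pair act_f2_pair tscale_simps tensor.scale_minus_left tensor.scale_minus_right
  show "(act f1 ^^ n) (wedge 1 5 y) =
      tscale (of_nat n) (wedge 2 5 ((act f1 ^^ (n - 1)) y)) + wedge 1 5 ((act f1 ^^ n) y)"
    using f1_pow_ladder[of "wedge 1 5" 1 "wedge 2 5" n y] by (simp add: simps)
  show "(act f1 ^^ n) (pair55 y) =
      tscale (of_nat n) (wedge 2 3 ((act f1 ^^ (n - 1)) y)) + pair55 ((act f1 ^^ n) y)"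
    using f1_pow_ladder[of "pair55" 1 "wedge 2 3" n y] by (simp add: simps)
  show "(act f1 ^^ n) (pair13 y) =
      tscale (- 2 * of_nat n) (wedge 2 3 ((act f1 ^^ (n - 1)) y)) + pair13 ((act f1 ^^ n) y)"
    by (rule f1_pow_ladder) (simp_all add: simps tensor.twice)
  show "(act f1 ^^ n) (wedge 5 4 y) =
      tscale (- of_nat n) (wedge 5 3 ((act f1 ^^ (n - 1)) y)) + wedge 5 4 ((act f1 ^^ n) y)"
    using f1_pow_ladder[of "wedge 5 4" "- 1" "wedge 5 3" n y] by (simp add: simps)
  show "(act f1 ^^ n) (wedge 1 4 y) =
      tscale (- (of_nat n * (of_nat n - 1))) (wedge 2 3 ((act f1 ^^ (n - 2)) y)) +
      tscale (of_nat n) (pair13 ((act f1 ^^ (n - 1)) y)) + wedge 1 4 ((act f1 ^^ n) y)"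
    by (rule f1_pow_ladder2) (simp_all add: simps tensor.twice)
  show "(act f2 ^^ n) (wedge 1 2 y) = wedge 1 2 ((act f2 ^^ n) y)
      + tscale (of_nat (n mod 2)) (wedge 1 5 ((act f2 ^^ (n - 1)) y))
      - tscale (of_nat (n div 2)) (wedge 1 4 ((act f2 ^^ (n - 2)) y))"
    by (rule f2_pow_even) (simp_all add: simps)
  show "(act f2 ^^ n) (wedge 2 3 y) = wedge 2 3 ((act f2 ^^ n) y)
      + tscale (of_nat (n mod 2)) (wedge 5 3 ((act f2 ^^ (n - 1)) y))
      - tscale (of_nat (n div 2)) (wedge 4 3 ((act f2 ^^ (n - 2)) y))"
    by (rule f2_pow_even) (simp_all add: simps)
  show "(act f2 ^^ n) (pair13 y) = pair13 ((act f2 ^^ n) y)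
      + tscale (of_nat (n mod 2)) (wedge 5 4 ((act f2 ^^ (n - 1)) y))"
    using f2_pow_even[of pair13 "wedge 5 4" "\<lambda>_. 0" n y]
    by (simp add: simps act_basis_simps tensor.scale_zero_right)
  show "(act f2 ^^ n) (wedge 1 5 y) = tscale ((- 1) ^ n) (wedge 1 5 ((act f2 ^^ n) y))
      - tscale (of_nat (n mod 2)) (wedge 1 4 ((act f2 ^^ (n - 1)) y))"
    using f2_pow_odd[of "wedge 1 5" "\<lambda>y. - wedge 1 4 y" "\<lambda>_. 0" n y]
    by (simp add: simps act_basis_simps tensor.scale_zero_right)
  show "(act f2 ^^ n) (wedge 2 5 y) = tscale ((- 1) ^ n) (wedge 2 5 ((act f2 ^^ n) y))
      + tscale (of_nat (n mod 2)) (pair55 ((act f2 ^^ (n - 1)) y))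
      + tscale ((- 1) ^ n * of_nat (n div 2)) (wedge 5 4 ((act f2 ^^ (n - 2)) y))"
    by (rule f2_pow_odd) (simp_all add: simps)
qed (simp_all add: f1_pow_commute f2_pow_commute act_f1_pair act_f2_pair)

lemma wedge_coordinates:
  "wedge i j y (k # l # W) = (if k = i \<and> l = j then y W else 0) - (if k = j \<and> l = i then y W else 0)"
  "pair55 y (k # l # W) = (if k = 5 \<and> l = 5 then 2 * y W else 0) - wedge 2 4 y (k # l # W)"
  "pair13 y (k # l # W) = wedge 2 4 y (k # l # W) - wedge 1 3 y (k # l # W)"
proof -
  have ins2: "ins i (ins j y) (k # l # W) = (if k = i \<and> l = j then y W else 0)" for i j by simp
  show "wedge i j y (k # l # W) =
      (if k = i \<and> l = j then y W else 0) - (if k = j \<and> l = i then y W else 0)"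
    unfolding wedge_def minus_apply ins2 ..
  show "pair55 y (k # l # W) = (if k = 5 \<and> l = 5 then 2 * y W else 0) - wedge 2 4 y (k # l # W)"
    unfolding pair55_def minus_apply tscale_apply ins2 by (simp only: if_distrib mult_zero_right)
  show "pair13 y (k # l # W) = wedge 2 4 y (k # l # W) - wedge 1 3 y (k # l # W)"
    by (simp only: pair13_def minus_apply)
qed

text \<open>Equal totals of \<open>f1\<close> and of \<open>f2\<close>, but \<open>c\<close> spends
  no more of them in the two innermost strings. This is the order in which the coordinates are
  triangular.\<close>

fun dominates :: "exponents \<Rightarrow> exponents \<Rightarrow> bool" where
  "dominates (b1, b2, b3, b4) (c1, c2, c3, c4) \<longleftrightarrow>
    c1 \<le> b1 \<and> c2 \<le> b2 \<and> c1 + c3 = b1 + b3 \<and> c2 + c4 = b2 + b4"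

fun below :: "exponents \<Rightarrow> exponents \<Rightarrow> bool" where
  "below (c1, c2, c3, c4) (b1, b2, b3, b4) \<longleftrightarrow> c1 \<le> b1 \<and> c2 \<le> b2 \<and> c3 \<le> b3 \<and> c4 \<le> b4"

text \<open>The word \<open>W\<close> is a pivot for \<open>b\<close>.\<close>

definition detects :: "5 list \<Rightarrow> exponents \<Rightarrow> tensor \<Rightarrow> bool" where
  "detects W b y \<longleftrightarrow> (\<forall>c. verma c y W \<noteq> 0 \<longrightarrow> dominates b c) \<and> verma b y W \<noteq> 0"

declare verma.simps [simp del]

lemma sum_list_map_zero: "(\<And>x. x \<in> set xs \<Longrightarrow> f x = 0) \<Longrightarrow> sum_list (map f xs) = (0 :: complex)"
  by (induction xs) auto

text \<open>\<open>formula\<close> distributes the exponents \<open>c\<close> into a part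
  \<open>g\<close> absorbed by the new front factor and the rest \<open>c - g\<close> acting on
  \<open>y\<close>; the subtraction is a true one where the coefficient is nonzero. As
  \<open>a\<close> dominates every such \<open>g\<close> and domination is additive, pivots add
  up.\<close>

lemma detects_step:
  assumes y: "detects W b y"
    and formula: "\<And>c. verma c z U = (\<Sum>(g, k)\<leftarrow>G. k c * verma (c - g) y W)"
    and G: "\<And>g k. (g, k) \<in> set G \<Longrightarrow> dominates a g \<and> (\<forall>c. k c \<noteq> 0 \<longrightarrow> below g c)"
    and G': "distinct (map fst G)" "(a, k) \<in> set G" "k (b + a) \<noteq> 0"
  shows "detects U (b + a) z"
proof -
  have dom: "dominates b c" if "verma c y W \<noteq> 0" for c using y that unfolding detects_def by blast
  have dom_add: "dominates (b + a) c" if "dominates a g" "below g c" "dominates b (c - g)" for c g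
    using that by (cases a; cases b; cases c; cases g) auto
  have "dominates (b + a) c" if "verma c z U \<noteq> 0" for c
  proof -
    have "\<exists>(g, k)\<in>set G. k c * verma (c - g) y W \<noteq> 0"
    proof (rule ccontr)
      assume "\<not> (\<exists>(g, k)\<in>set G. k c * verma (c - g) y W \<noteq> 0)"
      have "(\<Sum>(g, k)\<leftarrow>G. k c * verma (c - g) y W) = 0"
      proof (intro sum_list_map_zero)
        fix p assume "p \<in> set G"
        moreover obtain g k where "p = (g, k)" by (cases p)
        ultimately show "(case p of (g, k) \<Rightarrow> k c * verma (c - g) y W) = 0"
          using \<open>\<not> (\<exists>(g, k)\<in>set G. k c * verma (c - g) y W \<noteq> 0)\<close> by (simp only: split_conv) blast
      qed
      then show False using that formula by simp
    qed
    then obtain g k where "(g, k) \<in> set G" "k c \<noteq> 0" "verma (c - g) y W \<noteq> 0" by auto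
    then show ?thesis using G[of g k] dom[of "c - g"] dom_add[of g c] by blast
  qed
  moreover have "verma (b + a) z U \<noteq> 0"
  proof -
    have only: "h (b + a) * verma (b + a - g) y W = 0" if "(g, h) \<in> set G" "g \<noteq> a" for g h
    proof (rule ccontr)
      assume "\<not> ?thesis"
      then have nz: "h (b + a) \<noteq> 0" "verma (b + a - g) y W \<noteq> 0" by auto
      then have "dominates a g" "below g (b + a)" "dominates b (b + a - g)"
        using G[OF that(1)] dom by blast+
      \<comment> \<open>At \<open>b + a\<close> the two dominations add up to an equality, so both
        are equalities.\<close>
      then have "g = a" by (cases a; cases b; cases g) auto
      then show False using that(2) by simp
    qed
    have "(\<Sum>(g, h)\<leftarrow>G. h (b + a) * verma (b + a - g) y W) = k (b + a) * verma b y W"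
      using G'(1,2) only
    proof (induction G)
      case (Cons p G)
      have sub: "b + a - a = b" by (cases a; cases b) simp
      show ?case
      proof (cases "p = (a, k)")
        case True
        have "(\<Sum>(g, h)\<leftarrow>G. h (b + a) * verma (b + a - g) y W) = 0"
        proof (rule sum_list_map_zero)
          fix q assume "q \<in> set G"
          moreover from this have "fst q \<noteq> a" using Cons.prems(1) True by force
          ultimately show "(case q of (g, h) \<Rightarrow> h (b + a) * verma (b + a - g) y W) = 0"
            using Cons.prems(3)[of "fst q" "snd q"] by (simp add: case_prod_beta)
        qed
        then show ?thesis using True sub by simp
      next
        case False
        then have mem: "(a, k) \<in> set G" using Cons.prems(2) by auto
        then have "a \<in> fst ` set G" by (intro image_eqI[of a fst "(a, k)"]) simp_all
        then have "fst p \<noteq> a" using Cons.prems(1) by auto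
        then show ?thesis using Cons.prems(1,3) Cons.IH mem by (cases p) auto
      qed
    qed simp
    then show ?thesis using formula G'(3) y by (simp add: detects_def)
  qed
  ultimately show ?thesis unfolding detects_def by blast
qed

text \<open>The front vector passes through the letters 1, 2, 5, 4, 3 under \<open>f1\<close>,
  \<open>f2\<close>, \<open>f2\<close>, \<open>f1\<close>. The added exponents charge each step to
  the innermost string that can make it. Letter 5 arises with coefficient \<open>c3 mod 2\<close>,
  which is nonzero at \<open>b3 + 1\<close> only if \<open>b3\<close> is even.\<close>

lemma detects_ins:
  assumes "detects W b y"
  shows "detects (1 # W) (b + (0, 0, 0, 0)) (ins 1 y)"
    "detects (2 # W) (b + (0, 1, 0, 0)) (ins 1 y)"
    "even (fst (snd (snd b))) \<Longrightarrow> detects (5 # W) (b + (0, 1, 1, 0)) (ins 1 y)"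
    "detects (4 # W) (b + (0, 1, 2, 0)) (ins 1 y)"
    "detects (3 # W) (b + (0, 1, 2, 1)) (ins 1 y)"
proof -
  obtain b1 b2 b3 b4 where b: "b = (b1, b2, b3, b4)" by (cases b)
  note simps = b verma.simps ins_pow act_pow_simps act_pow_diff
  show "detects (1 # W) (b + (0, 0, 0, 0)) (ins 1 y)"
    by (rule detects_step[OF assms, where k = "\<lambda>_. 1" and G = "[((0, 0, 0, 0), \<lambda>_. 1)]"])
      (auto simp: simps)
  show "detects (2 # W) (b + (0, 1, 0, 0)) (ins 1 y)"
    by (rule detects_step[OF assms, where k = "\<lambda>(c1, c2, c3, c4). of_nat c2"
          and G = "[((0, 1, 0, 0), \<lambda>(c1, c2, c3, c4). of_nat c2),
            ((0, 0, 0, 1), \<lambda>(c1, c2, c3, c4). of_nat c4)]"])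
      (auto simp: simps simp del: of_nat_Suc)
  show "detects (5 # W) (b + (0, 1, 1, 0)) (ins 1 y)" if "even (fst (snd (snd b)))"
    by (rule detects_step[OF assms, where k = "\<lambda>(c1, c2, c3, c4). of_nat (c2 * (c3 mod 2))"
          and G = "[((0, 1, 1, 0), \<lambda>(c1, c2, c3, c4). of_nat (c2 * (c3 mod 2)))]"])
      (use that in \<open>auto simp: simps mod_Suc simp del: of_nat_Suc\<close>)
  show "detects (4 # W) (b + (0, 1, 2, 0)) (ins 1 y)"
    by (rule detects_step[OF assms, where k = "\<lambda>(c1, c2, c3, c4). - of_nat (c2 * (c3 div 2))"
          and G = "[((0, 1, 2, 0), \<lambda>(c1, c2, c3, c4). - of_nat (c2 * (c3 div 2)))]"])
      (auto simp: simps simp del: of_nat_Suc)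
  show "detects (3 # W) (b + (0, 1, 2, 1)) (ins 1 y)"
    by (rule detects_step[OF assms, where k = "\<lambda>(c1, c2, c3, c4). of_nat (c2 * (c3 div 2) * c4)"
          and G = "[((0, 1, 2, 1), \<lambda>(c1, c2, c3, c4). of_nat (c2 * (c3 div 2) * c4))]"])
      (auto simp: simps simp del: of_nat_Suc)
qed

text \<open>\<open>G\<close> lists all ways in which steps from the four strings turn
  \<open>wedge 1 2\<close> into a vector with the given initial word; its first entry uses the
  innermost strings most. The parity conditions keep factors \<open>c1 mod 2\<close> and
  \<open>c3 mod 2\<close> of that entry from vanishing.\<close>

lemma detects_wedge:
  assumes "detects W b y"
  shows "detects (1 # 2 # W) (b + (0, 0, 0, 0)) (wedge 1 2 y)"
    "even (fst b) \<Longrightarrow> detects (1 # 5 # W) (b + (1, 0, 0, 0)) (wedge 1 2 y)"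
    "detects (1 # 4 # W) (b + (2, 0, 0, 0)) (wedge 1 2 y)"
    "even (fst b) \<Longrightarrow> detects (2 # 5 # W) (b + (1, 1, 0, 0)) (wedge 1 2 y)"
    "even (fst b) \<Longrightarrow> even (fst (snd (snd b))) \<Longrightarrow>
      detects (5 # 5 # W) (b + (1, 1, 1, 0)) (wedge 1 2 y)"
    "detects (1 # 3 # W) (b + (2, 1, 0, 0)) (wedge 1 2 y)"
    "even (fst (snd (snd b))) \<Longrightarrow> detects (5 # 4 # W) (b + (2, 1, 1, 0)) (wedge 1 2 y)"
    "detects (2 # 3 # W) (b + (2, 2, 0, 0)) (wedge 1 2 y)"
    "even (fst (snd (snd b))) \<Longrightarrow> detects (5 # 3 # W) (b + (2, 2, 1, 0)) (wedge 1 2 y)"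
    "detects (4 # 3 # W) (b + (2, 2, 2, 0)) (wedge 1 2 y)"
proof -
  obtain b1 b2 b3 b4 where b: "b = (b1, b2, b3, b4)" by (cases b)
  note simps = b verma.simps wedge_pow wedge_coordinates act_pow_simps act_pow_diff
  show "detects (1 # 2 # W) (b + (0, 0, 0, 0)) (wedge 1 2 y)"
    by (rule detects_step[OF assms, where k = "\<lambda>_. 1" and G = "[((0, 0, 0, 0), \<lambda>_. 1)]"])
      (auto simp: simps)
  show "detects (1 # 5 # W) (b + (1, 0, 0, 0)) (wedge 1 2 y)" if "even (fst b)"
    by (rule detects_step[OF assms, where k = "\<lambda>(c1, c2, c3, c4). of_nat (c1 mod 2) * (- 1) ^ c3"
          and G = "[((1, 0, 0, 0), \<lambda>(c1, c2, c3, c4). of_nat (c1 mod 2) * (- 1) ^ c3),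
            ((0, 0, 1, 0), \<lambda>(c1, c2, c3, c4). of_nat (c3 mod 2))]"])
      (use that in \<open>auto simp: simps mod_Suc\<close>)
  show "detects (1 # 4 # W) (b + (2, 0, 0, 0)) (wedge 1 2 y)"
    by (rule detects_step[OF assms, where k = "\<lambda>(c1, c2, c3, c4). - of_nat (c1 div 2)"
          and G = "[((2, 0, 0, 0), \<lambda>(c1, c2, c3, c4). - of_nat (c1 div 2)),
            ((0, 0, 2, 0), \<lambda>(c1, c2, c3, c4). - of_nat (c3 div 2)),
            ((1, 0, 1, 0), \<lambda>(c1, c2, c3, c4). - of_nat (c1 mod 2 * (c3 mod 2)))]"])
      (auto simp: simps algebra_simps simp del: of_nat_Suc)
  show "detects (2 # 5 # W) (b + (1, 1, 0, 0)) (wedge 1 2 y)" if "even (fst b)"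
    by (rule detects_step[OF assms, where k = "\<lambda>(c1, c2, c3, c4). of_nat (c1 mod 2 * c2) * (- 1) ^ c3"
          and G = "[((1, 1, 0, 0), \<lambda>(c1, c2, c3, c4). of_nat (c1 mod 2 * c2) * (- 1) ^ c3),
            ((1, 0, 0, 1), \<lambda>(c1, c2, c3, c4). of_nat (c1 mod 2 * c4) * (- 1) ^ c3),
            ((0, 0, 1, 1), \<lambda>(c1, c2, c3, c4). of_nat (c3 mod 2 * c4))]"])
      (use that in \<open>auto simp: simps mod_Suc algebra_simps simp del: of_nat_Suc\<close>)
  show "detects (5 # 5 # W) (b + (1, 1, 1, 0)) (wedge 1 2 y)"
    if "even (fst b)" "even (fst (snd (snd b)))"
    by (rule detects_step[OF assms, where k = "\<lambda>(c1, c2, c3, c4). 2 * of_nat (c1 mod 2 * c2 * (c3 mod 2))"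
          and G = "[((1, 1, 1, 0), \<lambda>(c1, c2, c3, c4). 2 * of_nat (c1 mod 2 * c2 * (c3 mod 2)))]"])
      (use that in \<open>auto simp: simps mod_Suc algebra_simps simp del: of_nat_Suc\<close>)
  show "detects (1 # 3 # W) (b + (2, 1, 0, 0)) (wedge 1 2 y)"
    by (rule detects_step[OF assms, where k = "\<lambda>(c1, c2, c3, c4). of_nat (c1 div 2 * c2)"
          and G = "[((2, 1, 0, 0), \<lambda>(c1, c2, c3, c4). of_nat (c1 div 2 * c2)),
            ((0, 0, 2, 1), \<lambda>(c1, c2, c3, c4). of_nat (c3 div 2 * c4)),
            ((1, 0, 1, 1), \<lambda>(c1, c2, c3, c4). of_nat (c1 mod 2 * (c3 mod 2) * c4)),
            ((2, 0, 0, 1), \<lambda>(c1, c2, c3, c4). of_nat (c1 div 2 * c4))]"])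
      (auto simp: simps algebra_simps simp del: of_nat_Suc)
  show "detects (5 # 4 # W) (b + (2, 1, 1, 0)) (wedge 1 2 y)" if "even (fst (snd (snd b)))"
    by (rule detects_step[OF assms, where k = "\<lambda>(c1, c2, c3, c4). - of_nat (c1 div 2 * c2 * (c3 mod 2))"
          and G = "[((2, 1, 1, 0), \<lambda>(c1, c2, c3, c4). - of_nat (c1 div 2 * c2 * (c3 mod 2))),
            ((1, 1, 2, 0), \<lambda>(c1, c2, c3, c4). of_nat (c1 mod 2 * c2 * (c3 div 2)) * (- 1) ^ c3)]"])
      (use that in \<open>auto simp: simps mod_Suc algebra_simps simp del: of_nat_Suc\<close>)
  show "detects (2 # 3 # W) (b + (2, 2, 0, 0)) (wedge 1 2 y)"
    by (rule detects_step[OF assms,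
          where k = "\<lambda>(c1, c2, c3, c4). of_nat (c1 div 2) * (of_nat c2 * (of_nat c2 - 1))"
          and G = "[((2, 2, 0, 0), \<lambda>(c1, c2, c3, c4). of_nat (c1 div 2) * (of_nat c2 * (of_nat c2 - 1))),
            ((1, 1, 1, 1), \<lambda>(c1, c2, c3, c4). of_nat (c1 mod 2 * (c3 mod 2) * c2 * c4)),
            ((2, 1, 0, 1), \<lambda>(c1, c2, c3, c4). 2 * of_nat (c1 div 2 * c2 * c4)),
            ((0, 0, 2, 2), \<lambda>(c1, c2, c3, c4). of_nat (c3 div 2) * (of_nat c4 * (of_nat c4 - 1))),
            ((1, 0, 1, 2), \<lambda>(c1, c2, c3, c4). of_nat (c1 mod 2 * (c3 mod 2)) * (of_nat c4 * (of_nat c4 - 1))),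
            ((2, 0, 0, 2), \<lambda>(c1, c2, c3, c4). of_nat (c1 div 2) * (of_nat c4 * (of_nat c4 - 1)))]"])
      (auto simp: simps algebra_simps simp del: of_nat_Suc)
  show "detects (5 # 3 # W) (b + (2, 2, 1, 0)) (wedge 1 2 y)" if "even (fst (snd (snd b)))"
    by (rule detects_step[OF assms,
          where k = "\<lambda>(c1, c2, c3, c4). of_nat (c1 div 2 * (c3 mod 2)) * (of_nat c2 * (of_nat c2 - 1))"
          and G = "[((2, 2, 1, 0), \<lambda>(c1, c2, c3, c4). of_nat (c1 div 2 * (c3 mod 2)) * (of_nat c2 * (of_nat c2 - 1))),
            ((1, 1, 2, 1), \<lambda>(c1, c2, c3, c4). - of_nat (c1 mod 2 * c2 * (c3 div 2) * c4) * (- 1) ^ c3),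
            ((2, 1, 1, 1), \<lambda>(c1, c2, c3, c4). of_nat (c1 div 2 * c2 * (c3 mod 2) * c4))]"])
      (use that in \<open>auto simp: simps mod_Suc algebra_simps simp del: of_nat_Suc\<close>)
  show "detects (4 # 3 # W) (b + (2, 2, 2, 0)) (wedge 1 2 y)"
    by (rule detects_step[OF assms,
          where k = "\<lambda>(c1, c2, c3, c4). - of_nat (c1 div 2 * (c3 div 2)) * (of_nat c2 * (of_nat c2 - 1))"
          and G = "[((2, 2, 2, 0), \<lambda>(c1, c2, c3, c4). - of_nat (c1 div 2 * (c3 div 2)) * (of_nat c2 * (of_nat c2 - 1)))]"])
      (auto simp: simps algebra_simps simp del: of_nat_Suc)
qed

section \<open>Linear independence\<close>

fun admissible :: "nat \<Rightarrow> nat \<Rightarrow> exponents \<Rightarrow> bool" where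
  "admissible m1 m2 (b1, b2, b3, b4) \<longleftrightarrow>
    b1 \<le> 2 * m2 \<and> b2 \<le> m1 + b1 \<and> b3 \<le> min (b2 + m1) (2 * b2) \<and> b4 \<le> min m1 (b3 div 2)"

definition unit_tensor :: tensor where
  "unit_tensor w = (if w = [] then 1 else 0)"

text \<open>m2 factors v_1 \<otimes> v_2 - v_2 \<otimes> v_1 of weight \<epsilon>1 + \<epsilon>2,
  followed by m1 factors v_1 of weight \<epsilon>1; the total weight is \<lambda>.\<close>

definition hw_tensor :: "nat \<Rightarrow> nat \<Rightarrow> tensor" where
  "hw_tensor m1 m2 = (wedge 1 2 ^^ m2) ((ins 1 ^^ m1) unit_tensor)"

lemma act_unit_tensor: "act X unit_tensor = 0"
proof
  fix w
  have zero: "act_word r Y (\<lambda>_. 0) = 0" for r Y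
    using act_word_linear(2)[of r Y 0 "\<lambda>_. 0"] by simp
  show "act X unit_tensor w = 0 w"
    by (cases w) (simp_all add: act_def unit_tensor_def zero)
qed

lemma hw_tensor_hw:
  "act e1 (hw_tensor m1 m2) = 0" "act e2 (hw_tensor m1 m2) = 0"
  "tensor.wt (of_nat (m1 + m2)) (of_nat m2) (hw_tensor m1 m2)"
proof -
  have zero: "ins j 0 = 0" "wedge i j 0 = 0" for i j
    by (auto simp: fun_eq_iff wedge_def ins_def split: list.split)
  have scale: "wedge i j (tscale c y) = tscale c (wedge i j y)" for i j c y
    by (simp add: wedge_def ins_linear tensor.scale_right_diff_distrib)
  have add: "wedge i j (x + y) = wedge i j x + wedge i j y" for i j x y
    by (simp add: wedge_def ins_linear)
  have "act e1 ((ins 1 ^^ m1) unit_tensor) = 0" "act e2 ((ins 1 ^^ m1) unit_tensor) = 0"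
    "act H1 ((ins 1 ^^ m1) unit_tensor) = tscale (of_nat m1) ((ins 1 ^^ m1) unit_tensor)"
    "act H2 ((ins 1 ^^ m1) unit_tensor) = 0"
    by (induction m1)
      (simp_all add: act_unit_tensor act_e_ins zero ins_linear tscale_simps tensor.scale_left_distrib)
  then have "act e1 (hw_tensor m1 m2) = 0 \<and> act e2 (hw_tensor m1 m2) = 0 \<and>
    act H1 (hw_tensor m1 m2) = tscale (of_nat (m1 + m2)) (hw_tensor m1 m2) \<and>
    act H2 (hw_tensor m1 m2) = tscale (of_nat m2) (hw_tensor m1 m2)"
    unfolding hw_tensor_def
    by (induction m2)
      (simp_all add: act_cartan_pair zero scale add tscale_simps tensor.scale_left_distrib)
  then show "act e1 (hw_tensor m1 m2) = 0" "act e2 (hw_tensor m1 m2) = 0"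
    "tensor.wt (of_nat (m1 + m2)) (of_nat m2) (hw_tensor m1 m2)"
    by (simp_all add: tensor.wt_def)
qed

lemma detects_unit: "detects [] (0, 0, 0, 0) unit_tensor"
proof -
  have "verma c unit_tensor [] = 0" if "c \<noteq> (0, 0, 0, 0)" for c
  proof -
    obtain b1 b2 b3 b4 where c: "c = (b1, b2, b3, b4)" by (cases c)
    have pow: "(act X ^^ n) z [] = 0" if "n > 0" for X n z
      using that by (cases n) (simp_all add: act_Nil)
    have pow1: "(act X ^^ n) unit_tensor = 0" if "n > 0" "X \<in> spo" for X n
      using that by (cases n) (simp_all add: act_unit_tensor funpow_swap1 tensor.rho_pow_zero)
    show ?thesis
      using that unfolding c verma.simps
      by (cases "b4 > 0"; cases "b3 > 0"; cases "b2 > 0"; cases "b1 > 0")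
        (simp_all add: pow pow1 spo_basis tensor.rho_pow_zero)
  qed
  moreover have "verma (0, 0, 0, 0) unit_tensor [] = 1"
    by (simp add: verma.simps unit_tensor_def)
  ultimately show ?thesis unfolding detects_def by (metis dominates.simps le_refl zero_neq_one)
qed

text \<open>Each factor v_1 takes the last letter in the order 1, 2, 5, 4, 3 that the exponents
  permit. Letter 5 is used only for \<open>b3 = 1\<close>, so the rest \<open>b3 - 1\<close> is even
  as required.\<close>

lemma detecting_word_ins:
  "admissible m1 0 b \<Longrightarrow> \<exists>W. detects W b ((ins 1 ^^ m1) unit_tensor)"
proof (induction m1 arbitrary: b)
  case 0
  then have "b = (0, 0, 0, 0)" by (cases b) auto
  then show ?case using detects_unit by auto
next
  case (Suc m1)
  obtain b2 b3 b4 where b: "b = (0, b2, b3, b4)"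
    and *: "b2 \<le> Suc m1" "b3 \<le> 2 * b2" "b4 \<le> b3 div 2" "b4 \<le> Suc m1"
    using Suc.prems by (cases b) auto
  have b2: "b2 - Suc 0 \<le> m1" "b3 - 2 \<le> 2 * (b2 - Suc 0)" "b4 - Suc 0 \<le> (b3 - 2) div 2"
    using * by linarith+
  consider "b2 = 0" | "b2 > 0" "b3 = 0" | "b2 > 0" "b3 = 1" | "b2 > 0" "b3 > 1" "b4 = 0" | "b2 > 0" "b4 > 0"
    using * by linarith
  then show ?case
  proof cases
    case 1
    then obtain W where "detects W (0, b2, b3, b4) ((ins 1 ^^ m1) unit_tensor)"
      using Suc.IH[of "(0, b2, b3, b4)"] * b2 by auto
    from detects_ins(1)[OF this] show ?thesis unfolding b by auto
  next
    case 2
    then obtain W where "detects W (0, b2 - 1, b3, b4) ((ins 1 ^^ m1) unit_tensor)"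
      using Suc.IH[of "(0, b2 - 1, b3, b4)"] * b2 by auto
    from detects_ins(2)[OF this] 2 show ?thesis unfolding b by auto
  next
    case 3
    then obtain W where "detects W (0, b2 - 1, b3 - 1, b4) ((ins 1 ^^ m1) unit_tensor)"
      using Suc.IH[of "(0, b2 - 1, b3 - 1, b4)"] * b2 by auto
    from detects_ins(3)[OF this] 3 show ?thesis unfolding b by auto
  next
    case 4
    then obtain W where "detects W (0, b2 - 1, b3 - 2, b4) ((ins 1 ^^ m1) unit_tensor)"
      using Suc.IH[of "(0, b2 - 1, b3 - 2, b4)"] * b2 by auto
    moreover have "(0, b2 - 1, b3 - 2, b4) + (0, 1, 2, 0) = b" using 4 unfolding b by auto
    ultimately show ?thesis using detects_ins(4)[of W "(0, b2 - 1, b3 - 2, b4)"] by auto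
  next
    case 5
    then obtain W where "detects W (0, b2 - 1, b3 - 2, b4 - 1) ((ins 1 ^^ m1) unit_tensor)"
      using Suc.IH[of "(0, b2 - 1, b3 - 2, b4 - 1)"] * b2 by auto
    moreover have "b3 \<ge> 2" using 5 * by linarith
    then have "(0, b2 - 1, b3 - 2, b4 - 1) + (0, 1, 2, 1) = b" using 5 unfolding b by auto
    ultimately show ?thesis using detects_ins(5)[of W "(0, b2 - 1, b3 - 2, b4 - 1)"] by auto
  qed
qed

text \<open>
  The exponents of the factors are split off greedily. The factor of \<open>b\<close> taken by \<open>wedge 1 2\<close> may
  have an odd first (third) entry only if the remaining one is even.
\<close>

lemma detecting_word:
  "admissible m1 m2 b \<Longrightarrow> \<exists>W. detects W b (hw_tensor m1 m2)"
proof (induction m2 arbitrary: b)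
  case 0
  then show ?case using detecting_word_ins by (simp add: hw_tensor_def)
next
  case (Suc m2)
  obtain b1 b2 b3 b4 where b: "b = (b1, b2, b3, b4)" by (cases b)
  note adm = Suc.prems[unfolded b, simplified]
  have hw: "hw_tensor m1 (Suc m2) = wedge 1 2 (hw_tensor m1 m2)" by (simp add: hw_tensor_def)
  have cases: "b1 = 0 \<or> b1 = 1 \<or> b1 \<ge> 2" "b2 \<le> m1 \<or> b2 = m1 + 1 \<or> b2 \<ge> m1 + 2"
    "b2 = m1 + 1 \<Longrightarrow> b3 \<le> 2 * m1 \<or> b3 = 2 * m1 + 1" "b1 = 1 \<Longrightarrow> \<not> b2 \<ge> m1 + 2"
    "b3 + 2 \<le> b2 + m1 \<or> b3 + 1 = b2 + m1 \<or> b3 = b2 + m1"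
    using adm by linarith+
  from cases(1) consider (zero) "b1 = 0" | (one) "b1 = 1" | (two) "b1 \<ge> 2" by blast
  then show ?case
  proof cases
    case zero
    have "admissible m1 m2 (b1, b2, b3, b4)" using adm zero by (auto)
    moreover have "(b1, b2, b3, b4) + (0, 0, 0, 0) = b" unfolding b by simp
    ultimately show ?thesis using Suc.IH[of "(b1, b2, b3, b4)"] detects_wedge(1)[of _ "(b1, b2, b3, b4)"]
      unfolding hw by (auto simp del: add_Pair)
  next
    case one
    consider (low) "b2 \<le> m1" | (mid) "b2 = m1 + 1" "b3 \<le> 2 * m1" | (top) "b2 = m1 + 1" "b3 = 2 * m1 + 1"
      using cases(2,3) cases(4)[OF one] by blast
    then show ?thesis
    proof cases
      case low
      have "admissible m1 m2 (b1 - 1, b2, b3, b4)" using adm one low by (auto)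
      moreover have "(b1 - 1, b2, b3, b4) + (1, 0, 0, 0) = b" unfolding b using one low by auto
      moreover have "even (b1 - 1)" using one low by auto
      ultimately show ?thesis using Suc.IH[of "(b1 - 1, b2, b3, b4)"] detects_wedge(2)[of _ "(b1 - 1, b2, b3, b4)"]
        unfolding hw by (auto simp del: add_Pair)
    next
      case mid
      have "admissible m1 m2 (b1 - 1, b2 - 1, b3, b4)" using adm one mid by (auto)
      moreover have "(b1 - 1, b2 - 1, b3, b4) + (1, 1, 0, 0) = b" unfolding b using one mid by auto
      moreover have "even (b1 - 1)" using one mid by auto
      ultimately show ?thesis using Suc.IH[of "(b1 - 1, b2 - 1, b3, b4)"] detects_wedge(4)[of _ "(b1 - 1, b2 - 1, b3, b4)"]
        unfolding hw by (auto simp del: add_Pair)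
    next
      case top
      have "admissible m1 m2 (b1 - 1, b2 - 1, b3 - 1, b4)" using adm one top by (auto)
      moreover have "(b1 - 1, b2 - 1, b3 - 1, b4) + (1, 1, 1, 0) = b" unfolding b using one top by auto
      moreover have "even (b1 - 1)" "even (b3 - 1)" using one top by auto
      ultimately show ?thesis using Suc.IH[of "(b1 - 1, b2 - 1, b3 - 1, b4)"] detects_wedge(5)[of _ "(b1 - 1, b2 - 1, b3 - 1, b4)"]
        unfolding hw by (auto simp del: add_Pair)
    qed
  next
    case two
    consider (low) "b2 \<le> m1" | (mid) "b2 = m1 + 1" "b3 \<le> 2 * m1" | (top) "b2 = m1 + 1" "b3 = 2 * m1 + 1"
      | (d) "b2 \<ge> m1 + 2"
      using cases(2,3) by blast
    then show ?thesis
    proof cases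
      case low
      have "admissible m1 m2 (b1 - 2, b2, b3, b4)" using adm two low by (auto)
      moreover have "(b1 - 2, b2, b3, b4) + (2, 0, 0, 0) = b" unfolding b using two low by auto
      ultimately show ?thesis using Suc.IH[of "(b1 - 2, b2, b3, b4)"] detects_wedge(3)[of _ "(b1 - 2, b2, b3, b4)"]
        unfolding hw by (auto simp del: add_Pair)
    next
      case mid
      have "admissible m1 m2 (b1 - 2, b2 - 1, b3, b4)" using adm two mid by (auto)
      moreover have "(b1 - 2, b2 - 1, b3, b4) + (2, 1, 0, 0) = b" unfolding b using two mid by auto
      ultimately show ?thesis using Suc.IH[of "(b1 - 2, b2 - 1, b3, b4)"] detects_wedge(6)[of _ "(b1 - 2, b2 - 1, b3, b4)"]
        unfolding hw by (auto simp del: add_Pair)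
    next
      case top
      have "admissible m1 m2 (b1 - 2, b2 - 1, b3 - 1, b4)" using adm two top by (auto)
      moreover have "(b1 - 2, b2 - 1, b3 - 1, b4) + (2, 1, 1, 0) = b" unfolding b using two top by auto
      moreover have "even (b3 - 1)" using two top by auto
      ultimately show ?thesis using Suc.IH[of "(b1 - 2, b2 - 1, b3 - 1, b4)"] detects_wedge(7)[of _ "(b1 - 2, b2 - 1, b3 - 1, b4)"]
        unfolding hw by (auto simp del: add_Pair)
    next
      case d
      consider (e) "b3 + 2 \<le> b2 + m1" | (f) "b3 + 1 = b2 + m1" "odd b3"
        | (g) "b3 + 1 = b2 + m1" "even b3" | (h) "b3 = b2 + m1"
        using cases(5) by blast
      then show ?thesis
      proof cases
        case e
        have "admissible m1 m2 (b1 - 2, b2 - 2, b3, b4)" using adm two d e by (auto)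
        moreover have "(b1 - 2, b2 - 2, b3, b4) + (2, 2, 0, 0) = b" unfolding b using two d e by auto
        ultimately show ?thesis using Suc.IH[of "(b1 - 2, b2 - 2, b3, b4)"] detects_wedge(8)[of _ "(b1 - 2, b2 - 2, b3, b4)"]
          unfolding hw by (auto simp del: add_Pair)
      next
        case f
        obtain k where k: "b3 = 2 * k + 1" using f(2) by (rule oddE)
        have "admissible m1 m2 (b1 - 2, b2 - 2, b3 - 1, b4)" using adm two d f k by (auto)
        moreover have "(b1 - 2, b2 - 2, b3 - 1, b4) + (2, 2, 1, 0) = b" unfolding b using two d f k by auto
        moreover have "even (b3 - 1)" using two d f k by auto
        ultimately show ?thesis using Suc.IH[of "(b1 - 2, b2 - 2, b3 - 1, b4)"] detects_wedge(9)[of _ "(b1 - 2, b2 - 2, b3 - 1, b4)"]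
          unfolding hw by (auto simp del: add_Pair)
      next
        \<comment> \<open>Splitting off a single \<open>f2\<close> would leave an odd third entry,
          so two are taken. The bound on \<open>b4\<close> survives because half of the new entry is
          \<open>k - 1\<close>, which is at least \<open>m1\<close>.\<close>
        case g
        obtain k where k: "b3 = 2 * k" using g(2) by (rule evenE)
        have "(b3 - 2) div 2 = k - 1" unfolding k by (cases k) auto
        moreover have k1: "k \<ge> m1 + 1" using two d g k by linarith
        ultimately have "admissible m1 m2 (b1 - 2, b2 - 2, b3 - 2, b4)" using adm two d g by (auto)
        moreover have "b3 \<ge> 2" using k1 k by simp
        then have "(b1 - 2, b2 - 2, b3 - 2, b4) + (2, 2, 2, 0) = b" unfolding b using two d g by auto
        ultimately show ?thesis using Suc.IH[of "(b1 - 2, b2 - 2, b3 - 2, b4)"] detects_wedge(10)[of _ "(b1 - 2, b2 - 2, b3 - 2, b4)"]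
          unfolding hw by (auto simp del: add_Pair)
      next
        case h
        have "admissible m1 m2 (b1 - 2, b2 - 2, b3 - 2, b4)" using adm two d h by (auto)
        moreover have "(b1 - 2, b2 - 2, b3 - 2, b4) + (2, 2, 2, 0) = b" unfolding b using two d h by auto
        ultimately show ?thesis using Suc.IH[of "(b1 - 2, b2 - 2, b3 - 2, b4)"] detects_wedge(10)[of _ "(b1 - 2, b2 - 2, b3 - 2, b4)"]
          unfolding hw by (auto simp del: add_Pair)
      qed
    qed
  qed
qed

text \<open>Among the exponents with nonzero coefficient, one with \<open>b1 + b2\<close> minimal is
  chosen. Everything else that its pivot word sees is dominated by it and has a strictly smaller
  sum, so only its own term remains.\<close>

lemma verma_tensor_independent:
  assumes fin: "finite B" "B \<subseteq> {b. admissible m1 m2 b}"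
    and zero: "(\<Sum>b\<in>B. tscale (k b) (verma b (hw_tensor m1 m2))) = 0"
  shows "\<forall>b\<in>B. k b = 0"
proof (rule ccontr)
  assume "\<not> (\<forall>b\<in>B. k b = 0)"
  define A where "A = {b \<in> B. k b \<noteq> 0}"
  have "finite A" "A \<noteq> {}" using \<open>\<not> _\<close> fin by (auto simp: A_def)
  define depth :: "exponents \<Rightarrow> nat" where "depth b = fst b + fst (snd b)" for b
  obtain a where a: "a \<in> A" "\<And>b. b \<in> A \<Longrightarrow> depth a \<le> depth b"
    using arg_min_if_finite[OF \<open>finite A\<close> \<open>A \<noteq> {}\<close>, of depth] by (metis not_le)
  obtain W where W: "detects W a (hw_tensor m1 m2)"
    using detecting_word[of m1 m2 a] a(1) fin unfolding A_def by blast
  have "verma b (hw_tensor m1 m2) W = 0" if "b \<in> A" "b \<noteq> a" for b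
  proof (rule ccontr)
    assume "verma b (hw_tensor m1 m2) W \<noteq> 0"
    then have "dominates a b" using W unfolding detects_def by blast
    then show False using a(2)[OF that(1)] that(2) by (cases a; cases b) (auto simp: depth_def)
  qed
  then have "(\<Sum>b\<in>B. k b * verma b (hw_tensor m1 m2) W) = (\<Sum>b\<in>{a}. k b * verma b (hw_tensor m1 m2) W)"
    using fin(1) a(1) by (intro sum.mono_neutral_right) (auto simp: A_def)
  moreover have "(\<Sum>b\<in>B. k b * verma b (hw_tensor m1 m2) W) = (\<Sum>b\<in>B. tscale (k b) (verma b (hw_tensor m1 m2))) W"
    using fin(1) by (induction B rule: finite_induct) auto
  ultimately have "k a * verma a (hw_tensor m1 m2) W = 0" using zero by simp
  then show False using a(1) W by (auto simp: A_def detects_def)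
qed

section \<open>Kashiwara-Nakashima tableaux\<close>

text \<open>
  A weakly increasing row is determined by the positions \<open>p\<^sub>1 \<le> p\<^sub>2 \<le> p\<^sub>3 \<le> p\<^sub>4\<close> of the last
  entry that is at most 1, 2, 0 and \<open>TwoBar\<close>.
\<close>

definition row :: "nat \<Rightarrow> nat \<Rightarrow> nat \<Rightarrow> nat \<Rightarrow> nat \<Rightarrow> letter" where
  "row p1 p2 p3 p4 j = (if j \<le> p1 then One else if j \<le> p2 then Two else if j \<le> p3 then Zero
    else if j \<le> p4 then TwoBar else OneBar)"

text \<open>The second row has first position 0 because strict columns exclude the letter 1
  there.\<close>

definition tableau :: "nat \<Rightarrow> nat \<Rightarrow> nat \<Rightarrow> nat \<Rightarrow> nat \<Rightarrow> nat \<Rightarrow> nat \<Rightarrow> nat \<Rightarrow> nat \<Rightarrow> nat \<times> nat \<Rightarrow> letter" where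
  "tableau l1 l2 p1 p2 p3 p4 r2 r3 r4 = restrict
    (\<lambda>(i, j). if i = 1 then row p1 p2 p3 p4 j else row 0 r2 r3 r4 j) (young_diagram l1 l2)"

definition row_bounds :: "nat \<Rightarrow> nat \<Rightarrow> nat \<Rightarrow> nat \<Rightarrow> nat \<Rightarrow> bool" where
  "row_bounds l p1 p2 p3 p4 \<longleftrightarrow> p1 \<le> p2 \<and> p2 \<le> p3 \<and> p3 \<le> p4 \<and> p4 \<le> l \<and> p3 \<le> p2 + 1"

text \<open>Rows increase, so it is enough to look at the ends of the blocks of equal letters in the
  second row. A 2 stands below a 1; a 0 below a letter up to 0; \<open>TwoBar\<close> below a letter
  up to 0, and by the rule on adjacent columns the column to its left starts with 1;
  \<open>OneBar\<close> below neither \<open>OneBar\<close> nor 1.\<close>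

definition KN_bounds :: "nat \<Rightarrow> nat \<Rightarrow> nat \<Rightarrow> nat \<Rightarrow> nat \<Rightarrow> nat \<Rightarrow> nat \<Rightarrow> nat \<Rightarrow> bool" where
  "KN_bounds l2 p1 p2 p3 p4 r2 r3 r4 \<longleftrightarrow> r2 \<le> p1 \<and> (r2 < r3 \<longrightarrow> r3 \<le> p3) \<and>
    (r3 < r4 \<longrightarrow> r4 \<le> p3 \<and> r4 \<le> p1 + 1) \<and> (r4 < l2 \<longrightarrow> l2 \<le> p4 \<and> p1 \<le> r4)"

lemmas letter_order = less_eq_letter_def less_letter_def

lemma young_diagram_rows:
  "(1, j) \<in> young_diagram l1 l2 \<longleftrightarrow> 1 \<le> j \<and> j \<le> l1"
  "(2, j) \<in> young_diagram l1 l2 \<longleftrightarrow> 1 \<le> j \<and> j \<le> l2"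
  "(Suc 0, j) \<in> young_diagram l1 l2 \<longleftrightarrow> 1 \<le> j \<and> j \<le> l1"
  by (auto simp: young_diagram_def)

lemma tableau_apply:
  "1 \<le> j \<Longrightarrow> j \<le> l1 \<Longrightarrow> tableau l1 l2 p1 p2 p3 p4 r2 r3 r4 (1, j) = row p1 p2 p3 p4 j"
  "1 \<le> j \<Longrightarrow> j \<le> l2 \<Longrightarrow> tableau l1 l2 p1 p2 p3 p4 r2 r3 r4 (2, j) = row 0 r2 r3 r4 j"
  "1 \<le> j \<Longrightarrow> j \<le> l1 \<Longrightarrow> tableau l1 l2 p1 p2 p3 p4 r2 r3 r4 (Suc 0, j) = row p1 p2 p3 p4 j"
  by (auto simp: tableau_def young_diagram_def)

section \<open>Tableaux in terms of row positions\<close>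

lemma KN_tableaux_iff:
  assumes "l2 \<le> l1"
  shows "T \<in> KN_tableaux l1 l2 \<longleftrightarrow> T \<in> young_diagram l1 l2 \<rightarrow>\<^sub>E UNIV \<and>
    (\<forall>j j'. 1 \<le> j \<longrightarrow> j < j' \<longrightarrow> j' \<le> l1 \<longrightarrow> T (1, j) \<le> T (1, j') \<and> \<not> (T (1, j) = Zero \<and> T (1, j') = Zero)) \<and>
    (\<forall>j j'. 1 \<le> j \<longrightarrow> j < j' \<longrightarrow> j' \<le> l2 \<longrightarrow> T (2, j) \<le> T (2, j') \<and> \<not> (T (2, j) = Zero \<and> T (2, j') = Zero)) \<and>
    (\<forall>j. 1 \<le> j \<longrightarrow> j \<le> l2 \<longrightarrow> (T (1, j) < T (2, j) \<or> T (1, j) = Zero \<and> T (2, j) = Zero) \<and>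
      \<not> (T (1, j) = One \<and> T (2, j) = OneBar)) \<and>
    (\<forall>j. 1 \<le> j \<longrightarrow> j + 1 \<le> l2 \<longrightarrow> T (2, j + 1) = TwoBar \<longrightarrow> T (1, j) \<noteq> Two \<and> T (1, j) \<noteq> Zero)"
  (is "_ \<longleftrightarrow> ?E \<and> ?R1 \<and> ?R2 \<and> ?C \<and> ?D")
proof
  assume T: "T \<in> KN_tableaux l1 l2"
  have E: "?E" using T by (simp add: KN_tableaux_def)
  have R: "\<And>i j j'. (i, j) \<in> young_diagram l1 l2 \<Longrightarrow> (i, j') \<in> young_diagram l1 l2 \<Longrightarrow> j < j' \<Longrightarrow>
      T (i, j) \<le> T (i, j') \<and> \<not> (T (i, j) = Zero \<and> T (i, j') = Zero)"
    and C: "\<And>i i' j. (i, j) \<in> young_diagram l1 l2 \<Longrightarrow> (i', j) \<in> young_diagram l1 l2 \<Longrightarrow> i < i' \<Longrightarrow>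
      T (i, j) < T (i', j) \<or> (T (i, j) = Zero \<and> T (i', j) = Zero)"
    and O: "\<And>i i' j. (i, j) \<in> young_diagram l1 l2 \<Longrightarrow> (i', j) \<in> young_diagram l1 l2 \<Longrightarrow>
      \<not> (T (i, j) = One \<and> T (i', j) = OneBar)"
    and D: "\<And>j. (1, j) \<in> young_diagram l1 l2 \<Longrightarrow> (2, j + 1) \<in> young_diagram l1 l2 \<Longrightarrow>
      \<not> (T (1, j) = Two \<and> T (2, j + 1) = TwoBar) \<and> \<not> (T (1, j) = Zero \<and> T (2, j + 1) = TwoBar)"
    using T unfolding KN_tableaux_def by blast+
  have "?R1" using R[of 1] by (simp add: young_diagram_rows)
  moreover have "?R2" using R[of 2] by (simp add: young_diagram_rows)
  moreover have "?C" using C[of 1 _ 2] O[of 1 _ 2] assms by (simp add: young_diagram_rows)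
  moreover have "?D" using D assms by (auto simp: young_diagram_rows)
  ultimately show "?E \<and> ?R1 \<and> ?R2 \<and> ?C \<and> ?D" using E by blast
next
  assume *: "?E \<and> ?R1 \<and> ?R2 \<and> ?C \<and> ?D"
  then have E: ?E and R1: ?R1 and R2: ?R2 and C: ?C and D: ?D by blast+
  have rows: "i = 1 \<or> i = 2" if "(i, j) \<in> young_diagram l1 l2" for i j
    using that by (auto simp: young_diagram_def)
  show "T \<in> KN_tableaux l1 l2"
    unfolding KN_tableaux_def
  proof (intro CollectI conjI E allI impI)
    fix i j j' assume "(i, j) \<in> young_diagram l1 l2" "(i, j') \<in> young_diagram l1 l2" "j < j'"
    then show "T (i, j) \<le> T (i, j')" "\<not> (T (i, j) = Zero \<and> T (i, j') = Zero)"
      using R1 R2 rows[of i j] by (auto simp: young_diagram_rows)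
  next
    fix i i' j assume "(i, j) \<in> young_diagram l1 l2" "(i', j) \<in> young_diagram l1 l2" "i < i'"
    then show "T (i, j) < T (i', j) \<or> (T (i, j) = Zero \<and> T (i', j) = Zero)"
      using C rows[of i j] rows[of i' j] by (auto simp: young_diagram_rows)
  next
    fix i i' j assume "(i, j) \<in> young_diagram l1 l2" "(i', j) \<in> young_diagram l1 l2"
    then show "\<not> (T (i, j) = One \<and> T (i', j) = OneBar)"
      using C rows[of i j] rows[of i' j] by (auto simp: young_diagram_rows letter_order)
  next
    fix j assume "(1, j) \<in> young_diagram l1 l2" "(2, j + 1) \<in> young_diagram l1 l2"
    then show "\<not> (T (1, j) = Two \<and> T (2, j + 1) = TwoBar)" "\<not> (T (1, j) = Zero \<and> T (2, j + 1) = TwoBar)"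
      using D by (auto simp: young_diagram_rows)
  qed
qed

lemma row_mono:
  "row_bounds l p1 p2 p3 p4 \<Longrightarrow> j < j' \<Longrightarrow>
    row p1 p2 p3 p4 j \<le> row p1 p2 p3 p4 j' \<and> \<not> (row p1 p2 p3 p4 j = Zero \<and> row p1 p2 p3 p4 j' = Zero)"
  by (auto simp: row_def row_bounds_def letter_order)

lemma tableau_in_KN:
  assumes "l2 \<le> l1" "row_bounds l1 p1 p2 p3 p4" "row_bounds l2 0 r2 r3 r4" "KN_bounds l2 p1 p2 p3 p4 r2 r3 r4"
  shows "tableau l1 l2 p1 p2 p3 p4 r2 r3 r4 \<in> KN_tableaux l1 l2"
  unfolding KN_tableaux_iff[OF assms(1)]
proof (intro conjI allI impI)
  show "tableau l1 l2 p1 p2 p3 p4 r2 r3 r4 \<in> young_diagram l1 l2 \<rightarrow>\<^sub>E UNIV" by (simp add: tableau_def)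
qed (use assms row_mono[OF assms(2)] row_mono[OF assms(3)] in
    \<open>auto simp: tableau_apply simp del: One_nat_def,
     auto simp: row_def row_bounds_def KN_bounds_def letter_order split: if_splits\<close>)

lemma initial_segment:
  fixes g :: "nat \<Rightarrow> letter"
  assumes "\<And>j j'. 1 \<le> j \<Longrightarrow> j < j' \<Longrightarrow> j' \<le> l \<Longrightarrow> g j \<le> g j'" "1 \<le> j" "j \<le> l"
  shows "g j \<le> x \<longleftrightarrow> j \<le> card {i \<in> {1..l}. g i \<le> x}"
proof
  assume "g j \<le> x"
  then have "{1..j} \<subseteq> {i \<in> {1..l}. g i \<le> x}"
    using assms by (auto intro: order_trans) (metis le_neq_implies_less order_trans order_refl)
  then have "card {1..j} \<le> card {i \<in> {1..l}. g i \<le> x}" by (intro card_mono) auto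
  then show "j \<le> card {i \<in> {1..l}. g i \<le> x}" by simp
next
  assume *: "j \<le> card {i \<in> {1..l}. g i \<le> x}"
  show "g j \<le> x"
  proof (rule ccontr)
    assume "\<not> g j \<le> x"
    have "i < j" if "i \<in> {1..l}" "g i \<le> x" for i
    proof (rule ccontr)
      assume "\<not> i < j"
      then have "g j \<le> g i" using assms(1)[of j i] that assms(2) by (cases "i = j") auto
      then show False using that \<open>\<not> g j \<le> x\<close> by (meson order_trans)
    qed
    then have "{i \<in> {1..l}. g i \<le> x} \<subseteq> {1..<j}" by auto
    then have "card {i \<in> {1..l}. g i \<le> x} \<le> card {1..<j}" by (intro card_mono) auto
    then show False using * assms(2) by simp
  qed
qed

definition threshold :: "nat \<Rightarrow> (nat \<Rightarrow> letter) \<Rightarrow> letter \<Rightarrow> nat" where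
  "threshold l g x = card {i \<in> {1..l}. g i \<le> x}"

lemma row_threshold:
  assumes "\<And>j j'. 1 \<le> j \<Longrightarrow> j < j' \<Longrightarrow> j' \<le> l \<Longrightarrow> g j \<le> g j' \<and> \<not> (g j = Zero \<and> g j' = Zero)"
  shows "1 \<le> j \<Longrightarrow> j \<le> l \<Longrightarrow>
      g j = row (threshold l g One) (threshold l g Two) (threshold l g Zero) (threshold l g TwoBar) j"
    and "row_bounds l (threshold l g One) (threshold l g Two) (threshold l g Zero) (threshold l g TwoBar)"
proof -
  have seg: "g j \<le> x \<longleftrightarrow> j \<le> threshold l g x" if "1 \<le> j" "j \<le> l" for j x
    unfolding threshold_def using assms that by (intro initial_segment) auto
  show "g j = row (threshold l g One) (threshold l g Two) (threshold l g Zero) (threshold l g TwoBar) j"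
    if "1 \<le> j" "j \<le> l" for j
    unfolding row_def seg[OF that, symmetric] by (cases "g j") (simp_all add: letter_order)
  have mono: "threshold l g x \<le> threshold l g y" if "x \<le> y" for x y
    unfolding threshold_def using that by (intro card_mono) auto
  have bound: "threshold l g x \<le> l" for x
    unfolding threshold_def by (rule order_trans[OF card_mono[of "{1..l}"]]) auto
  have "threshold l g Zero \<le> threshold l g Two + 1"
  proof (rule ccontr)
    assume *: "\<not> ?thesis"
    define j where "j = threshold l g Two + 1"
    have j: "1 \<le> j" "j + 1 \<le> l" "j + 1 \<le> threshold l g Zero" "\<not> j \<le> threshold l g Two"
      using * bound[of Zero] by (auto simp: j_def)
    have "g j \<le> Zero" "\<not> g j \<le> Two" "g (j + 1) \<le> Zero" "\<not> g (j + 1) \<le> Two"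
      using j seg[of j] seg[of "j + 1"] by auto
    then have "g j = Zero" "g (j + 1) = Zero"
      by ((cases "g j"; simp add: letter_order), (cases "g (Suc j)"; simp add: letter_order))
    then show False using assms[of j "j + 1"] j by simp
  qed
  then show "row_bounds l (threshold l g One) (threshold l g Two) (threshold l g Zero) (threshold l g TwoBar)"
    unfolding row_bounds_def using bound by (auto intro!: mono simp: letter_order)
qed

lemma threshold_row:
  assumes "row_bounds l p1 p2 p3 p4"
  shows "threshold l (row p1 p2 p3 p4) One = p1" "threshold l (row p1 p2 p3 p4) Two = p2"
    "threshold l (row p1 p2 p3 p4) Zero = p3" "threshold l (row p1 p2 p3 p4) TwoBar = p4"
proof -
  have "{i \<in> {1..l}. row p1 p2 p3 p4 i \<le> One} = {1..p1}" "{i \<in> {1..l}. row p1 p2 p3 p4 i \<le> Two} = {1..p2}"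
    "{i \<in> {1..l}. row p1 p2 p3 p4 i \<le> Zero} = {1..p3}" "{i \<in> {1..l}. row p1 p2 p3 p4 i \<le> TwoBar} = {1..p4}"
    using assms by (auto simp: row_bounds_def row_def letter_order split: if_splits)
  then show "threshold l (row p1 p2 p3 p4) One = p1" "threshold l (row p1 p2 p3 p4) Two = p2"
    "threshold l (row p1 p2 p3 p4) Zero = p3" "threshold l (row p1 p2 p3 p4) TwoBar = p4"
    by (simp_all add: threshold_def)
qed

lemma threshold_cong: "(\<And>j. 1 \<le> j \<Longrightarrow> j \<le> l \<Longrightarrow> g j = h j) \<Longrightarrow> threshold l g x = threshold l h x"
  unfolding threshold_def by (intro arg_cong[of _ _ card]) auto

lemma KN_as_tableau:
  assumes "l2 \<le> l1" "T \<in> KN_tableaux l1 l2"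
  obtains p1 p2 p3 p4 r2 r3 r4 where "T = tableau l1 l2 p1 p2 p3 p4 r2 r3 r4"
    "row_bounds l1 p1 p2 p3 p4" "row_bounds l2 0 r2 r3 r4" "KN_bounds l2 p1 p2 p3 p4 r2 r3 r4"
proof -
  note T = assms(2)[unfolded KN_tableaux_iff[OF assms(1)]]
  define g where "g i j = T (i, j)" for i j
  define p where "p x = threshold l1 (g 1) x" for x
  define r where "r x = threshold l2 (g 2) x" for x
  have g1: "g 1 j = row (p One) (p Two) (p Zero) (p TwoBar) j" if "1 \<le> j" "j \<le> l1" for j
    unfolding p_def using that T by (intro row_threshold(1)) (auto simp: g_def)
  have p: "row_bounds l1 (p One) (p Two) (p Zero) (p TwoBar)"
    unfolding p_def using T by (intro row_threshold(2)) (auto simp: g_def)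
  have g2: "g 2 j = row (r One) (r Two) (r Zero) (r TwoBar) j" if "1 \<le> j" "j \<le> l2" for j
    unfolding r_def using that T by (intro row_threshold(1)) (auto simp: g_def)
  have r: "row_bounds l2 (r One) (r Two) (r Zero) (r TwoBar)"
    unfolding r_def using T by (intro row_threshold(2)) (auto simp: g_def)
  have col: "g 1 j < g 2 j \<or> g 1 j = Zero \<and> g 2 j = Zero" "\<not> (g 1 j = One \<and> g 2 j = OneBar)"
    if "1 \<le> j" "j \<le> l2" for j
    using T that by (auto simp: g_def)
  have adj: "\<not> (g 1 j = Two \<or> g 1 j = Zero)" if "1 \<le> j" "j + 1 \<le> l2" "g 2 (j + 1) = TwoBar" for j
    using T that by (auto simp: g_def)
  \<comment> \<open>A 1 in the second row would have no smaller letter above it.\<close>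
  have "r One = 0"
  proof (rule ccontr)
    assume "r One \<noteq> 0"
    then have "g 2 1 = One" using g2[of 1] r by (auto simp: row_def row_bounds_def)
    then show False using col[of 1] \<open>r One \<noteq> 0\<close> r
      by (auto simp: row_bounds_def letter_order)
  qed
  note g2 = g2[unfolded this] and r = r[unfolded this]
  have cols: "row (p One) (p Two) (p Zero) (p TwoBar) j < row 0 (r Two) (r Zero) (r TwoBar) j \<or>
      row (p One) (p Two) (p Zero) (p TwoBar) j = Zero \<and> row 0 (r Two) (r Zero) (r TwoBar) j = Zero"
    "\<not> (row (p One) (p Two) (p Zero) (p TwoBar) j = One \<and> row 0 (r Two) (r Zero) (r TwoBar) j = OneBar)"
    if "1 \<le> j" "j \<le> l2" for j
    using col[OF that] g1[of j] g2[of j] that assms(1) by auto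
  have "KN_bounds l2 (p One) (p Two) (p Zero) (p TwoBar) (r Two) (r Zero) (r TwoBar)"
    unfolding KN_bounds_def
  proof (intro conjI impI)
    show "r Two \<le> p One"
      using cols[of "r Two"] r p by (cases "r Two = 0") (auto simp: row_def row_bounds_def letter_order split: if_splits)
    show "r Zero \<le> p Zero" if "r Two < r Zero"
      using cols[of "r Zero"] r p that by (auto simp: row_def row_bounds_def letter_order split: if_splits)
    show "r TwoBar \<le> p Zero" if "r Zero < r TwoBar"
      using cols[of "r TwoBar"] r p that by (auto simp: row_def row_bounds_def letter_order split: if_splits)
    then have p3: "r TwoBar \<le> p Zero" if "r Zero < r TwoBar" using that .
    show "r TwoBar \<le> p One + 1" if "r Zero < r TwoBar"
    proof (rule ccontr)
      assume *: "\<not> ?thesis"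
      \<comment> \<open>The column to the left of the last \<open>TwoBar\<close> of the second row:
        it would start with 2 or 0, against the rule on adjacent columns.\<close>
      define j where "j = r TwoBar - 1"
      have j: "1 \<le> j" "j + 1 = r TwoBar" "j + 1 \<le> l2" "p One < j" "j \<le> p Zero"
        using * r p3[OF that] by (auto simp: j_def row_bounds_def)
      have "g 2 (j + 1) = TwoBar" using g2[of "j + 1"] j that r by (auto simp: row_def row_bounds_def)
      moreover have "g 1 j = Two \<or> g 1 j = Zero"
        using g1[of j] j assms(1) by (auto simp: row_def)
      ultimately show False using adj[of j] j by blast
    qed
    show "l2 \<le> p TwoBar" if "r TwoBar < l2"
      using cols[of l2] r p that by (auto simp: row_def row_bounds_def letter_order split: if_splits)
    show "p One \<le> r TwoBar" if "r TwoBar < l2"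
      using cols[of "r TwoBar + 1"] r p that by (auto simp: row_def row_bounds_def letter_order split: if_splits)
  qed
  moreover have "T = tableau l1 l2 (p One) (p Two) (p Zero) (p TwoBar) (r Two) (r Zero) (r TwoBar)"
  proof
    fix x :: "nat \<times> nat"
    obtain i j where x: "x = (i, j)" by (cases x)
    show "T x = tableau l1 l2 (p One) (p Two) (p Zero) (p TwoBar) (r Two) (r Zero) (r TwoBar) x"
    proof (cases "x \<in> young_diagram l1 l2")
      case True
      then show ?thesis using g1[of j] g2[of j] by (auto simp: x young_diagram_def tableau_def g_def)
    next
      case False
      moreover have "T x = undefined" using T False by (auto intro: PiE_arb)
      ultimately show ?thesis by (simp add: tableau_def)
    qed
  qed
  ultimately show ?thesis using that p r by blast
qed

text \<open>The number of 1 in the first row. If the excess \<open>b2 - m1\<close> is odd, its extra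
  unit is charged to the first row, hence the rounding up.\<close>

fun ones :: "nat \<Rightarrow> nat \<Rightarrow> nat \<Rightarrow> nat" where
  "ones m1 m2 b2 = (if b2 \<le> m1 then m1 + m2 - b2 else m2 - (b2 - m1 + 1) div 2)"

text \<open>
  The entries of the first row that exceed 1 encode \<open>b3\<close> and \<open>b4\<close>. For \<open>b2 \<le> m1\<close> there are \<open>b2\<close>
  of them; otherwise the excess \<open>b2 - m1\<close> is split evenly between the columns that do not start
  with 1 and the entries \<open>OneBar\<close> of the second row.
\<close>

fun tableau_of :: "nat \<Rightarrow> nat \<Rightarrow> exponents \<Rightarrow> nat \<times> nat \<Rightarrow> letter" where
  "tableau_of m1 m2 (b1, b2, b3, b4) = tableau (m1 + m2) m2
    (ones m1 m2 b2) (m1 + m2 - b3 div 2 - b3 mod 2) (m1 + m2 - b3 div 2) (m1 + m2 - b4)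
    (m2 - b1 div 2 - b1 mod 2) (m2 - b1 div 2) (m2 - (b2 - m1) div 2)"

text \<open>The test \<open>m2 \<le> p One\<close> recognizes \<open>b2 \<le> m1\<close>: then every
  column of height two starts with 1 and the second row has no \<open>OneBar\<close>.\<close>

definition exponents_of :: "nat \<Rightarrow> nat \<Rightarrow> (nat \<times> nat \<Rightarrow> letter) \<Rightarrow> exponents" where
  "exponents_of m1 m2 T =
    (let p = threshold (m1 + m2) (\<lambda>j. T (1, j)); r = threshold m2 (\<lambda>j. T (2, j)) in
     (2 * (m2 - r Zero) + (r Zero - r Two),
      if m2 \<le> p One then m1 + m2 - p One else m1 + (m2 - p One) + (m2 - r TwoBar),
      2 * (m1 + m2 - p Zero) + (p Zero - p Two), m1 + m2 - p TwoBar))"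

text \<open>\<open>s\<close> and \<open>t\<close> count the letters beyond 0, and \<open>o'\<close>
  and \<open>u\<close> the zeros, in the second and first row: a letter beyond 0 stands for two
  steps of \<open>f2\<close>, a 0 for one. \<open>w\<close> counts \<open>OneBar\<close> in the
  second row, \<open>x\<close> is the parity of the excess \<open>b2 - m1\<close>. Truncated
  differences are restated as sums so that linear arithmetic applies.\<close>

lemma admissible_parameters:
  assumes "admissible m1 m2 (b1, b2, b3, b4)"
  obtains s o' t u w x p1 p2 p4 r2 r4 where
    "b1 div 2 = s" "b1 mod 2 = o'" "b1 = 2 * s + o'" "o' \<le> 1"
    "b3 div 2 = t" "b3 mod 2 = u" "b3 = 2 * t + u" "u \<le> 1"
    "m1 + m2 = p2 + u + t" "m1 + m2 = p4 + b4" "m2 = r2 + o' + s" "m2 = r4 + w"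
    "(b2 - m1) div 2 = w" "ones m1 m2 b2 = p1"
    "b2 \<le> m1 \<and> w = 0 \<and> p1 + b2 = m1 + m2 \<or>
     b2 = m1 + 2 * w + x \<and> w + x > 0 \<and> p1 + w + x = m2 \<and> t + u \<le> m1 + w + x \<and> t \<le> m1 + w"
    "x \<le> 1" "t + u \<le> b2" "w \<le> s" "w + x \<le> s + o'" "b4 \<le> m1" "b4 \<le> t"
proof -
  define s o' t u w x where "s = b1 div 2" and "o' = b1 mod 2" and "t = b3 div 2" and "u = b3 mod 2"
    and "w = (b2 - m1) div 2" and "x = (b2 - m1) mod 2"
  have div: "b1 = 2 * s + o'" "o' \<le> 1" "b3 = 2 * t + u" "u \<le> 1" "b2 - m1 = 2 * w + x" "x \<le> 1"
    by (auto simp: s_def o'_def t_def u_def w_def x_def)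
  have adm: "b1 \<le> 2 * m2" "b2 \<le> m1 + b1" "b3 \<le> b2 + m1" "b3 \<le> 2 * b2" "b4 \<le> m1" "b4 \<le> t"
    using assms by (auto simp: t_def)
  have h: "t + u \<le> b2" "s + o' \<le> m2" using div adm by presburger+
  have q: "2 * w + x \<le> 2 * s + o'" using div(1,5) adm(2) by linarith
  have h': "w \<le> s" "w + x \<le> s + o'" using q div(2,6) by presburger+
  have half: "(b2 - m1 + 1) div 2 = w + x"
    unfolding div(5) using div(6) by (cases "x = 0") auto
  have cases: "b2 \<le> m1 \<and> w = 0 \<or> b2 = m1 + 2 * w + x \<and> w + x > 0" "b2 \<le> m1 \<Longrightarrow> x = 0"
    using div(5) by (cases "b2 \<le> m1"; auto)+
  have h'': "t + u \<le> m1 + w + x \<and> t \<le> m1 + w" if "b2 = m1 + 2 * w + x"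
  proof -
    have "2 * t + u \<le> 2 * m1 + 2 * w + x" using that adm(3) div(3) by linarith
    then show ?thesis using div(4,6) by presburger
  qed
  have "t + u \<le> m1 + m2" using cases(1) h h' h'' by (elim disjE conjE) linarith+
  then have p2: "m1 + m2 = (m1 + m2 - u - t) + u + t" by linarith
  have p4: "m1 + m2 = (m1 + m2 - b4) + b4" using adm(5) by linarith
  have r: "m2 = (m2 - o' - s) + o' + s" "m2 = (m2 - w) + w" using h h' by linarith+
  have "b2 \<le> m1 \<and> w = 0 \<and> ones m1 m2 b2 + b2 = m1 + m2 \<or>
     b2 = m1 + 2 * w + x \<and> w + x > 0 \<and> ones m1 m2 b2 + w + x = m2 \<and> t + u \<le> m1 + w + x \<and> t \<le> m1 + w"
    using cases h h' h'' half by (cases "b2 \<le> m1") auto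
  from that[OF s_def[symmetric] o'_def[symmetric] div(1,2) t_def[symmetric] u_def[symmetric] div(3,4)
      p2 p4 r w_def[symmetric] refl this div(6) h(1) h' adm(5,6)]
  show ?thesis .
qed

lemma tableau_of_bounds:
  assumes "admissible m1 m2 (b1, b2, b3, b4)"
  shows "row_bounds (m1 + m2) (ones m1 m2 b2) (m1 + m2 - b3 div 2 - b3 mod 2) (m1 + m2 - b3 div 2)
      (m1 + m2 - b4)"
    "row_bounds m2 0 (m2 - b1 div 2 - b1 mod 2) (m2 - b1 div 2) (m2 - (b2 - m1) div 2)"
    "KN_bounds m2 (ones m1 m2 b2) (m1 + m2 - b3 div 2 - b3 mod 2) (m1 + m2 - b3 div 2) (m1 + m2 - b4)
      (m2 - b1 div 2 - b1 mod 2) (m2 - b1 div 2) (m2 - (b2 - m1) div 2)"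
  using assms
proof (atomize (full), rule admissible_parameters)
  fix s o' t u w x p1 p2 p4 r2 r4
  assume *: "b1 div 2 = s" "b1 mod 2 = o'" "b1 = 2 * s + o'" "o' \<le> 1"
    "b3 div 2 = t" "b3 mod 2 = u" "b3 = 2 * t + u" "u \<le> 1"
    "m1 + m2 = p2 + u + t" "m1 + m2 = p4 + b4" "m2 = r2 + o' + s" "m2 = r4 + w"
    "(b2 - m1) div 2 = w" "ones m1 m2 b2 = p1"
    and **: "b2 \<le> m1 \<and> w = 0 \<and> p1 + b2 = m1 + m2 \<or>
     b2 = m1 + 2 * w + x \<and> w + x > 0 \<and> p1 + w + x = m2 \<and> t + u \<le> m1 + w + x \<and> t \<le> m1 + w"
    "x \<le> 1" "t + u \<le> b2" "w \<le> s" "w + x \<le> s + o'" "b4 \<le> m1" "b4 \<le> t"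
  have sub: "m1 + m2 - t - u = p2" "m1 + m2 - t = p2 + u" "m1 + m2 - b4 = p4" "m2 - s - o' = r2"
    "m2 - s = r2 + o'" "m2 - w = r4" "p2 + u - u = p2" "r2 + o' - o' = r2"
    using *(9-12) by simp_all
  have "row_bounds (m1 + m2) p1 p2 (p2 + u) p4 \<and> row_bounds m2 0 r2 (r2 + o') r4 \<and>
      KN_bounds m2 p1 p2 (p2 + u) p4 r2 (r2 + o') r4"
    unfolding row_bounds_def KN_bounds_def
    using *(3,4,7-12) ** by (elim disjE conjE) (intro conjI impI; linarith)+
  then show "row_bounds (m1 + m2) (ones m1 m2 b2) (m1 + m2 - b3 div 2 - b3 mod 2) (m1 + m2 - b3 div 2)
      (m1 + m2 - b4) \<and>
    row_bounds m2 0 (m2 - b1 div 2 - b1 mod 2) (m2 - b1 div 2) (m2 - (b2 - m1) div 2) \<and>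
    KN_bounds m2 (ones m1 m2 b2) (m1 + m2 - b3 div 2 - b3 mod 2) (m1 + m2 - b3 div 2) (m1 + m2 - b4)
      (m2 - b1 div 2 - b1 mod 2) (m2 - b1 div 2) (m2 - (b2 - m1) div 2)"
    by (simp only: *(1,2,5,6,13,14) sub)
qed

lemma tableau_threshold:
  assumes "row_bounds l1 p1 p2 p3 p4" "row_bounds l2 0 r2 r3 r4"
  defines "T \<equiv> tableau l1 l2 p1 p2 p3 p4 r2 r3 r4"
  shows "threshold l1 (\<lambda>j. T (1, j)) One = p1" "threshold l1 (\<lambda>j. T (1, j)) Two = p2"
    "threshold l1 (\<lambda>j. T (1, j)) Zero = p3" "threshold l1 (\<lambda>j. T (1, j)) TwoBar = p4"
    "threshold l2 (\<lambda>j. T (2, j)) Two = r2" "threshold l2 (\<lambda>j. T (2, j)) Zero = r3"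
    "threshold l2 (\<lambda>j. T (2, j)) TwoBar = r4"
proof -
  have "threshold l1 (\<lambda>j. T (1, j)) x = threshold l1 (row p1 p2 p3 p4) x"
    "threshold l2 (\<lambda>j. T (2, j)) x = threshold l2 (row 0 r2 r3 r4) x" for x
    unfolding T_def
    by (rule threshold_cong, rule tableau_apply(1), assumption+)
      (rule threshold_cong, rule tableau_apply(2), assumption+)
  then show "threshold l1 (\<lambda>j. T (1, j)) One = p1" "threshold l1 (\<lambda>j. T (1, j)) Two = p2"
    "threshold l1 (\<lambda>j. T (1, j)) Zero = p3" "threshold l1 (\<lambda>j. T (1, j)) TwoBar = p4"
    "threshold l2 (\<lambda>j. T (2, j)) Two = r2" "threshold l2 (\<lambda>j. T (2, j)) Zero = r3"
    "threshold l2 (\<lambda>j. T (2, j)) TwoBar = r4"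
    using threshold_row[OF assms(1)] threshold_row[OF assms(2)] by (simp_all only:)
qed

lemma exponents_of_tableau_of:
  assumes "admissible m1 m2 (b1, b2, b3, b4)"
  shows "exponents_of m1 m2 (tableau_of m1 m2 (b1, b2, b3, b4)) = (b1, b2, b3, b4)"
  using assms
proof (rule admissible_parameters)
  note bounds = tableau_of_bounds[OF assms]
  fix s o' t u w x p1 p2 p4 r2 r4
  assume *: "b1 div 2 = s" "b1 mod 2 = o'" "b1 = 2 * s + o'" "o' \<le> 1"
    "b3 div 2 = t" "b3 mod 2 = u" "b3 = 2 * t + u" "u \<le> 1"
    "m1 + m2 = p2 + u + t" "m1 + m2 = p4 + b4" "m2 = r2 + o' + s" "m2 = r4 + w"
    "(b2 - m1) div 2 = w" "ones m1 m2 b2 = p1"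
    and **: "b2 \<le> m1 \<and> w = 0 \<and> p1 + b2 = m1 + m2 \<or>
     b2 = m1 + 2 * w + x \<and> w + x > 0 \<and> p1 + w + x = m2 \<and> t + u \<le> m1 + w + x \<and> t \<le> m1 + w"
  have sub: "m1 + m2 - t - u = p2" "m1 + m2 - t = p2 + u" "m1 + m2 - b4 = p4" "m2 - s - o' = r2"
    "m2 - s = r2 + o'" "m2 - w = r4" "p2 + u - u = p2" "r2 + o' - o' = r2"
    using *(9-12) by simp_all
  have sub2: "m2 - (r2 + o') = s" "r2 + o' - r2 = o'" "m1 + m2 - (p2 + u) = t" "p2 + u - p2 = u"
    "m1 + m2 - p4 = b4" "m2 - r4 = w"
    using *(9-12) by simp_all
  have b2: "(if m2 \<le> p1 then m1 + m2 - p1 else m1 + (m2 - p1) + w) = b2"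
    using ** by (elim disjE conjE) auto
  show ?thesis
    unfolding tableau_of.simps exponents_of_def Let_def *(1,2,5,6,13,14) sub
      tableau_threshold[OF bounds(1,2)[unfolded *(1,2,5,6,13,14) sub]]
    by (simp only: sub2 b2 *(3,7)[symmetric])
qed

lemma tableau_of_surjective:
  assumes "T \<in> KN_tableaux (m1 + m2) m2"
  shows "admissible m1 m2 (exponents_of m1 m2 T)" "tableau_of m1 m2 (exponents_of m1 m2 T) = T"
proof -
  obtain p1 p2 p3 p4 r2 r3 r4 where T: "T = tableau (m1 + m2) m2 p1 p2 p3 p4 r2 r3 r4"
    and rows: "row_bounds (m1 + m2) p1 p2 p3 p4" "row_bounds m2 0 r2 r3 r4"
    and KN: "KN_bounds m2 p1 p2 p3 p4 r2 r3 r4"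
    using KN_as_tableau[OF _ assms] by (metis le_add2)
  have le: "p1 \<le> p2" "p2 \<le> p3" "p3 \<le> p4" "p4 \<le> m1 + m2" "p3 \<le> p2 + 1"
    "r2 \<le> r3" "r3 \<le> r4" "r4 \<le> m2" "r3 \<le> r2 + 1"
    using rows by (simp_all add: row_bounds_def)
  have KN: "r2 \<le> p1" "r2 < r3 \<Longrightarrow> r3 \<le> p3" "r3 < r4 \<Longrightarrow> r4 \<le> p3" "r3 < r4 \<Longrightarrow> r4 \<le> p1 + 1"
    "r4 < m2 \<Longrightarrow> m2 \<le> p4" "r4 < m2 \<Longrightarrow> p1 \<le> r4"
    using KN by (simp_all add: KN_bounds_def)
  define s o' t u w where "s = m2 - r3" and "o' = r3 - r2" and "t = m1 + m2 - p3"
    and "u = p3 - p2" and "w = m2 - r4"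
  define b1 b2 b3 b4 where "b1 = 2 * s + o'"
    and "b2 = (if m2 \<le> p1 then m1 + m2 - p1 else m1 + (m2 - p1) + w)"
    and "b3 = 2 * t + u" and "b4 = m1 + m2 - p4"
  have b: "exponents_of m1 m2 T = (b1, b2, b3, b4)"
    unfolding T exponents_of_def Let_def tableau_threshold[OF rows] b1_def b2_def b3_def b4_def
      s_def o'_def t_def u_def w_def ..
  have eqs: "m2 = s + r3" "r3 = o' + r2" "o' \<le> 1" "m1 + m2 = t + p3" "p3 = u + p2" "u \<le> 1"
    "m2 = w + r4" "m1 + m2 = b4 + p4"
    using le by (simp_all add: s_def o'_def t_def u_def w_def b4_def)
  have half: "b1 div 2 = s" "b1 mod 2 = o'" "b3 div 2 = t" "b3 mod 2 = u"
    using eqs(3,6) by (simp_all add: b1_def b3_def)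
  have cases: "m2 \<le> p1 \<and> w = 0 \<and> b2 \<le> m1 \<and> b2 + p1 = m1 + m2 \<and> ones m1 m2 b2 = p1 \<and> (b2 - m1) div 2 = w \<or>
    p1 < m2 \<and> (r4 = p1 \<or> r4 = p1 + 1) \<and> b2 + p1 = m1 + m2 + w \<and> ones m1 m2 b2 = p1 \<and> (b2 - m1) div 2 = w"
  proof (cases "m2 \<le> p1")
    case True
    then have "r4 = m2" using KN(6) le(8) by linarith
    then have "w = 0" using eqs(7) by simp
    moreover have "b2 + p1 = m1 + m2" using True le by (simp add: b2_def)
    moreover from this have "b2 \<le> m1" using True by linarith
    ultimately show ?thesis using True by auto
  next
    case False
    \<comment> \<open>This rigidity is what allows the single number \<open>b2\<close> to record
      both \<open>p1\<close> and \<open>r4\<close>: half of the excess, rounded up and rounded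
      down.\<close>
    have r4: "r4 = p1 \<or> r4 = p1 + 1"
    proof (cases "r4 < m2")
      case True
      then have "p1 \<le> r4" by (rule KN(6))
      moreover have "r4 \<le> p1 + 1" using KN(1,4) le(6,7,9) by linarith
      ultimately show ?thesis by linarith
    next
      case False
      then have "r4 = m2" using le(8) by linarith
      moreover have "r4 \<le> p1 + 1" using KN(1,4) le(6,7,9) by linarith
      ultimately show ?thesis using \<open>\<not> m2 \<le> p1\<close> by linarith
    qed
    obtain k where k: "m2 = p1 + k" "k > 0" using False by (metis add_diff_inverse_nat nat_le_linear not_le zero_less_diff)
    have b2: "b2 = m1 + k + w" using False k by (simp add: b2_def)
    have "w = k \<or> w + 1 = k" using r4 k eqs(7) by linarith
    then have "(k + w) div 2 = w" "(k + w + 1) div 2 = k" by auto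
    moreover have "\<not> b2 \<le> m1" "b2 - m1 = k + w" using b2 k(2) by simp_all
    ultimately show ?thesis using False r4 b2 k by simp
  qed
  have p3: "p1 + 1 \<le> p3" if "r4 = p1 + 1"
    using KN(2,3) that le(7) KN(1) by (cases "r3 < r4") linarith+
  have p4: "m2 \<le> p4" if "p1 < m2"
  proof (cases "r4 < m2")
    case False
    then have "r4 = p1 + 1" "r4 = m2" using cases that le(8) by linarith+
    then show ?thesis using p3 le(3) by linarith
  qed (rule KN(5))
  have "2 * s + o' \<le> 2 * m2" using eqs(1,2) by linarith
  moreover have "b4 \<le> t" using eqs(4,8) le(3) by linarith
  moreover have "b2 \<le> m1 + b1 \<and> 2 * t + u \<le> b2 + m1 \<and> 2 * t + u \<le> 2 * b2 \<and> b4 \<le> m1"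
    using cases
  proof (elim disjE conjE)
    assume *: "m2 \<le> p1" "b2 \<le> m1" "b2 + p1 = m1 + m2"
    have "t + u \<le> b2" using *(3) eqs(4,5) le(1) by linarith
    moreover have "b4 \<le> b2" using *(3) eqs(8) le(1,2,3) by linarith
    ultimately show ?thesis using *(2) by linarith
  next
    assume *: "p1 < m2" "r4 = p1" "b2 + p1 = m1 + m2 + w"
    have "b2 = m1 + 2 * w" using * eqs(7) by linarith
    moreover have "t + u \<le> m1 + w" using *(2) eqs(4,5,7) le(1) by linarith
    moreover have "b4 \<le> m1" using p4[OF *(1)] eqs(8) by linarith
    moreover have "w \<le> s" using eqs(1,7) le(7) by linarith
    ultimately show ?thesis unfolding b1_def by linarith
  next
    assume *: "p1 < m2" "r4 = p1 + 1" "b2 + p1 = m1 + m2 + w"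
    have "b2 = m1 + 2 * w + 1" using * eqs(7) by linarith
    moreover have "t + u \<le> m1 + w + 1" using *(2) eqs(4,5,7) le(1) by linarith
    moreover have "t \<le> m1 + w" using *(2) eqs(4,7) p3[OF *(2)] by linarith
    moreover have "b4 \<le> m1" using p4[OF *(1)] eqs(8) by linarith
    moreover have "w + 1 \<le> s + o'" using *(2) eqs(1,2,7) KN(1) by linarith
    moreover have "w \<le> s" using eqs(1,7) le(7) by linarith
    ultimately show ?thesis unfolding b1_def using eqs(3,6) by linarith
  qed
  ultimately show "admissible m1 m2 (exponents_of m1 m2 T)"
    unfolding b admissible.simps half min.bounded_iff unfolding b3_def b1_def by blast
  have ones: "ones m1 m2 b2 = p1" "(b2 - m1) div 2 = w" using cases by blast+
  have sub: "m2 - s = r3" "m2 - s - o' = r2" "m2 - w = r4" "m1 + m2 - t = p3" "m1 + m2 - t - u = p2"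
    "m1 + m2 - b4 = p4" "p3 - u = p2" "r3 - o' = r2"
    using eqs by simp_all
  show "tableau_of m1 m2 (exponents_of m1 m2 T) = T"
    unfolding b tableau_of.simps half ones sub by (rule T[symmetric])
qed

theorem tableau_of_bij:
  "bij_betw (tableau_of m1 m2) {b. admissible m1 m2 b} (KN_tableaux (m1 + m2) m2)"
proof (rule bij_betw_byWitness[where f' = "exponents_of m1 m2"])
  show "\<forall>b\<in>{b. admissible m1 m2 b}. exponents_of m1 m2 (tableau_of m1 m2 b) = b"
    using exponents_of_tableau_of by (metis mem_Collect_eq prod_cases4)
  show "tableau_of m1 m2 ` {b. admissible m1 m2 b} \<subseteq> KN_tableaux (m1 + m2) m2"
  proof (rule image_subsetI)
    fix b assume "b \<in> {b. admissible m1 m2 b}"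
    then obtain b1 b2 b3 b4 where b: "b = (b1, b2, b3, b4)" "admissible m1 m2 (b1, b2, b3, b4)"
      by (cases b) blast
    show "tableau_of m1 m2 b \<in> KN_tableaux (m1 + m2) m2"
      unfolding b(1) tableau_of.simps by (intro tableau_in_KN tableau_of_bounds[OF b(2)]) simp
  qed
qed (use tableau_of_surjective in blast)+

lemma letter_count_tableau:
  "letter_count l1 l2 (tableau l1 l2 p1 p2 p3 p4 r2 r3 r4) x =
    card {j \<in> {1..l1}. row p1 p2 p3 p4 j = x} + card {j \<in> {1..l2}. row 0 r2 r3 r4 j = x}"
proof -
  let ?A = "{j \<in> {1..l1}. row p1 p2 p3 p4 j = x}" and ?B = "{j \<in> {1..l2}. row 0 r2 r3 r4 j = x}"
  have "{b \<in> young_diagram l1 l2. tableau l1 l2 p1 p2 p3 p4 r2 r3 r4 b = x} =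
    Pair 1 ` ?A \<union> Pair 2 ` ?B"
    by (auto simp: young_diagram_def tableau_def)
  moreover have "card (Pair (1::nat) ` ?A \<union> Pair 2 ` ?B) = card ?A + card ?B"
    by (subst card_Un_disjoint) (auto simp: card_image inj_on_def)
  ultimately show ?thesis by (simp add: letter_count_def)
qed

lemma row_counts:
  assumes "row_bounds l p1 p2 p3 p4"
  shows "card {j \<in> {1..l}. row p1 p2 p3 p4 j = One} = p1"
    "card {j \<in> {1..l}. row p1 p2 p3 p4 j = Two} = p2 - p1"
    "card {j \<in> {1..l}. row p1 p2 p3 p4 j = TwoBar} = p4 - p3"
    "card {j \<in> {1..l}. row p1 p2 p3 p4 j = OneBar} = l - p4"
proof -
  have "{j \<in> {1..l}. row p1 p2 p3 p4 j = One} = {1..p1}"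
    "{j \<in> {1..l}. row p1 p2 p3 p4 j = Two} = {p1<..p2}"
    "{j \<in> {1..l}. row p1 p2 p3 p4 j = TwoBar} = {p3<..p4}"
    "{j \<in> {1..l}. row p1 p2 p3 p4 j = OneBar} = {p4<..l}"
    using assms by (auto simp: row_def row_bounds_def split: if_splits)
  then show "card {j \<in> {1..l}. row p1 p2 p3 p4 j = One} = p1"
    "card {j \<in> {1..l}. row p1 p2 p3 p4 j = Two} = p2 - p1"
    "card {j \<in> {1..l}. row p1 p2 p3 p4 j = TwoBar} = p4 - p3"
    "card {j \<in> {1..l}. row p1 p2 p3 p4 j = OneBar} = l - p4" by simp_all
qed

text \<open>The right-hand side is \<lambda> - (b2 + b4) \<alpha>1 - (b1 + b3) \<alpha>2, the weight
  of the Verma vector with these exponents.\<close>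

lemma tableau_weight_of:
  assumes "admissible m1 m2 (b1, b2, b3, b4)"
  shows "tableau_weight (m1 + m2) m2 (tableau_of m1 m2 (b1, b2, b3, b4)) =
    weight_of (of_nat (m1 + m2) - of_nat b2 - of_nat b4)
      (of_nat m2 - of_nat b1 + of_nat b2 - of_nat b3 + of_nat b4)"
  using assms
proof (rule admissible_parameters)
  note bounds = tableau_of_bounds[OF assms]
  fix s o' t u w x p1 p2 p4 r2 r4
  assume *: "b1 div 2 = s" "b1 mod 2 = o'" "b1 = 2 * s + o'" "o' \<le> 1"
    "b3 div 2 = t" "b3 mod 2 = u" "b3 = 2 * t + u" "u \<le> 1"
    "m1 + m2 = p2 + u + t" "m1 + m2 = p4 + b4" "m2 = r2 + o' + s" "m2 = r4 + w"
    "(b2 - m1) div 2 = w" "ones m1 m2 b2 = p1"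
    and **: "b2 \<le> m1 \<and> w = 0 \<and> p1 + b2 = m1 + m2 \<or>
     b2 = m1 + 2 * w + x \<and> w + x > 0 \<and> p1 + w + x = m2 \<and> t + u \<le> m1 + w + x \<and> t \<le> m1 + w"
    "x \<le> 1" "t + u \<le> b2" "w \<le> s" "w + x \<le> s + o'" "b4 \<le> m1" "b4 \<le> t"
  have sub: "m1 + m2 - t - u = p2" "m1 + m2 - t = p2 + u" "m1 + m2 - b4 = p4" "m2 - s - o' = r2"
    "m2 - s = r2 + o'" "m2 - w = r4" "p2 + u - u = p2" "r2 + o' - o' = r2"
    using *(9-12) by simp_all
  note bounds' = bounds(1,2)[unfolded *(1,2,5,6,13,14) sub]
  let ?T = "tableau_of m1 m2 (b1, b2, b3, b4)"
  let ?c = "\<lambda>x. int (letter_count (m1 + m2) m2 ?T x)"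
  have le: "p1 \<le> p2" "p2 + u \<le> p4" "p4 \<le> m1 + m2" "r2 + o' \<le> r4" "r4 \<le> m2"
    using bounds' by (simp_all add: row_bounds_def)
  have counts: "?c One = int p1" "?c OneBar = (int (m1 + m2) - int p4) + (int m2 - int r4)"
    "?c Two = (int p2 - int p1) + int r2"
    "?c TwoBar = (int p4 - int p2 - int u) + (int r4 - int r2 - int o')"
    unfolding tableau_of.simps *(1,2,5,6,13,14) sub letter_count_tableau row_counts[OF bounds'(1)]
      row_counts[OF bounds'(2)] using le by (simp_all add: of_nat_diff)
  have "?c One - ?c OneBar = int (m1 + m2) - int b2 - int b4"
    unfolding counts using *(3,4,7-12) ** by (elim disjE conjE) linarith+
  moreover have "?c Two - ?c TwoBar = int m2 - int b1 + int b2 - int b3 + int b4"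
    unfolding counts using *(3,4,7-12) ** by (elim disjE conjE) linarith+
  ultimately have "(of_int (?c One - ?c OneBar) :: complex) = of_int (int (m1 + m2) - int b2 - int b4)"
    "(of_int (?c Two - ?c TwoBar) :: complex) = of_int (int m2 - int b1 + int b2 - int b3 + int b4)"
    by simp_all
  then show ?thesis unfolding tableau_weight_def by simp
qed

section \<open>Nilpotency and irreducibility\<close>

text \<open>Nonzero eigenvectors with distinct eigenvalues are independent, so a finitely spanned
  space cannot contain infinitely many.\<close>

lemma (in vector_space) no_infinite_eigenvector_sequence:
  assumes lin: "Vector_Spaces.linear scale scale T" and B: "finite B" "span B = UNIV"
    and z: "\<And>k::nat. T (z k) = scale (t k) (z k)" "inj t"
  shows "\<exists>k. z k = 0"
proof (rule ccontr)
  assume "\<not> (\<exists>k. z k = 0)"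
  then have nz: "z k \<noteq> 0" for k by blast
  have inj: "inj z"
  proof (rule injI)
    fix a b assume ab: "z a = z b"
    have "scale (t a) (z a) = scale (t b) (z a)"
      using z(1)[of a] z(1)[of b] unfolding ab by (rule trans[OF sym])
    then have "t a = t b" by (rule scale_right_imp_eq[OF nz])
    then show "a = b" by (rule injD[OF z(2)])
  qed
  have "independent (range z)"
    unfolding independent_explicit_module
  proof (intro allI impI)
    fix S u x assume S: "finite S" "S \<subseteq> range z" "(\<Sum>v\<in>S. scale (u v) v) = 0" "x \<in> S"
    interpret T: Vector_Spaces.linear scale scale T by (rule lin)
    obtain I where I: "S = z ` I" using S(2) by (auto simp: subset_image_iff)
    then have fin: "finite I" using S(1) inj by (simp add: finite_image_iff inj_on_subset)
    obtain i where i: "i \<in> I" "x = z i" using S(4) I by auto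
    have "(\<Sum>i\<in>I. scale (u (z i)) (z i)) = 0"
      using S(3) inj unfolding I by (simp add: sum.reindex inj_on_subset)
    then have sum: "(\<Sum>i\<in>I. scale (u (z i)) (z i)) \<in> {0}" by simp
    have "scale (u (z i)) (z i) \<in> {0}"
    proof (rule eigencomponents_in_subspace[OF _ _ lin fin _ _ sum i(1)])
      show "inj_on t I" using z(2) by (rule inj_on_subset) simp
      show "T (scale (u (z i)) (z i)) = scale (t i) (scale (u (z i)) (z i))" for i
        by (simp add: T.scale z(1) mult.commute)
    qed (simp_all add: T.zero)
    then show "u x = 0" using nz[of i] i(2) by simp
  qed
  then have "finite (range z)" using independent_span_bound[OF B(1)] B(2) by blast
  then show False using inj by (simp add: finite_image_iff)
qed

context spo_module
begin

lemma nilpotent_on_weight_vector: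
  assumes "finite B" "span B = UNIV" "wt x y u"
  shows "\<exists>k. (\<rho> f1 ^^ k) u = 0" "\<exists>k. (\<rho> f2 ^^ k) u = 0"
proof -
  have H1: "\<rho> H1 ((\<rho> f1 ^^ k) u) = (x - of_nat k) \<cdot> (\<rho> f1 ^^ k) u"
    and H2: "\<rho> H2 ((\<rho> f2 ^^ k) u) = (y - of_nat k) \<cdot> (\<rho> f2 ^^ k) u" for k
    using wt_pow(3,4)[OF assms(3), of k] by (simp_all add: wt_def)
  show "\<exists>k. (\<rho> f1 ^^ k) u = 0"
    by (rule no_infinite_eigenvector_sequence[OF rho_linear[OF spo_basis(1)] assms(1,2) H1])
      (simp add: inj_on_def)
  show "\<exists>k. (\<rho> f2 ^^ k) u = 0"
    by (rule no_infinite_eigenvector_sequence[OF rho_linear[OF spo_basis(2)] assms(1,2) H2])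
      (simp add: inj_on_def)
qed

text \<open>\<open>e1\<close>, \<open>e2\<close>, \<open>f1\<close>, \<open>f2\<close> generate the
  Lie superalgebra: all other root vectors and the Cartan elements are obtained from them by
  brackets and squares.\<close>

lemma stable_under_spo:
  assumes W: "subspace W" and "\<And>x. x \<in> W \<Longrightarrow> \<rho> e1 x \<in> W" "\<And>x. x \<in> W \<Longrightarrow> \<rho> e2 x \<in> W"
    "\<And>x. x \<in> W \<Longrightarrow> \<rho> f1 x \<in> W" "\<And>x. x \<in> W \<Longrightarrow> \<rho> f2 x \<in> W"
    and "X \<in> spo" "x \<in> W"
  shows "\<rho> X x \<in> W"
proof -
  note closed = subspace_add[OF W] subspace_diff[OF W] subspace_neg[OF W] subspace_scale[OF W] assms(2-5)
  have H2: "\<rho> H2 x \<in> W" if "x \<in> W" for x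
  proof -
    have "\<rho> H2 x = \<rho> e2 (\<rho> f2 x) + \<rho> f2 (\<rho> e2 x)" by (simp add: simple_relations)
    also have "\<dots> \<in> W" by (intro closed that)
    finally show ?thesis .
  qed
  have H1: "\<rho> H1 x \<in> W" if "x \<in> W" for x
  proof -
    have "\<rho> H1 x = \<rho> e1 (\<rho> f1 x) - \<rho> f1 (\<rho> e1 x) + \<rho> H2 x" by (simp add: simple_relations)
    also have "\<dots> \<in> W" by (intro closed H2 that)
    finally show ?thesis .
  qed
  have e3: "\<rho> e3 x \<in> W" if "x \<in> W" for x
    unfolding composite_e(1) by (intro closed that)
  have e4: "\<rho> e4 x \<in> W" if "x \<in> W" for x
    unfolding composite_e(2) by (intro closed e3 that)
  have e56: "\<rho> e5 x \<in> W" "\<rho> e6 x \<in> W" if "x \<in> W" for x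
    unfolding squares(1,3)[symmetric] by (intro closed e3 that)+
  have f3: "\<rho> f3 x \<in> W" if "x \<in> W" for x
  proof -
    have "\<rho> f3 x = \<rho> f2 (\<rho> f1 x) - \<rho> f1 (\<rho> f2 x)" by (simp add: simple_relations)
    also have "\<dots> \<in> W" by (intro closed that)
    finally show ?thesis .
  qed
  have f4: "\<rho> f4 x \<in> W" if "x \<in> W" for x
    unfolding composite_f by (intro closed f3 that)
  have f5: "\<rho> f5 x \<in> W" if "x \<in> W" for x
  proof -
    have "\<rho> f5 x = - \<rho> f3 (\<rho> f3 x)" by (simp add: squares)
    also have "\<dots> \<in> W" by (intro closed f3 that)
    finally show ?thesis .
  qed
  have f6: "\<rho> f6 x \<in> W" if "x \<in> W" for x
  proof -
    have "\<rho> f6 x = - \<rho> f2 (\<rho> f2 x)" by (simp add: squares)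
    also have "\<dots> \<in> W" by (intro closed that)
    finally show ?thesis .
  qed
  obtain a11 a12 a21 a22 b11 b12 b22 c11 c12 c22 p1 p2 q1 q2 where
    "X = spo_matrix a11 a12 a21 a22 b11 b12 b22 c11 c12 c22 p1 p2 q1 q2"
    using \<open>X \<in> spo\<close> unfolding spo_def by blast
  then have "\<rho> X x = a11 \<cdot> \<rho> H1 x + a12 \<cdot> \<rho> e1 x + a21 \<cdot> \<rho> f1 x + a22 \<cdot> \<rho> H2 x
    + b11 \<cdot> \<rho> e5 x + b12 \<cdot> \<rho> e4 x + b22 \<cdot> \<rho> e6 x + c11 \<cdot> \<rho> f5 x + c12 \<cdot> \<rho> f4 x + c22 \<cdot> \<rho> f6 x
    + p1 \<cdot> \<rho> e3 x + p2 \<cdot> \<rho> e2 x + (- q1) \<cdot> \<rho> f3 x + (- q2) \<cdot> \<rho> f2 x"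
    by (simp only: spo_matrix_expand rho_add spo_add spo_scale spo_basis bracket_simps)
  also have "\<dots> \<in> W"
    by (intro subspace_add[OF W] subspace_scale[OF W] H1 H2 e3 e4 e56 f3 f4 f5 f6 assms)
  finally show ?thesis .
qed

lemma generated_stable:
  assumes hw: "wt (of_nat l1) (of_nat l2) u" "\<rho> e1 u = 0" "\<rho> e2 u = 0" and x: "x \<in> generated u"
  shows "\<rho> e1 x \<in> generated u" "\<rho> e2 x \<in> generated u" "\<rho> f1 x \<in> generated u" "\<rho> f2 x \<in> generated u"
    "\<rho> H1 x \<in> generated u" "\<rho> H2 x \<in> generated u"
proof -
  have sub: "f_space u n1 n2 \<subseteq> generated u" for n1 n2 by (rule f_space_subset_generated[OF hw])
  have zero: "0 \<in> generated u" by (simp add: generated_def span_zero)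
  have word: "x \<in> f_space u n1 n2" if "f_word u n1 n2 x" for x n1 n2
    using that by (auto simp: f_space_def intro: span_base)
  have stable: "\<rho> X x \<in> generated u" if "X \<in> spo" "\<And>n1 n2 x. f_word u n1 n2 x \<Longrightarrow> \<rho> X x \<in> generated u" for X
    using rho_span[OF that(1), of "{x. \<exists>n1 n2. f_word u n1 n2 x}" "{x. \<exists>n1 n2. f_word u n1 n2 x}" x]
      that(2) x unfolding generated_def by blast
  show "\<rho> e1 x \<in> generated u"
  proof (rule stable[OF spo_basis(3)])
    fix n1 n2 x assume w: "f_word u n1 n2 x"
    show "\<rho> e1 x \<in> generated u"
    proof (cases n1)
      case 0
      then show ?thesis using e_f_space(1)[OF hw word[OF w]] zero by simp
    next
      case (Suc n)
      show ?thesis using e_f_space(2)[OF hw word[OF w] Suc] sub by blast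
    qed
  qed
  show "\<rho> e2 x \<in> generated u"
  proof (rule stable[OF spo_basis(11)])
    fix n1 n2 x assume w: "f_word u n1 n2 x"
    show "\<rho> e2 x \<in> generated u"
    proof (cases n2)
      case 0
      then show ?thesis using e_f_space(3)[OF hw word[OF w]] zero by simp
    next
      case (Suc n)
      show ?thesis using e_f_space(4)[OF hw word[OF w] Suc] sub by blast
    qed
  qed
  show "\<rho> f1 x \<in> generated u"
    by (rule stable[OF spo_basis(4)]) (use f_space_f(1) word sub in blast)
  show "\<rho> f2 x \<in> generated u"
    by (rule stable[OF spo_basis(12)]) (use f_space_f(2) word sub in blast)
  show "\<rho> H1 x \<in> generated u"
    by (rule stable[OF spo_basis(1)]) (use f_space_cartan(1)[OF hw] word sub in blast)
  show "\<rho> H2 x \<in> generated u"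
    by (rule stable[OF spo_basis(2)]) (use f_space_cartan(2)[OF hw] word sub in blast)
qed

end

section \<open>Nilpotency in the tensor power\<close>

lemma tensor_support:
  assumes "\<And>w. length w \<noteq> n \<Longrightarrow> g w = 0" "length w \<noteq> n"
  shows "act X g w = 0"
proof -
  have "act_word w X g = 0" if "\<And>s. length s = length w \<Longrightarrow> g s = 0" for w and g :: tensor
    using that by (induction w arbitrary: X g) simp_all
  then show ?thesis using assms unfolding act_def by metis
qed

lemma act_cartan_coordinate:
  "act H1 g w = of_int (\<Sum>l\<leftarrow>w. if l = 1 then 1 else if l = 3 then - 1 else 0) * g w"
  "act H2 g w = of_int (\<Sum>l\<leftarrow>w. if l = 2 then 1 else if l = 4 then - 1 else 0) * g w"
proof (induction w arbitrary: g)
  case (Cons l r)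
  have d: "(\<Sum>j\<in>UNIV. H1 $ l $ j * h j) = of_int (if l = 1 then 1 else if l = 3 then - 1 else 0) * h l"
    "(\<Sum>j\<in>UNIV. H2 $ l $ j * h j) = of_int (if l = 2 then 1 else if l = 4 then - 1 else 0) * h l"
    for h :: "5 \<Rightarrow> complex"
    using exhaust_5[of l] by (auto simp: sum_5 f_entries)
  { case 1
    then show ?case
      by (simp add: act_Cons[OF homogeneous_spo_part[OF even_basis(1)]] d Cons.IH parity_sign_def
          distrib_right del: of_int_add, simp add: distrib_right left_diff_distrib) }
  { case 2
    then show ?case
      by (simp add: act_Cons[OF homogeneous_spo_part[OF even_basis(2)]] d Cons.IH parity_sign_def
          distrib_right del: of_int_add, simp add: distrib_right left_diff_distrib) }
qed (simp_all add: act_Nil)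

text \<open>The space of all tensors is infinite dimensional, so weights bound the strings instead:
  on words of length \<open>n\<close> the eigenvalues of \<open>H1\<close> and \<open>H2\<close> are
  integers of absolute value at most \<open>n\<close>, whereas \<open>f1\<close> and
  \<open>f2\<close> shift one of them at every step.\<close>

lemma tensor_nilpotent:
  assumes supp: "\<And>w. length w \<noteq> n \<Longrightarrow> g w = 0" and wt: "tensor.wt x y g"
  shows "\<exists>k. (act f1 ^^ k) g = 0" "\<exists>k. (act f2 ^^ k) g = 0"
proof -
  have supp': "((act X ^^ k) g) w = 0" if "length w \<noteq> n" for X k w
    using that by (induction k arbitrary: w) (auto simp: supp intro: tensor_support)
  have bound: "\<bar>\<Sum>l\<leftarrow>w. d l\<bar> \<le> int (length w)" if "\<And>l. \<bar>d l\<bar> \<le> 1" for d :: "5 \<Rightarrow> int" and w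
  proof (induction w)
    case (Cons l w)
    then show ?case using that[of l] by simp
  qed simp
  have no: False if z: "\<And>k. \<exists>c::int. \<bar>c\<bar> \<le> int n \<and> z - of_nat k = of_int c" for z :: complex
  proof -
    obtain c where c: "\<bar>c\<bar> \<le> int n" "z - of_nat 0 = of_int c" using z[of 0] by blast
    \<comment> \<open>Two numbers at distance \<open>2 * n + 1\<close> cannot both lie between
      \<open>-n\<close> and \<open>n\<close>.\<close>
    obtain d where d: "\<bar>d\<bar> \<le> int n" "z - of_nat (2 * n + 1) = of_int d" using z[of "2 * n + 1"] by blast
    have "(of_int c :: complex) = of_int (d + int (2 * n + 1))"
      using d(2) c(2) by (simp add: algebra_simps)
    then have "c = d + int (2 * n + 1)" unfolding of_int_eq_iff .
    then show False using c(1) d(1) by linarith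
  qed
  show "\<exists>k. (act f1 ^^ k) g = 0"
  proof (rule ccontr)
    assume *: "\<not> (\<exists>k. (act f1 ^^ k) g = 0)"
    show False
    proof (rule no[of x])
      fix k
      obtain w where w: "((act f1 ^^ k) g) w \<noteq> 0" using * by (auto simp: fun_eq_iff)
      let ?d = "\<lambda>l::5. (if l = 1 then 1 else if l = 3 then - 1 else 0) :: int"
      have "act H1 ((act f1 ^^ k) g) = tscale (x - of_nat k) ((act f1 ^^ k) g)"
        using tensor.wt_pow(3)[OF wt, of k] by (simp add: tensor.wt_def)
      then have "(x - of_nat k) * ((act f1 ^^ k) g) w = of_int (\<Sum>l\<leftarrow>w. ?d l) * ((act f1 ^^ k) g) w"
        using act_cartan_coordinate(1)[of "(act f1 ^^ k) g" w] by simp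
      then have "x - of_nat k = of_int (\<Sum>l\<leftarrow>w. ?d l)" using w by simp
      moreover have "\<bar>\<Sum>l\<leftarrow>w. ?d l\<bar> \<le> int n"
      proof -
        have "length w = n" using supp'[where w = w and k = k and X = f1] w by blast
        moreover have "\<bar>\<Sum>l\<leftarrow>w. ?d l\<bar> \<le> int (length w)" by (rule bound) simp
        ultimately show ?thesis by simp
      qed
      ultimately show "\<exists>c::int. \<bar>c\<bar> \<le> int n \<and> x - of_nat k = of_int c" by blast
    qed
  qed
  show "\<exists>k. (act f2 ^^ k) g = 0"
  proof (rule ccontr)
    assume *: "\<not> (\<exists>k. (act f2 ^^ k) g = 0)"
    show False
    proof (rule no[of y])
      fix k
      obtain w where w: "((act f2 ^^ k) g) w \<noteq> 0" using * by (auto simp: fun_eq_iff)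
      let ?d = "\<lambda>l::5. (if l = 2 then 1 else if l = 4 then - 1 else 0) :: int"
      have "act H2 ((act f2 ^^ k) g) = tscale (y - of_nat k) ((act f2 ^^ k) g)"
        using tensor.wt_pow(4)[OF wt, of k] by (simp add: tensor.wt_def)
      then have "(y - of_nat k) * ((act f2 ^^ k) g) w = of_int (\<Sum>l\<leftarrow>w. ?d l) * ((act f2 ^^ k) g) w"
        using act_cartan_coordinate(2)[of "(act f2 ^^ k) g" w] by simp
      then have "y - of_nat k = of_int (\<Sum>l\<leftarrow>w. ?d l)" using w by simp
      moreover have "\<bar>\<Sum>l\<leftarrow>w. ?d l\<bar> \<le> int n"
      proof -
        have "length w = n" using supp'[where w = w and k = k and X = f2] w by blast
        moreover have "\<bar>\<Sum>l\<leftarrow>w. ?d l\<bar> \<le> int (length w)" by (rule bound) simp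
        ultimately show ?thesis by simp
      qed
      ultimately show "\<exists>c::int. \<bar>c\<bar> \<le> int n \<and> y - of_nat k = of_int c" by blast
    qed
  qed
qed

lemma hw_tensor_support: "length w \<noteq> m1 + 2 * m2 \<Longrightarrow> hw_tensor m1 m2 w = 0"
proof -
  have ins: "ins j y w = 0" if "\<And>w. length w \<noteq> n \<Longrightarrow> y w = 0" "length w \<noteq> Suc n" for j y n w
    using that by (cases w) auto
  have wedge: "wedge i j y w = 0" if "\<And>w. length w \<noteq> n \<Longrightarrow> y w = 0" "length w \<noteq> Suc (Suc n)" for i j y n w
    unfolding wedge_def minus_apply using ins[of "Suc n" "ins j y"] ins[of "Suc n" "ins i y"] ins[of n y] that
    by simp
  have base: "length w \<noteq> m1 \<Longrightarrow> ((ins 1 ^^ m1) unit_tensor) w = 0" for w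
    by (induction m1 arbitrary: w) (auto simp: unit_tensor_def intro: ins)
  show "length w \<noteq> m1 + 2 * m2 \<Longrightarrow> hw_tensor m1 m2 w = 0"
    unfolding hw_tensor_def
  proof (induction m2 arbitrary: w)
    case (Suc m2)
    show ?case using wedge[of "m1 + 2 * m2" "(wedge 1 2 ^^ m2) ((ins 1 ^^ m1) unit_tensor)" w] Suc by simp
  qed (simp add: base)
qed

section \<open>Transfer to the irreducible module\<close>

context spo_hw_module
begin

definition verma_vector :: "exponents \<Rightarrow> 'v" where
  "verma_vector = (\<lambda>(b1, b2, b3, b4). (\<rho> f1 ^^ b4) (Y b1 b2 b3))"

lemma wt_verma_vector:
  "wt (of_nat (m1 + m2) - of_nat b2 - of_nat b4)
    (of_nat m2 - of_nat b1 + of_nat b2 - of_nat b3 + of_nat b4) (verma_vector (b1, b2, b3, b4))"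
  unfolding verma_vector_def split_conv by (intro wt_pow wt_Y)

lemma verma_vectors_image:
  "verma_vector ` {b. admissible m1 m2 b} =
    {(\<rho> f1 ^^ b4) (Y b1 b2 b3) | b1 b2 b3 b4.
      b1 \<le> 2 * m2 \<and> b2 \<le> m1 + b1 \<and> b3 \<le> min (b2 + m1) (2 * b2) \<and> b4 \<le> min m1 (b3 div 2)}"
proof -
  have "verma_vector ` {b. admissible m1 m2 b} =
    {verma_vector (b1, b2, b3, b4) | b1 b2 b3 b4. admissible m1 m2 (b1, b2, b3, b4)}"
    by (simp only: image_Collect split_paired_Ex)
  then show ?thesis unfolding admissible.simps verma_vector_def split_conv .
qed

lemma verma_vectors_eq: "verma_vectors \<rho> v m1 m2 = verma_vector ` {b. admissible m1 m2 b}"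
proof -
  have half: "real b4 \<le> min (real m1) (real b3 / 2) \<longleftrightarrow> b4 \<le> min m1 (b3 div 2)" for b3 b4
  proof -
    have "real b4 \<le> real b3 / 2 \<longleftrightarrow> real (2 * b4) \<le> real b3" by (simp add: mult.commute)
    also have "\<dots> \<longleftrightarrow> b4 \<le> b3 div 2" unfolding of_nat_le_iff by linarith
    finally show ?thesis by simp
  qed
  show ?thesis unfolding verma_vectors_def verma_vectors_image Y_def half ..
qed

lemma span_verma_vectors: "span (verma_vectors \<rho> v m1 m2) = UNIV"
  using verma_span_UNIV unfolding verma_vectors_eq verma_vectors_image verma_span_def J_def .

text \<open>
  The highest weight vector \<open>(v, hw_tensor m1 m2)\<close> of the direct sum generates the graph of an
  isomorphism: a vector of this submodule with vanishing first component generates a submodule that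
  does not contain the highest weight vector, so it is 0.
\<close>

lemma verma_vectors_relation:
  assumes B: "finite B" "B \<subseteq> {b. admissible m1 m2 b}"
    and zero: "(\<Sum>b\<in>B. k b \<cdot> verma_vector b) = 0"
  shows "\<forall>b\<in>B. k b = 0"
proof -
  interpret P: spo_module "pscale scale" "pact \<rho>" by (rule product_module)
  let ?u = "(v, hw_tensor m1 m2)"
  have pow: "(pact \<rho> X ^^ n) (a, b) = ((\<rho> X ^^ n) a, (act X ^^ n) b)" for X n a b
    by (induction n) (simp_all add: pact_def)
  have hw_u: "P.wt (of_nat (m1 + m2)) (of_nat m2) ?u" "pact \<rho> e1 ?u = 0" "pact \<rho> e2 ?u = 0"
    using hw hw_tensor_hw[of m1 m2]
    by (auto simp: P.wt_def wt_def tensor.wt_def pact_def pscale_def zero_prod_def)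
  define x where "x b = (verma_vector b, verma b (hw_tensor m1 m2))" for b
  have gen: "P.generated ?u = module.span (pscale scale) {x. \<exists>n1 n2. P.f_word ?u n1 n2 x}"
    by (rule P.generated_def)
  note stable = P.generated_stable[OF hw_u]
  have x_gen: "x b \<in> P.generated ?u" for b
  proof -
    obtain b1 b2 b3 b4 where b: "b = (b1, b2, b3, b4)" by (cases b)
    have f: "(pact \<rho> f1 ^^ n) y \<in> P.generated ?u" "(pact \<rho> f2 ^^ n) y \<in> P.generated ?u"
      if "y \<in> P.generated ?u" for n y
      using that by (induction n) (auto intro: stable)
    have "?u \<in> P.generated ?u"
      unfolding gen by (rule P.span_base) (auto intro: P.f_word_base)
    then have "(pact \<rho> f1 ^^ b4) ((pact \<rho> f2 ^^ b3) ((pact \<rho> f1 ^^ b2) ((pact \<rho> f2 ^^ b1) ?u)))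
      \<in> P.generated ?u"
      by (intro f)
    then show ?thesis by (simp add: x_def b pow verma_vector_def Y_def verma.simps)
  qed
  have sub_gen: "P.subspace (P.generated ?u)" by (simp add: gen)
  define M where "M = {y \<in> P.generated ?u. fst y = 0}"
  have M: "P.subspace M"
  proof (rule P.subspaceI)
    show "0 \<in> M" using P.subspace_0[OF sub_gen] by (simp add: M_def)
    show "y + z \<in> M" if "y \<in> M" "z \<in> M" for y z
      using that P.subspace_add[OF sub_gen] by (simp add: M_def)
    show "pscale scale c y \<in> M" if "y \<in> M" for c y
      using that P.subspace_scale[OF sub_gen, of y c] by (simp add: M_def pscale_def)
  qed
  have stable_M: "pact \<rho> X y \<in> M"
    if "X \<in> spo" "\<And>y. y \<in> P.generated ?u \<Longrightarrow> pact \<rho> X y \<in> P.generated ?u" "y \<in> M" for X y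
    using that(2)[of y] that(1,3) by (cases y) (auto simp: M_def pact_def rho_simps)
  have components: "f_word v n1 n2 (fst y) \<and> tensor.f_word (hw_tensor m1 m2) n1 n2 (snd y)"
    if "P.f_word ?u n1 n2 y" for n1 n2 y
    using that
    by (induction rule: P.f_word.induct) (auto simp: pact_def intro: f_word.intros tensor.f_word.intros)
  have supp: "length w \<noteq> m1 + 2 * m2 \<Longrightarrow> g w = 0"
    if "tensor.f_word (hw_tensor m1 m2) n1 n2 g" for n1 n2 g w
    using that
    by (induction arbitrary: w rule: tensor.f_word.induct) (auto intro: hw_tensor_support tensor_support)
  have nil_t: "\<exists>j. (act f1 ^^ j) (snd y) = 0" "\<exists>j. (act f2 ^^ j) (snd y) = 0"
    if "P.f_word ?u n1 n2 y" for n1 n2 y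
  proof -
    have w: "tensor.f_word (hw_tensor m1 m2) n1 n2 (snd y)" using components[OF that] ..
    show "\<exists>j. (act f1 ^^ j) (snd y) = 0" "\<exists>j. (act f2 ^^ j) (snd y) = 0"
      using tensor_nilpotent[OF supp[OF w] tensor.wt_f_word[OF hw_tensor_hw(3,1,2) w]] by blast+
  qed
  have nil: "\<exists>j. (pact \<rho> X ^^ j) y = 0"
    if X: "X \<in> spo" and 1: "\<exists>j. (\<rho> X ^^ j) (fst y) = 0" and 2: "\<exists>j. (act X ^^ j) (snd y) = 0" for X y
  proof -
    obtain i j where ij: "(\<rho> X ^^ i) (fst y) = 0" "(act X ^^ j) (snd y) = 0" using 1 2 by blast
    have "(\<rho> X ^^ (j + i)) (fst y) = 0" using ij(1) by (simp add: funpow_add rho_pow_zero X)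
    moreover have "(act X ^^ (i + j)) (snd y) = 0" using ij(2) by (simp add: funpow_add tensor.rho_pow_zero X)
    ultimately have "(pact \<rho> X ^^ (i + j)) y = 0"
      using pow[where X = X and n = "i + j" and a = "fst y" and b = "snd y"]
      by (simp add: add.commute zero_prod_def)
    then show ?thesis ..
  qed
  define z where "z = (\<Sum>b\<in>B. pscale scale (k b) (x b))"
  have z_gen: "z \<in> P.generated ?u"
    unfolding z_def by (intro P.subspace_sum[OF sub_gen] P.subspace_scale[OF sub_gen] x_gen)
  have z_components: "fst z = (\<Sum>b\<in>B. k b \<cdot> verma_vector b)"
    "snd z = (\<Sum>b\<in>B. tscale (k b) (verma b (hw_tensor m1 m2)))"
    unfolding z_def by (simp_all add: fst_sum snd_sum pscale_def x_def)
  have "z \<in> M" using z_gen zero by (simp add: M_def z_components)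
  have "z = 0"
  proof (rule ccontr)
    assume "z \<noteq> 0"
    have "?u \<in> M"
    proof (rule P.generator_in_submodule[OF hw_u, where M = M and z = z])
      show "\<exists>j. (pact \<rho> f1 ^^ j) y = 0" if "P.f_word ?u n1 n2 y" for n1 n2 y
        by (rule nil[OF spo_basis(4) nilpotent_f1 nil_t(1)[OF that]])
      show "\<exists>j. (pact \<rho> f2 ^^ j) y = 0" if "P.f_word ?u n1 n2 y" for n1 n2 y
        by (rule nil[OF spo_basis(12) nilpotent_f2 nil_t(2)[OF that]])
      fix y assume y: "y \<in> M"
      show "pact \<rho> e1 y \<in> M" by (rule stable_M[OF spo_basis(3) stable(1) y])
      show "pact \<rho> e2 y \<in> M" by (rule stable_M[OF spo_basis(11) stable(2) y])
      show "pact \<rho> H1 y \<in> M" by (rule stable_M[OF spo_basis(1) stable(5) y])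
      show "pact \<rho> H2 y \<in> M" by (rule stable_M[OF spo_basis(2) stable(6) y])
    qed (use M \<open>z \<in> M\<close> \<open>z \<noteq> 0\<close> in \<open>auto simp: M_def\<close>)
    then show False using v_nonzero by (simp add: M_def)
  qed
  then have "(\<Sum>b\<in>B. tscale (k b) (verma b (hw_tensor m1 m2))) = 0" using z_components(2) by simp
  then show ?thesis by (rule verma_tensor_independent[OF B])
qed

lemma verma_vector_inj: "inj_on verma_vector {b. admissible m1 m2 b}"
proof (rule inj_onI, rule ccontr)
  fix a b assume *: "a \<in> {b. admissible m1 m2 b}" "b \<in> {b. admissible m1 m2 b}"
    "verma_vector a = verma_vector b" "a \<noteq> b"
  let ?k = "\<lambda>c. if c = a then 1 else - 1 :: complex"
  have "(\<Sum>c\<in>{a, b}. ?k c \<cdot> verma_vector c) = 0" using *(3,4) by simp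
  from verma_vectors_relation[OF _ _ this] * show False by auto
qed

lemma verma_vector_nonzero: "admissible m1 m2 b \<Longrightarrow> verma_vector b \<noteq> 0"
  using verma_vectors_relation[of "{b}" "\<lambda>_. 1"] by auto

lemma independent_verma_vectors: "independent (verma_vectors \<rho> v m1 m2)"
  unfolding independent_explicit_module
proof (intro allI impI)
  fix S k u assume S: "finite S" "S \<subseteq> verma_vectors \<rho> v m1 m2" "(\<Sum>u\<in>S. k u \<cdot> u) = 0" "u \<in> S"
  obtain B where B: "B \<subseteq> {b. admissible m1 m2 b}" "S = verma_vector ` B"
    using S(2) unfolding verma_vectors_eq subset_image_iff by blast
  have inj: "inj_on verma_vector B" using verma_vector_inj B(1) by (rule inj_on_subset)
  have "finite B" using S(1) inj unfolding B(2) by (simp add: finite_image_iff)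
  moreover have "(\<Sum>b\<in>B. k (verma_vector b) \<cdot> verma_vector b) = 0"
    using S(3) unfolding B(2) sum.reindex[OF inj] comp_def .
  ultimately have "\<forall>b\<in>B. k (verma_vector b) = 0" using B(1) by (intro verma_vectors_relation)
  then show "k u = 0" using S(4) unfolding B(2) by blast
qed

lemma weight_vector_verma_vector:
  assumes "admissible m1 m2 b"
  shows "weight_vector scale \<rho> (tableau_weight (m1 + m2) m2 (tableau_of m1 m2 b)) (verma_vector b)"
proof -
  obtain b1 b2 b3 b4 where b: "b = (b1, b2, b3, b4)" by (cases b)
  note wt = wt_verma_vector[of b2 b4 b1 b3]
  have "\<rho> (mat_scale c H1 + mat_scale d H2) (verma_vector b) =
    tableau_weight (m1 + m2) m2 (tableau_of m1 m2 b) (mat_scale c H1 + mat_scale d H2) \<cdot> verma_vector b"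
    for c d
  proof -
    have "eps1 (mat_scale c H1 + mat_scale d H2) = c" "eps2 (mat_scale c H1 + mat_scale d H2) = d"
      by (simp_all add: eps1_def eps2_def mat5_entries)
    then have coeff: "tableau_weight (m1 + m2) m2 (tableau_of m1 m2 b) (mat_scale c H1 + mat_scale d H2) =
      (of_nat (m1 + m2) - of_nat b2 - of_nat b4) * c +
      (of_nat m2 - of_nat b1 + of_nat b2 - of_nat b3 + of_nat b4) * d"
      unfolding b tableau_weight_of[OF assms[unfolded b]] weight_of_def by (simp only:)
    have "\<rho> (mat_scale c H1 + mat_scale d H2) u = (x * c + y * d) \<cdot> u" if "wt x y u" for x y u
      using that
      by (simp add: wt_def rho_add spo_scale spo_basis rho_scale scale_left_distrib mult.commute)
    from this[OF wt] show ?thesis unfolding coeff[symmetric] b[symmetric] .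
  qed
  then show ?thesis
    unfolding weight_vector_def cartan_def using verma_vector_nonzero[OF assms] by blast
qed

theorem verma_basis:
  "\<exists>\<Phi>. bij_betw \<Phi> (verma_vectors \<rho> v m1 m2) (KN_tableaux (m1 + m2) m2) \<and>
    (\<forall>u \<in> verma_vectors \<rho> v m1 m2. weight_vector scale \<rho> (tableau_weight (m1 + m2) m2 (\<Phi> u)) u)"
proof -
  let ?A = "{b. admissible m1 m2 b}"
  let ?\<Phi> = "tableau_of m1 m2 \<circ> inv_into ?A verma_vector"
  have bij: "bij_betw verma_vector ?A (verma_vectors \<rho> v m1 m2)"
    using verma_vector_inj by (simp add: bij_betw_def verma_vectors_eq)
  have "bij_betw ?\<Phi> (verma_vectors \<rho> v m1 m2) (KN_tableaux (m1 + m2) m2)"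
    by (rule bij_betw_trans[OF bij_betw_inv_into[OF bij] tableau_of_bij])
  moreover have "weight_vector scale \<rho> (tableau_weight (m1 + m2) m2 (?\<Phi> u)) u"
    if u: "u \<in> verma_vectors \<rho> v m1 m2" for u
  proof -
    obtain b where b: "b \<in> ?A" "u = verma_vector b" using u unfolding verma_vectors_eq by blast
    then have "inv_into ?A verma_vector u = b" using verma_vector_inj by simp
    then show ?thesis using weight_vector_verma_vector b by simp
  qed
  ultimately show ?thesis by blast
qed

end

context highest_weight_irrep
begin

sublocale spo_module cscale \<rho>
  by (intro spo_module.intro spo_module_axioms.intro vector_space_axioms)
    (fact rho_linear rho_add rho_scale rho_bracket)+

section \<open>The irreducible module is generated by its highest weight vector\<close>

lemma parts_unique:
  assumes "a \<in> V False" "b \<in> V True" "c \<in> V False" "d \<in> V True" "a + b = c + d"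
  shows "a = c" "b = d"
proof -
  have "a - c = d - b" using assms(5) by (simp add: algebra_simps)
  then have "a - c \<in> V False \<inter> V True"
    using subspace_diff[OF subspace_V assms(1,3)] subspace_diff[OF subspace_V assms(4,2)] by auto
  then show "a = c" using V_disjoint by simp
  then show "b = d" using assms(5) by simp
qed

text \<open>Irreducibility speaks about graded submodules. For homogeneous \<open>u\<close> every
  word in \<open>f1\<close> and \<open>f2\<close> applied to \<open>u\<close> is homogeneous, so the
  submodule generated by \<open>u\<close> is graded.\<close>

lemma homogeneous_generator:
  assumes hw: "wt (of_nat l1) (of_nat l2) u" "\<rho> e1 u = 0" "\<rho> e2 u = 0"
    and u: "u \<in> V p" "u \<noteq> 0"
  shows "generated u = UNIV"
proof -
  let ?S = "{x. \<exists>n1 n2. f_word u n1 n2 x}"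
  have homogeneous: "\<exists>q. x \<in> V q" if "f_word u n1 n2 x" for n1 n2 x
    using that
  proof (induction rule: f_word.induct)
    case (f_word_f1 n1 n2 x)
    then show ?case using rho_parity[OF even_basis(4)] by blast
  next
    case (f_word_f2 n1 n2 x)
    then show ?case using rho_parity[OF odd_basis(2)] by blast
  qed (use u in blast)
  have sub: "subspace (generated u)" by (simp add: generated_def)
  note stable = generated_stable[OF hw]
  have "\<exists>x \<in> generated u \<inter> V False. \<exists>y \<in> generated u \<inter> V True. z = x + y"
    if "z \<in> generated u" for z
    using that unfolding generated_def
  proof (induction rule: span_induct_alt)
    case base
    show ?case using span_zero subspace_0[OF subspace_V] by (intro bexI[of _ 0]) auto
  next
    case (step c x z)
    then obtain a b q where ab: "a \<in> span ?S \<inter> V False" "b \<in> span ?S \<inter> V True" "z = a + b"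
      and x: "x \<in> span ?S" "x \<in> V q" using homogeneous span_base[of x ?S] by blast
    have cx: "cscale c x \<in> span ?S" "cscale c x \<in> V q"
      using x by (simp_all add: span_scale subspace_scale subspace_V)
    show ?case
    proof (cases q)
      case True
      show ?thesis
        by (rule bexI[of _ a], rule bexI[of _ "cscale c x + b"])
          (use ab cx True in \<open>auto simp: subspace_add subspace_V intro: span_add\<close>)
    next
      case False
      show ?thesis
        by (rule bexI[of _ "cscale c x + a"], rule bexI[of _ b])
          (use ab cx False in \<open>auto simp: subspace_add subspace_V intro: span_add\<close>)
    qed
  qed
  moreover have "\<rho> X z \<in> generated u" if "X \<in> spo" "z \<in> generated u" for X z
    by (rule stable_under_spo[OF sub stable(1-4) that])
  ultimately have "graded_submodule (generated u)"
    unfolding graded_submodule_def using sub by blast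
  then have "generated u = {0} \<or> generated u = UNIV"
    using irreducible by (simp add: irreducible_rep_def)
  moreover have "u \<in> generated u"
    unfolding generated_def by (rule span_base) (auto intro: f_word_base)
  ultimately show ?thesis using u(2) by blast
qed

lemma nilpotent:
  assumes hw: "wt (of_nat l1) (of_nat l2) u" "\<rho> e1 u = 0" "\<rho> e2 u = 0" and "x \<in> generated u"
  shows "\<exists>k. (\<rho> f1 ^^ k) x = 0" "\<exists>k. (\<rho> f2 ^^ k) x = 0"
proof -
  obtain B where B: "finite B" "span B = UNIV" using finite_dim by (auto simp: finite_dim_rep_def)
  have "\<exists>k. (\<rho> f1 ^^ k) y = 0" "\<exists>k. (\<rho> f2 ^^ k) y = 0" if "f_word u n1 n2 y" for n1 n2 y
    using nilpotent_on_weight_vector[OF B wt_f_word[OF hw that]] by blast+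
  note word = this
  show "\<exists>k. (\<rho> f1 ^^ k) x = 0"
    by (rule nilpotent_generated[OF hw spo_basis(4) _ assms(4)]) (rule word(1))
  show "\<exists>k. (\<rho> f2 ^^ k) x = 0"
    by (rule nilpotent_generated[OF hw spo_basis(12) _ assms(4)]) (rule word(2))
qed

text \<open>The point is that \<open>v\<close> is homogeneous. Both of its parts are killed by
  \<open>e1\<close> and \<open>e2\<close> and have weight \<lambda>. If neither were 0, the even
  part would generate the module, and the line through the odd part, being stable under
  \<open>e1\<close>, \<open>e2\<close>, \<open>H1\<close> and \<open>H2\<close>, would contain the
  even part by \<open>generator_in_submodule\<close>. This contradicts the disjointness of the
  parities.\<close>

lemma spo_hw_module:
  assumes \<mu>: "\<mu> = weight_of (of_nat (m1 + m2)) (of_nat m2)"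
  shows "spo_hw_module cscale \<rho> m1 m2 v"
proof -
  have v: "v \<noteq> 0" and cartan: "\<And>h. h \<in> cartan \<Longrightarrow> \<rho> h v = cscale (\<mu> h) v"
    and root: "\<And>\<alpha> X. \<alpha> \<in> positive_roots \<Longrightarrow> X \<in> root_space \<alpha> \<Longrightarrow> \<rho> X v = 0"
    using highest_weight by (auto simp: highest_weight_vector_def weight_vector_def)
  have "H1 = mat_scale 1 H1 + mat_scale 0 H2" "H2 = mat_scale 0 H1 + mat_scale 1 H2"
    by (simp_all add: mat5_entries)
  then have "H1 \<in> cartan" "H2 \<in> cartan" unfolding cartan_def by blast+
  then have wt_v: "wt (of_nat (m1 + m2)) (of_nat m2) v"
    using cartan by (simp add: wt_def \<mu> weight_of_def eps_dual_basis)
  have e_v: "\<rho> e1 v = 0" "\<rho> e2 v = 0"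
    using root positive_roots_simple simple_root_vectors by blast+
  obtain v0 v1 where parts: "v0 \<in> V False" "v1 \<in> V True" "v = v0 + v1" using V_sum by blast
  have even: "\<rho> X v0 = cscale c v0 \<and> \<rho> X v1 = cscale c v1"
    if X: "X \<in> spo_part False" and eig: "\<rho> X v = cscale c v" for X c
  proof -
    have spo: "X \<in> spo" by (rule spo_part_subset[OF X])
    have "\<rho> X v0 \<in> V False" "\<rho> X v1 \<in> V True"
      using rho_parity[OF X parts(1)] rho_parity[OF X parts(2)] by simp_all
    moreover have "cscale c v0 \<in> V False" "cscale c v1 \<in> V True"
      using parts by (simp_all add: subspace_scale subspace_V)
    moreover have "\<rho> X v0 + \<rho> X v1 = cscale c v0 + cscale c v1"
      using eig by (simp add: parts(3) rho_simps[OF spo] scale_right_distrib)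
    ultimately show ?thesis using parts_unique by blast
  qed
  have wt: "wt (of_nat (m1 + m2)) (of_nat m2) v0" "wt (of_nat (m1 + m2)) (of_nat m2) v1"
    using even[OF even_basis(1)] even[OF even_basis(2)] wt_v by (simp_all add: wt_def)
  have e1: "\<rho> e1 v0 = 0" "\<rho> e1 v1 = 0"
    using even[OF even_basis(3), of 0] e_v(1) by simp_all
  have "\<rho> e2 v1 \<in> V False" "\<rho> e2 v0 \<in> V True"
    using rho_parity[OF odd_basis(1) parts(1)] rho_parity[OF odd_basis(1) parts(2)] by simp_all
  moreover have "\<rho> e2 v1 + \<rho> e2 v0 = 0 + 0"
    using e_v(2) by (simp add: parts(3) rho_basis_simps add.commute)
  ultimately have e2: "\<rho> e2 v0 = 0" "\<rho> e2 v1 = 0"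
    using parts_unique[of "\<rho> e2 v1" "\<rho> e2 v0" 0 0] subspace_0[OF subspace_V] by auto
  have "v0 = 0 \<or> v1 = 0"
  proof (rule ccontr)
    assume "\<not> (v0 = 0 \<or> v1 = 0)"
    then have nonzero: "v0 \<noteq> 0" "v1 \<noteq> 0" by auto
    note hw = wt(1) e1(1) e2(1)
    have gen: "generated v0 = UNIV" by (rule homogeneous_generator[OF hw parts(1) nonzero(1)])
    have "v0 \<in> span {v1}"
    proof (rule generator_in_submodule[OF hw, where M = "span {v1}" and z = v1])
      show "\<exists>k. (\<rho> f1 ^^ k) x = 0" "\<exists>k. (\<rho> f2 ^^ k) x = 0" for x
        using nilpotent[OF hw, of x] gen by simp_all
      show "\<rho> e1 x \<in> span {v1}" "\<rho> e2 x \<in> span {v1}" "\<rho> H1 x \<in> span {v1}" "\<rho> H2 x \<in> span {v1}"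
        if "x \<in> span {v1}" for x
        using that wt(2) e1(2) e2(2) by (auto simp: span_singleton rho_basis_simps wt_def)
    qed (use nonzero(2) gen in \<open>auto intro: span_base\<close>)
    then have "v0 \<in> V True" using parts(2) by (auto simp: span_singleton subspace_scale subspace_V)
    then show False using parts(1) V_disjoint nonzero(1) by blast
  qed
  then have gen: "generated v = UNIV"
    using homogeneous_generator[OF wt_v e_v] parts v by auto
  show ?thesis
    using wt_v e_v v gen nilpotent[OF wt_v e_v]
    by (intro spo_hw_module.intro spo_hw_module_axioms.intro spo_module_axioms) auto
qed

end

theorem mainTheorem1:
  fixes cscale :: "complex \<Rightarrow> 'v::ab_group_add \<Rightarrow> 'v"
    and V :: "bool \<Rightarrow> 'v set"
    and \<rho> :: "mat5 \<Rightarrow> 'v \<Rightarrow> 'v"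
    and v :: 'v
    and m1 m2 :: nat
  assumes "highest_weight_irrep cscale V \<rho> (weight_of (of_nat (m1 + m2)) (of_nat m2)) v"
  shows "(\<exists>\<Phi>. bij_betw \<Phi> (verma_vectors \<rho> v m1 m2) (KN_tableaux (m1 + m2) m2) \<and>
            (\<forall>u \<in> verma_vectors \<rho> v m1 m2.
               weight_vector cscale \<rho> (tableau_weight (m1 + m2) m2 (\<Phi> u)) u))
       \<and> (\<not> module.dependent cscale (verma_vectors \<rho> v m1 m2) \<and>
          module.span cscale (verma_vectors \<rho> v m1 m2) = UNIV)"
proof -
  interpret spo_hw_module cscale \<rho> m1 m2 v
    by (rule highest_weight_irrep.spo_hw_module[OF assms refl])
  show ?thesis using verma_basis independent_verma_vectors span_verma_vectors by blast
qed

end
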